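(* Let $n\in\mathbb{Z}_{>0}$, $r\in\mathbb{Z}_{\ge0}$, $x=(x_1,\dots,x_n)$, and $a,q,t$ generic with $|q|<1$. Then $$P^{(B_n)}_{(r)}(x|a;q,t)=\frac{(q;q)_r}{(t;q)_r}\sum_{0\le i+2j\le r}G_{r-i-2j}(x;q,t)\frac{(a;q)_i(t^{-n+1}q^{-r+1};q)_i(t^{-n}q^{-r};q)_{i+j}(t^{-2n+2}q^{-2r};q)_i(1/t;q)_j}{(q;q)_i(t^{-n+1}q^{-r};q)_i(t^{-n+1}q^{-r+1};q)_{i+j}(t^{-2n+2}q^{-2r+1}/a;q)_i(q;q)_j}\frac{1-t^{-n}q^{-r+i+2j}}{1-t^{-n}q^{-r}}\Big(\frac ta\Big)^i\Big(\frac{t^2}{q}\Big)^j,$$ where the sum is over $i,j\in\mathbb{Z}_{\ge0}$; and, setting $a=1$, $$P^{(D_n)}_{(r)}(x|q,t)=\frac{(q;q)_r}{(t;q)_r}\sum_{0\le 2j\le r}G_{r-2j}(x;q,t)\frac{(t^{-n}q^{-r};q)_j(1/t;q)_j}{(t^{-n+1}q^{-r+1};q)_j(q;q)_j}\frac{1-t^{-n}q^{-r+2j}}{1-t^{-n}q^{-r}}\Big(\frac{t^2}{q}\Big)^j.$$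
   Context: Notation: $(a_1,\dots,a_k;q)_n=\prod_{j=1}^k\prod_{i=0}^{n-1}(1-q^ia_j)$. Koornwinder polynomials: for parameters $a,b,c,d,q,t$ (generic, $|q|<1$), put $\alpha=(abcdq^{-1})^{1/2}$ and $$\mathcal{D}_x=\sum_{i=1}^n\frac{(1-ax_i)(1-bx_i)(1-cx_i)(1-dx_i)}{\alpha t^{n-1}(1-x_i^2)(1-qx_i^2)}\prod_{j\ne i}\frac{(1-tx_ix_j)(1-tx_i/x_j)}{(1-x_ix_j)(1-x_i/x_j)}(T_{q,x_i}-1)+\sum_{i=1}^n\frac{(1-a/x_i)(1-b/x_i)(1-c/x_i)(1-d/x_i)}{\alpha t^{n-1}(1-1/x_i^2)(1-q/x_i^2)}\prod_{j\ne i}\frac{(1-tx_j/x_i)(1-t/x_ix_j)}{(1-x_j/x_i)(1-1/x_ix_j)}(T_{q,x_i}^{-1}-1),$$ where $T_{q,x_i}^{\pm1}$ replaces $x_i$ by $q^{\pm1}x_i$. For a partition $\mu$ of length $\le n$, $P_\mu(x|a,b,c,d|q,t)$ is the unique Laurent polynomial invariant under permutations and inversions of the $x_i$, of the form $m_\mu+{}$(lower terms in dominance order), $m_\mu$ being the orbit sum of $x^\mu$, which is an eigenfunction of $\mathcal{D}_x$. The type $B_n$ and $D_n$ Macdonald polynomials are $P^{(B_n)}_\mu(x|a;q,t)=P_\mu(x|-1,a,-q^{1/2},q^{1/2}|q,t)$ and $P^{(D_n)}_\mu(x|q,t)=P^{(B_n)}_\mu(x|1;q,t)$. Define $G_r(x;q,t)$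 by $\prod_{i=1}^n\frac{(tux_i;q)_\infty(tu/x_i;q)_\infty}{(ux_i;q)_\infty(u/x_i;q)_\infty}=\sum_{r\ge0}G_r(x;q,t)u^r$.
   Formalization: The quotient of (t^{-n+1}q^{-r+1};q)_i by (t^{-n+1}q^{-r+1};q)_{i+j} is replaced by its cancelled form 1/(t^{-n+1}q^{-r+1+i};q)_j, because for n=1, i=r>0, j=0 it is 0/0; "generic" is spelled out as explicit non-vanishing conditions. *)

theory Defs
  imports "HOL-Complex_Analysis.Complex_Analysis"
begin

section \<open>Shifted factorials\<close>

definition qpoch :: "complex \<Rightarrow> complex \<Rightarrow> nat \<Rightarrow> complex" where
  "qpoch z q k = (\<Prod>i<k. 1 - q ^ i * z)"

definition qpoch_inf :: "complex \<Rightarrow> complex \<Rightarrow> complex" where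
  "qpoch_inf z q = (\<Prod>i. 1 - q ^ i * z)"

lemma qpoch_add: "qpoch z q (i + j) = qpoch z q i * qpoch (q ^ i * z) q j"
  by (induction j) (simp_all add: qpoch_def power_add mult_ac)

text \<open>
  The quotient of shifted factorials on the left is, as a rational function, the expression on
  the right. The right-hand side still makes sense when both factors on the left vanish, as happens for
  \<open>z = t powi (- int n + 1) * q powi (- int r + 1)\<close> with \<open>n = 1\<close>, \<open>i = r > 0\<close> and \<open>j = 0\<close>.
\<close>
lemma qpoch_quotient:
  assumes "qpoch z q i \<noteq> 0"
  shows "qpoch z q i / qpoch z q (i + j) = 1 / qpoch (q ^ i * z) q j"
  using assms by (simp add: qpoch_add)


section \<open>Laurent polynomials in n variables\<close>

text \<open>
  The variables are the coordinates \<open>x 0, \<dots>, x (n - 1)\<close> of a function on the natural numbers, so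
  that the index 0 here is the index 1 of the usual notation. Other coordinates never matter.
  Laurent polynomials are represented by the functions they induce.
\<close>

definition torus :: "nat \<Rightarrow> (nat \<Rightarrow> complex) set" where
  "torus n = {x. \<forall>i<n. x i \<noteq> 0}"

definition lmonom :: "nat \<Rightarrow> (nat \<Rightarrow> int) \<Rightarrow> (nat \<Rightarrow> complex) \<Rightarrow> complex" where
  "lmonom n v x = (\<Prod>i<n. x i powi v i)"

definition laurent_poly :: "nat \<Rightarrow> ((nat \<Rightarrow> complex) \<Rightarrow> complex) \<Rightarrow> bool" where
  "laurent_poly n f \<longleftrightarrow>
     (\<exists>V c. finite V \<and> f = (\<lambda>x. \<Sum>v\<in>V. c v * lmonom n v x))"

definition perm_inv_invariant :: "nat \<Rightarrow> ((nat \<Rightarrow> complex) \<Rightarrow> complex) \<Rightarrow> bool" where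
  "perm_inv_invariant n f \<longleftrightarrow>
     (\<forall>x\<in>torus n. (\<forall>p. p permutes {..<n} \<longrightarrow> f (x \<circ> p) = f x) \<and>
                    (\<forall>i<n. f (x(i := inverse (x i))) = f x))"


section \<open>Partitions, dominance order, orbit sums\<close>

text \<open>Partitions of length at most \<open>n\<close>, padded with zeros.\<close>

definition is_partition :: "nat \<Rightarrow> (nat \<Rightarrow> nat) \<Rightarrow> bool" where
  "is_partition n m \<longleftrightarrow> antimono m \<and> (\<forall>i\<ge>n. m i = 0)"

text \<open>
  The dominance order of type BC compares partitions of possibly different size.
\<close>
definition dominated :: "(nat \<Rightarrow> nat) \<Rightarrow> (nat \<Rightarrow> nat) \<Rightarrow> bool" where
  "dominated l m \<longleftrightarrow> (\<forall>k. (\<Sum>i<k. l i) \<le> (\<Sum>i<k. m i))"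

definition lower_partitions :: "nat \<Rightarrow> (nat \<Rightarrow> nat) \<Rightarrow> (nat \<Rightarrow> nat) set" where
  "lower_partitions n m = {l. is_partition n l \<and> dominated l m \<and> l \<noteq> m}"

definition row_partition :: "nat \<Rightarrow> nat \<Rightarrow> nat" where
  "row_partition r = (\<lambda>i. if i = 0 then r else 0)"

definition exponent_orbit :: "nat \<Rightarrow> (nat \<Rightarrow> nat) \<Rightarrow> (nat \<Rightarrow> int) set" where
  "exponent_orbit n m =
     {v. \<exists>p e. p permutes {..<n} \<and> (\<forall>i. e i \<in> {1, - 1}) \<and>
               v = (\<lambda>i. if i < n then e i * int (m (p i)) else 0)}"

definition orbit_sum :: "nat \<Rightarrow> (nat \<Rightarrow> nat) \<Rightarrow> (nat \<Rightarrow> complex) \<Rightarrow> complex" where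
  "orbit_sum n m x = (\<Sum>v\<in>exponent_orbit n m. lmonom n v x)"


section \<open>Koornwinder polynomials\<close>

text \<open>
  Replacing \<open>\<alpha>\<close> by \<open>-\<alpha>\<close> changes the sign of the operator \<open>koornwinder_op\<close> below, which does
  not affect its eigenfunctions, so the choice of the square root is immaterial.
\<close>
definition koornwinder_alpha ::
    "complex \<Rightarrow> complex \<Rightarrow> complex \<Rightarrow> complex \<Rightarrow> complex \<Rightarrow> complex" where
  "koornwinder_alpha a b c d q = csqrt (a * b * c * d / q)"

definition koornwinder_op ::
    "nat \<Rightarrow> complex \<Rightarrow> complex \<Rightarrow> complex \<Rightarrow> complex \<Rightarrow> complex \<Rightarrow> complex \<Rightarrow>
     ((nat \<Rightarrow> complex) \<Rightarrow> complex) \<Rightarrow> (nat \<Rightarrow> complex) \<Rightarrow> complex" where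
  "koornwinder_op n a b c d q t f x =
     (\<Sum>i<n.
        (1 - a * x i) * (1 - b * x i) * (1 - c * x i) * (1 - d * x i) /
        (koornwinder_alpha a b c d q * t ^ (n - 1) * (1 - (x i)\<^sup>2) * (1 - q * (x i)\<^sup>2)) *
        (\<Prod>j\<in>{..<n} - {i}.
           (1 - t * x i * x j) * (1 - t * x i / x j) /
           ((1 - x i * x j) * (1 - x i / x j))) *
        (f (x(i := q * x i)) - f x)) +
     (\<Sum>i<n.
        (1 - a / x i) * (1 - b / x i) * (1 - c / x i) * (1 - d / x i) /
        (koornwinder_alpha a b c d q * t ^ (n - 1) * (1 - 1 / (x i)\<^sup>2) * (1 - q / (x i)\<^sup>2)) *
        (\<Prod>j\<in>{..<n} - {i}.
           (1 - t * x j / x i) * (1 - t / (x i * x j)) /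
           ((1 - x j / x i) * (1 - 1 / (x i * x j)))) *
        (f (x(i := x i / q)) - f x))"

text \<open>The points at which no denominator of \<open>koornwinder_op\<close> vanishes.\<close>

definition koornwinder_regular :: "nat \<Rightarrow> complex \<Rightarrow> (nat \<Rightarrow> complex) set" where
  "koornwinder_regular n q =
     {x \<in> torus n.
        (\<forall>i<n. (x i)\<^sup>2 \<noteq> 1 \<and> q * (x i)\<^sup>2 \<noteq> 1 \<and> (x i)\<^sup>2 \<noteq> q) \<and>
        (\<forall>i<n. \<forall>j<n. i \<noteq> j \<longrightarrow> x i \<noteq> x j \<and> x i * x j \<noteq> 1)}"

definition is_koornwinder ::
    "nat \<Rightarrow> (nat \<Rightarrow> nat) \<Rightarrow>
     complex \<Rightarrow> complex \<Rightarrow> complex \<Rightarrow> complex \<Rightarrow> complex \<Rightarrow> complex \<Rightarrow>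
     ((nat \<Rightarrow> complex) \<Rightarrow> complex) \<Rightarrow> bool" where
  "is_koornwinder n m a b c d q t P \<longleftrightarrow>
     laurent_poly n P \<and> perm_inv_invariant n P \<and>
     (\<exists>k. P = (\<lambda>x. orbit_sum n m x + (\<Sum>l\<in>lower_partitions n m. k l * orbit_sum n l x))) \<and>
     (\<exists>E. \<forall>x\<in>koornwinder_regular n q. koornwinder_op n a b c d q t P x = E * P x)"

definition koornwinder ::
    "nat \<Rightarrow> (nat \<Rightarrow> nat) \<Rightarrow>
     complex \<Rightarrow> complex \<Rightarrow> complex \<Rightarrow> complex \<Rightarrow> complex \<Rightarrow> complex \<Rightarrow>
     (nat \<Rightarrow> complex) \<Rightarrow> complex" where
  "koornwinder n m a b c d q t = (THE P. is_koornwinder n m a b c d q t P)"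

text \<open>
  \<open>koornwinder_op\<close> acts on the orbit sums triangularly with respect to the dominance order, with
  the following diagonal entries. The Koornwinder polynomial of a partition exists and is unique
  as soon as its diagonal entry differs from those of all lower partitions. Unless \<open>q\<close> is a root of
  unity or \<open>a * b * c * d / q\<close> a negative power of \<open>q\<close>, the entries of distinct partitions are
  distinct as Laurent polynomials in \<open>t\<close>, so this excludes only finitely many nontrivial algebraic
  relations between the parameters.
\<close>
definition koornwinder_eigenvalue ::
    "nat \<Rightarrow> complex \<Rightarrow> complex \<Rightarrow> complex \<Rightarrow> complex \<Rightarrow> complex \<Rightarrow> complex \<Rightarrow>
     (nat \<Rightarrow> nat) \<Rightarrow> complex" where
  "koornwinder_eigenvalue n a b c d q t m =
     (\<Sum>i<n. koornwinder_alpha a b c d q * t ^ (n - 1 - i) * (q ^ m i - 1) +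
             (inverse (q ^ m i) - 1) / (koornwinder_alpha a b c d q * t ^ (n - 1 - i)))"

definition koornwinder_nondegenerate ::
    "nat \<Rightarrow> (nat \<Rightarrow> nat) \<Rightarrow>
     complex \<Rightarrow> complex \<Rightarrow> complex \<Rightarrow> complex \<Rightarrow> complex \<Rightarrow> complex \<Rightarrow> bool" where
  "koornwinder_nondegenerate n m a b c d q t \<longleftrightarrow>
     (\<forall>l\<in>lower_partitions n m.
        koornwinder_eigenvalue n a b c d q t l \<noteq> koornwinder_eigenvalue n a b c d q t m)"


section \<open>Macdonald polynomials of types B and D\<close>

text \<open>The other square root of \<open>q\<close> merely exchanges the last two Koornwinder parameters.\<close>

definition macdonald_B ::
    "nat \<Rightarrow> (nat \<Rightarrow> nat) \<Rightarrow> complex \<Rightarrow> complex \<Rightarrow> complex \<Rightarrow> (nat \<Rightarrow> complex) \<Rightarrow> complex" where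
  "macdonald_B n m a q t = koornwinder n m (- 1) a (- csqrt q) (csqrt q) q t"

definition macdonald_D ::
    "nat \<Rightarrow> (nat \<Rightarrow> nat) \<Rightarrow> complex \<Rightarrow> complex \<Rightarrow> (nat \<Rightarrow> complex) \<Rightarrow> complex" where
  "macdonald_D n m q t = macdonald_B n m 1 q t"

definition G_poly :: "nat \<Rightarrow> complex \<Rightarrow> complex \<Rightarrow> nat \<Rightarrow> (nat \<Rightarrow> complex) \<Rightarrow> complex" where
  "G_poly n q t r x =
     fps_nth (fps_expansion
       (\<lambda>u. \<Prod>i<n. qpoch_inf (t * u * x i) q * qpoch_inf (t * u / x i) q /
                     (qpoch_inf (u * x i) q * qpoch_inf (u / x i) q)) 0) r"

text \<open>
  Genericity, for given \<open>n\<close> and \<open>r\<close>: the parameters are nonzero, the Macdonald polynomial of the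
  one-row partition \<open>(r)\<close> is well defined, and no denominator vanishes in its expansion in the
  functions \<open>G_poly\<close>. Each condition excludes a proper algebraic subset of the parameter space,
  also within the hyperplane \<open>a = 1\<close> that corresponds to type D.
\<close>
definition generic_params :: "nat \<Rightarrow> nat \<Rightarrow> complex \<Rightarrow> complex \<Rightarrow> complex \<Rightarrow> bool" where
  "generic_params n r a q t \<longleftrightarrow>
     a \<noteq> 0 \<and> q \<noteq> 0 \<and> t \<noteq> 0 \<and>
     (\<forall>k<r. t * q ^ k \<noteq> 1) \<and>
     (\<forall>k\<in>{1..r}. t ^ (n - 1) * q ^ k \<noteq> 1) \<and>
     t ^ n * q ^ r \<noteq> 1 \<and>
     (\<forall>k\<in>{r..<2 * r}. a * t ^ (2 * n - 2) * q ^ k \<noteq> 1) \<and>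
     koornwinder_nondegenerate n (row_partition r) (- 1) a (- csqrt q) (csqrt q) q t"

end

theory Submission
  imports Defs "HOL-Combinatorics.Permutations"
begin

text \<open>
  Let \<open>g(u)\<close> be the generating function of the \<open>G\<^sub>r\<close>. The variables enter \<open>g(u)\<close> through a product,
  so applying the Koornwinder operator and summing residues of a rational function whose poles are
  the \<open>x\<^sub>i\<close>, the \<open>1/x\<^sub>i\<close> and a few points depending on \<open>u\<close> gives \<open>A(u) g(qu) + B(u) g(u/q) + C(u) g(u)\<close>.
  Hence \<open>\<Sum>\<^sub>k c\<^sub>k G\<^bsub>r-k\<^esub>\<close> is an eigenfunction as soon as \<open>c(u) = \<Sum>\<^sub>k c\<^sub>k u\<^sup>k\<close> solves the adjoint
  q-difference equation with \<open>s = t\<^sup>-\<^sup>n q\<^sup>-\<^sup>r\<close>. For \<open>a = 1\<close> that equation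
  has, up to a common elementary factor, eigenfunctions \<open>\<psi>\<^sub>i(u)\<close>, each \<open>u\<^sup>i\<close> times a basic hypergeometric series in \<open>u\<^sup>2\<close>; for general \<open>a\<close>, the
  operator multiplied by \<open>(1 - u)(1 - tu/q)\<close> is tridiagonal on the \<open>\<psi>\<^sub>i\<close>, so the coefficients
  of a solution in the \<open>\<psi>\<^sub>i\<close> obey a three-term recurrence that has a solution in product form.

  Uniqueness: at points whose coordinates tend to infinity at widely different rates, the leading
  term of an eigenfunction is a single partition, and it determines the eigenvalue.
\<close>

text \<open>In the equation for c(u), the numbers n and r occur only through s. Taking the
  coefficient of u^r in c(u) A(u) g(qu) moves the rescaling from g to c at the cost of a factor q^r,
  and the operator supplies t^(n-1); the product of the two is 1/(t s). So s can be a free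
  parameter, and only coefficients up to u^r matter in the end. The value a = 1 is special because
  there all coefficients of the conjugated equation are even in u, so that solutions of pure parity
  exist; a general a couples neighbouring parities, which is the source of the three-term
  recurrence. \<open>koornwinder\<close> is a definite description, so the explicit sum must be
  shown to satisfy every clause of its definition. Triangularity costs little: G_k contains only
  monomials of total absolute degree at most k, and (r) together with the partitions below it are
  exactly the partitions of size at most r with at most n parts. Uniqueness does not go through the
  triangular action of the operator on orbit sums. The operator is only evaluated at points, and its
  diagonal entries are recovered as limits.\<close>

section \<open>The adjoint q-difference equation\<close>

text \<open>
  The two polynomial identities are stated over an abstract ring so that \<open>algebra\<close> only meets variables.
\<close>
lemma ring_elim:
  fixes w t q S m2 m1 p0 p1 p2 :: "'a::idom"
  assumes "(1 - t^2*w)*m2 + t*S*(1 - q^2*w)*p0 = (1 + t*S)*(1 - t*q*w)*m1"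
    and "(1 - t^2*q*w)*m1 + t*S*(1 - q^3*w)*p1 = (1 + t*S)*(1 - t*q^2*w)*p0"
    and "(1 - t^2*q^2*w)*p0 + t*S*(1 - q^4*w)*p2 = (1 + t*S)*(1 - t*q^3*w)*p1"
  shows "(1 - t^2*q*w)*(1 - t^2*w)*(1 - t*q^3*w)*m2
       + t^2*S^2*(1 - q^3*w)*(1 - q^4*w)*(1 - t*q*w)*p2
       + t*S*(1 - t*q^2*w)*(q - t)*(t - 1)*q*(q+1)*w*p0
       = (1 + t^2*S^2)*(1 - t*q^2*w)*(1 - t*q^3*w)*(1 - t*q*w)*p0"
  using assms by algebra

text \<open>With X = q^2 U the hypotheses are one relation X g = (1 + (t/q) X^2) f, taken at X, X/q
  and q X. It makes \<open>mg\<close> and \<open>pg\<close> rational multiples of \<open>mf\<close>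
  and \<open>pf\<close>, so \<open>N 1\<close> applied to f and to g gives two linear expressions in
  \<open>mf\<close> and \<open>pf\<close>. These suffice to eliminate both from \<open>N a\<close>;
  the factors on the left clear the resulting denominators.\<close>

lemma ring_band:
  fixes U t q a T f g mf pf mg pg :: "'a::idom"
  assumes "q^2*U*g = (1 + t*q^3*U^2)*f"
    and "q*U*mg = (1 + t*q*U^2)*mf"
    and "q^3*U*pg = (1 + t*q^5*U^2)*pf"
  defines "N \<equiv> \<lambda>a m f p. (a - t*q*U)*(1+t*q*U)*(1-t^2*q*U^2)*(1-t*q^4*U^2)*m
     + T^2*(1-a*q^2*U)*(1+q^2*U)*(1-q^5*U^2)*(1-t*q^2*U^2)*p
     + T*(1-t*q^3*U^2)*(q-t)*q*U*((t-a)*q*(q+1)*U+(1-a)*(1+t*q^3*U^2))*f"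
  defines "D \<equiv> (1-t*q^3*U^2)*(1-t*q^4*U^2)*(1-t*q^2*U^2)"
  shows "(q^2-1)*(1-q^2*U)*(1-t*q*U)*N a mf f pf =
    (q^2-1)*(-(a*q+t)*q*U)*N 1 mf f pf + (q^2-a)*(1+t*q^3*U^2)*N 1 mf f pf + (a-1)*q^3*U*N 1 mg g pg
    + (q^2-1)*(t-q)*(a-1)*q*U*T*D*f"
  using assms(1-3) unfolding N_def D_def by algebra

section \<open>Rescaling and squaring the variable of a power series\<close>

definition fps_scale :: "complex \<Rightarrow> complex fps \<Rightarrow> complex fps" where
  "fps_scale c f = Abs_fps (\<lambda>k. c ^ k * fps_nth f k)"

lemma fps_scale_nth [simp]: "fps_nth (fps_scale c f) k = c ^ k * fps_nth f k"
  by (simp add: fps_scale_def)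

lemma fps_scale_add [simp]: "fps_scale c (f + g) = fps_scale c f + fps_scale c g"
  by (rule fps_ext) (simp add: algebra_simps)

lemma fps_scale_diff [simp]: "fps_scale c (f - g) = fps_scale c f - fps_scale c g"
  by (rule fps_ext) (simp add: algebra_simps)

lemma fps_scale_mult [simp]: "fps_scale c (f * g) = fps_scale c f * fps_scale c g"
proof (rule fps_ext)
  fix k
  have "c ^ k * (\<Sum>i=0..k. fps_nth f i * fps_nth g (k - i)) =
        (\<Sum>i=0..k. (c ^ i * fps_nth f i) * (c ^ (k - i) * fps_nth g (k - i)))"
    unfolding sum_distrib_left
  proof (intro sum.cong refl)
    fix i assume "i \<in> {0..k}"
    then have "c ^ k = c ^ i * c ^ (k - i)" by (simp flip: power_add)
    then show "c ^ k * (fps_nth f i * fps_nth g (k - i)) =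
        (c ^ i * fps_nth f i) * (c ^ (k - i) * fps_nth g (k - i))" by simp
  qed
  then show "fps_nth (fps_scale c (f * g)) k = fps_nth (fps_scale c f * fps_scale c g) k"
    by (simp add: fps_mult_nth)
qed

lemma fps_scale_const [simp]: "fps_scale c (fps_const a) = fps_const a"
  by (rule fps_ext) simp

lemma fps_scale_1 [simp]: "fps_scale c 1 = 1"
  by (rule fps_ext) simp

lemma fps_scale_X [simp]: "fps_scale c fps_X = fps_const c * fps_X"
  by (rule fps_ext) (simp add: fps_X_def)

lemma fps_scale_power [simp]: "fps_scale c (f ^ n) = fps_scale c f ^ n"
  by (induction n) simp_all

lemma fps_scale_one [simp]: "fps_scale 1 f = f"
  by (rule fps_ext) simp

lemma fps_scale_scale: "fps_scale c (fps_scale d f) = fps_scale (c * d) f"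
  by (rule fps_ext) (simp add: power_mult_distrib)

definition fps_even :: "complex fps \<Rightarrow> complex fps" where
  "fps_even f = fps_compose f (fps_X ^ 2)"

lemma fps_even_add [simp]: "fps_even (f + g) = fps_even f + fps_even g"
  by (simp add: fps_even_def fps_compose_add_distrib)

lemma fps_even_diff [simp]: "fps_even (f - g) = fps_even f - fps_even g"
  by (simp add: fps_even_def fps_compose_sub_distrib)

lemma fps_even_mult [simp]: "fps_even (f * g) = fps_even f * fps_even g"
  by (simp add: fps_even_def fps_compose_mult_distrib)

lemma fps_even_const [simp]: "fps_even (fps_const c) = fps_const c" "fps_even 1 = 1"
  "fps_even fps_X = fps_X ^ 2"
  by (simp_all add: fps_even_def)

lemma fps_even_nth: "fps_nth (fps_even f) k = (if even k then fps_nth f (k div 2) else 0)"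
  by (simp add: fps_even_def fps_nth_compose_X_power)

lemma fps_scale_even: "fps_scale c (fps_even f) = fps_even (fps_scale (c^2) f)"
  by (rule fps_ext) (auto simp: fps_even_nth power_mult [symmetric])

section \<open>Basic hypergeometric eigenfunctions at a = 1\<close>

text \<open>With S = s q^i this is the series 2phi1 with upper parameters S q and q/t, lower
  parameter t S q and argument t^2 X / q, multiplied by (s q; q)_i / (t s q; q)_i. Owing to this
  prefactor i enters a coefficient only through i + j, so series with neighbouring i share their
  factors.\<close>

definition hyp_fps :: "complex \<Rightarrow> complex \<Rightarrow> complex \<Rightarrow> nat \<Rightarrow> complex fps" where
  "hyp_fps q t s i = Abs_fps (\<lambda>j. qpoch (s * q) q (i + j) / qpoch (t * s * q) q (i + j) *
     (qpoch (q / t) q j / qpoch q q j * (t^2 / q) ^ j))"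

lemma qpoch_Suc: "qpoch z q (Suc k) = qpoch z q k * (1 - q ^ k * z)"
  by (simp add: qpoch_def)

lemma qpoch_0 [simp]: "qpoch z q 0 = 1"
  by (simp add: qpoch_def)

lemma qpoch_eq_0_iff: "qpoch z q k = 0 \<longleftrightarrow> (\<exists>i<k. q ^ i * z = 1)"
  by (auto simp: qpoch_def)

context
  fixes q t s :: complex
  assumes q0: "q \<noteq> 0" and t0: "t \<noteq> 0"
    and qk: "\<And>k. k > 0 \<Longrightarrow> q ^ k \<noteq> 1"
    and tsk: "\<And>k. k > 0 \<Longrightarrow> t * s * q ^ k \<noteq> 1"
begin

lemma denoms_nonzero: "qpoch q q k \<noteq> 0" "qpoch (t * s * q) q k \<noteq> 0"
  using qk[of "Suc _"] tsk[of "Suc _"] by (auto simp: qpoch_eq_0_iff mult_ac)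

lemma hyp_coeff_rec:
  "qpoch (s * q) q (Suc m) / qpoch (t * s * q) q (Suc m) * (1 - t * s * q * q ^ m) =
   qpoch (s * q) q m / qpoch (t * s * q) q m * (1 - s * q * q ^ m)" (is ?th1)
  "qpoch (q / t) q (Suc m) / qpoch q q (Suc m) * (t^2 / q) ^ Suc m * (1 - q * q ^ m) =
   qpoch (q / t) q m / qpoch q q m * (t^2 / q) ^ m * ((t - q * q ^ m) * t / q)" (is ?th2)
proof -
  show ?th1 using tsk[of "Suc m"] denoms_nonzero by (simp add: qpoch_Suc field_simps)
  show ?th2 using qk[of "Suc m"] denoms_nonzero q0 t0
    by (simp add: qpoch_Suc) (simp add: field_simps power2_eq_square)
qed

lemma hyp_fps_Suc:
  "fps_nth (hyp_fps q t s i) (Suc j) * (1 - q * q ^ j) * (1 - t * (s * q ^ i) * (q * q ^ j)) =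
   t^2 / q * (1 - (s * q ^ i) * (q * q ^ j)) * (1 - q / t * q ^ j) * fps_nth (hyp_fps q t s i) j"
proof -
  have "t^2 / q * (1 - q / t * q ^ j) = (t - q * q ^ j) * t / q"
    using q0 t0 by (simp add: field_simps power2_eq_square)
  moreover have "t^2 / q * X * (1 - q / t * q ^ j) * Y = X * Y * (t^2 / q * (1 - q / t * q ^ j))" for X Y
    by (simp only: mult_ac)
  ultimately have t2: "t^2 / q * X * (1 - q / t * q ^ j) * Y = X * Y * ((t - q * q ^ j) * t / q)" for X Y
    by (simp only:)
  show ?thesis unfolding t2
    using arg_cong2[OF hyp_coeff_rec(1)[of "i + j"] hyp_coeff_rec(2)[of j], of "(*)"]
    by (simp add: hyp_fps_def power_add mult_ac)
qed

text \<open>This is the two-term recursion \<open>hyp_fps_Suc\<close> read as a q-difference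
  equation. The free scale c allows it to be used at three consecutive q-shifts.\<close>

lemma hyp_fps_equation:
  fixes i :: nat and c :: complex
  defines "F \<equiv> hyp_fps q t s i" and "S \<equiv> s * q ^ i"
  shows "(1 - fps_const (c * t^2 / q) * fps_X) * fps_scale c F
     + fps_const (t * S) * (1 - fps_const (q * c) * fps_X) * fps_scale (q^2 * c) F
     = fps_const (1 + t * S) * (1 - fps_const (t * c) * fps_X) * fps_scale (q * c) F"
proof (rule fps_ext)
  fix k
  show "fps_nth ((1 - fps_const (c * t^2 / q) * fps_X) * fps_scale c F
     + fps_const (t * S) * (1 - fps_const (q * c) * fps_X) * fps_scale (q^2 * c) F) k
     = fps_nth (fps_const (1 + t * S) * (1 - fps_const (t * c) * fps_X) * fps_scale (q * c) F) k"
  proof (cases k)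
    case 0
    then show ?thesis by (simp add: distrib_right)
  next
    case (Suc j)
    define x where "x = q ^ j"
    define A where "A = fps_nth F (Suc j)"
    define B where "B = fps_nth F j"
    have AB: "A * (1 - q * x) * (1 - t * S * (q * x)) = t^2 / q * (1 - S * (q * x)) * (1 - q / t * x) * B"
      using hyp_fps_Suc[of i j] by (simp add: A_def B_def F_def S_def x_def)
    have "c ^ Suc j * A - c * t^2 / q * (c ^ j * B) + t * S * ((q^2*c) ^ Suc j * A - q * c * ((q^2 * c) ^ j * B))
      - (1 + t * S) * ((q * c) ^ Suc j * A - t * c * ((q * c) ^ j * B))
      = c ^ Suc j * (A * (1 - q * x) * (1 - t * S * (q * x)) - t^2 / q * (1 - S * (q * x)) * (1 - q / t * x) * B)"
      using q0 t0 by (simp add: power_mult_distrib flip: x_def power_mult)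
        (simp add: field_simps power2_eq_square power_mult flip: x_def)
    also have "\<dots> = 0" using AB by simp
    finally show ?thesis
      by (simp add: Suc A_def B_def algebra_simps)
  qed
qed

text \<open>In the coefficient of X^(j+1), all four terms are rational multiples of \<beta> (i + j +
  1) \<gamma> j; what remains is a rational identity in S and q^j.\<close>

lemma hyp_fps_contiguous:
  fixes i :: nat
  defines "S \<equiv> s * q ^ Suc i"
  shows "(1 + fps_const (t / q) * fps_X) * hyp_fps q t s (Suc i) =
     fps_const ((1 - S) / (1 - t * S)) * hyp_fps q t s i +
     fps_const (t / q * ((1 - t^2 * S) / (1 - t * S))) * fps_X * hyp_fps q t s (Suc (Suc i))"
proof (rule fps_ext)
  fix k
  have tS: "1 - t * S \<noteq> 0" using tsk[of "Suc i"] by (simp add: S_def mult_ac)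
  define \<beta> where "\<beta> = (\<lambda>m. qpoch (s * q) q m / qpoch (t * s * q) q m)"
  define \<gamma> where "\<gamma> = (\<lambda>j. qpoch (q / t) q j / qpoch q q j * (t^2 / q) ^ j)"
  have nth: "fps_nth (hyp_fps q t s i) j = \<beta> (i + j) * \<gamma> j" for i j
    by (simp add: hyp_fps_def \<beta>_def \<gamma>_def)
  have \<beta>: "\<beta> (Suc m) * (1 - t * s * q * q ^ m) = \<beta> m * (1 - s * q * q ^ m)" for m
    using hyp_coeff_rec(1)[of m] by (simp add: \<beta>_def)
  have \<gamma>: "\<gamma> (Suc j) * (1 - q * q ^ j) = \<gamma> j * (t - q * q ^ j) * t / q" for j
    using hyp_coeff_rec(2)[of j] by (simp add: \<gamma>_def mult_ac)
  show "fps_nth ((1 + fps_const (t / q) * fps_X) * hyp_fps q t s (Suc i)) k =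
     fps_nth (fps_const ((1 - S) / (1 - t * S)) * hyp_fps q t s i +
     fps_const (t / q * ((1 - t^2 * S) / (1 - t * S))) * fps_X * hyp_fps q t s (Suc (Suc i))) k"
  proof (cases k)
    case 0
    have "\<beta> (Suc i) * (1 - t * S) = (1 - S) * \<beta> i" using \<beta>[of i] by (simp add: S_def mult_ac)
    then have "\<beta> (Suc i) = (1 - S) / (1 - t * S) * \<beta> i" using tS by (simp add: field_simps)
    then show ?thesis using 0 by (simp add: nth)
  next
    case (Suc j)
    define x where "x = q ^ j"
    define B where "B = \<beta> (Suc (i + j))"
    define G where "G = \<gamma> j"
    have q1: "1 - q * x \<noteq> 0" using qk[of "Suc j"] by (simp add: x_def)
    have tq: "1 - t * S * (q * x) \<noteq> 0" using tsk[of "Suc (Suc i + j)"] by (simp add: S_def x_def power_add mult_ac)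
    have b1: "\<beta> (Suc (Suc (i + j))) = B * (1 - S * (q * x)) / (1 - t * S * (q * x))"
      using \<beta>[of "Suc (i + j)"] tq by (simp add: B_def S_def x_def power_add field_simps)
    have g1: "\<gamma> (Suc j) = G * (t - q * x) * t / (q * (1 - q * x))"
      using \<gamma>[of j] q1 q0 by (simp add: G_def x_def field_simps)
    have "\<beta> (Suc (Suc (i + j))) * \<gamma> (Suc j) + t / q * (B * G) = (1 - S) / (1 - t * S) * (B * \<gamma> (Suc j))
      + t / q * ((1 - t^2 * S) / (1 - t * S)) * (\<beta> (Suc (Suc (i + j))) * G)"
      unfolding b1 g1 using tq q1 tS q0
      by (simp add: divide_simps) (simp add: algebra_simps power2_eq_square)
    then show ?thesis by (simp add: Suc nth B_def G_def mult_ac distrib_left distrib_right)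
  qed
qed
end

definition psi_fps :: "complex \<Rightarrow> complex \<Rightarrow> complex \<Rightarrow> nat \<Rightarrow> complex fps" where
  "psi_fps q t s i = fps_X ^ i * fps_even (hyp_fps q t s i)"

text \<open>
  The adjoint q-difference operator, conjugated by the elementary factor of \<open>row_fps_eq\<close> and multiplied
  by its denominator \<open>dual_den\<close>. In terms of \<open>U = X / q\<^sup>2\<close> the coefficients involve no
  negative powers of \<open>q\<close>.
\<close>
definition dual_op :: "complex \<Rightarrow> complex \<Rightarrow> complex \<Rightarrow> complex \<Rightarrow> complex fps \<Rightarrow> complex fps" where
  "dual_op q t a w f = (let U = fps_const (1 / q^2) * fps_X; Q = fps_const q; T = fps_const t;
      A = fps_const a; W = fps_const w in
    (A - T*Q*U)*(1+T*Q*U)*(1-T^2*Q*U^2)*(1-T*Q^4*U^2) * fps_scale (1 / q) f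
     + W^2*(1-A*Q^2*U)*(1+Q^2*U)*(1-Q^5*U^2)*(1-T*Q^2*U^2)* fps_scale q f
     + W*(1-T*Q^3*U^2)*(Q-T)*Q*U*((T-A)*Q*(Q+1)*U+(1-A)*(1+T*Q^3*U^2))*f)"

definition dual_den :: "complex \<Rightarrow> complex \<Rightarrow> complex fps" where
  "dual_den q t = (let U = fps_const (1 / q^2) * fps_X; Q = fps_const q; T = fps_const t in
    (1-T*Q^3*U^2)*(1-T*Q^4*U^2)*(1-T*Q^2*U^2))"

context
  fixes q t s :: complex
  assumes q0: "q \<noteq> 0" and t0: "t \<noteq> 0" and s0: "s \<noteq> 0"
    and qk: "\<And>k. k > 0 \<Longrightarrow> q ^ k \<noteq> 1"
    and tsk: "\<And>k. k > 0 \<Longrightarrow> t * s * q ^ k \<noteq> 1"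
begin

text \<open>The operator shifts X by q, hence X^2 by q^2, while the hypergeometric equation steps by
  q. Its instances at c = 1/q^2, 1/q and 1 involve five shifts of the series;
  \<open>ring_elim\<close> removes the two odd ones, G (1/q) and G q, and leaves exactly the three
  shifts that the operator uses.\<close>

lemma psi_eigen:
  fixes i :: nat
  defines "S \<equiv> s * q ^ i"
  shows "dual_op q t 1 (t * s) (psi_fps q t s i) =
     fps_const (t * s * (1 / (t * S) + t * S)) * dual_den q t * psi_fps q t s i"
proof -
  define U where "U = fps_const (1 / q^2) * (fps_X :: complex fps)"
  define F where "F = hyp_fps q t s i"
  define G where "G = (\<lambda>c. fps_even (fps_scale c F))"
  have w: "fps_const q * U^2 = fps_const (1 / q^3) * fps_X^2"
  proof -
    have "q * (1 / q^2)^2 = 1 / q^3" using q0 by (simp add: field_simps eval_nat_numeral)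
    then show ?thesis by (simp only: U_def power_mult_distrib fps_const_power fps_const_mult flip: mult.assoc)
  qed
  have c: "fps_const (c / q^3) * fps_X^2 = fps_const c * (fps_const q * U^2)" for c
  proof -
    have "c / q^3 = c * (1 / q^3)" by simp
    then show ?thesis unfolding w by (simp only: fps_const_mult flip: mult.assoc)
  qed
  have eq: "(1 - fps_const (c * t^2 / q) * fps_X^2) * G c
     + fps_const (t * S) * (1 - fps_const (q * c) * fps_X^2) * G (q^2 * c)
     = fps_const (1 + t * S) * (1 - fps_const (t * c) * fps_X^2) * G (q * c)" for c
    using arg_cong[OF hyp_fps_equation[OF q0 t0 qk tsk, of c i], of fps_even, folded F_def S_def]
    by (simp add: G_def)
  have n: "1 / q^2 * t^2 / q = t^2 / q^3" "q * (1 / q^2) = q^2 / q^3" "t * (1 / q^2) = t * q / q^3"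
    "q^2 * (1/q^2) = 1" "q^2 / q^3 = 1 / q"
    "1 / q * t^2 / q = t^2 * q / q^3" "q * (1 / q) = q^3 / q^3" "t * (1 / q) = t * q^2 / q^3"
    "q^2 * (1/q) = q" "1 * t^2 / q = t^2 * q^2 / q^3" "q * 1 = q ^ 4 / q ^ 3" "t * 1 = t * q^3 / q^3"
    "q^2 * 1 = q^2"
    using q0 by (simp_all add: field_simps eval_nat_numeral)
  define Q T S' w where "Q = fps_const q" and "T = fps_const t" and "S' = fps_const S" and "w = Q * U^2"
  have q43: "q ^ 4 / q ^ 3 = q" using q0 by (simp add: eval_nat_numeral)
  have cs1: "fps_const (1 + t * S) = 1 + fps_const (t * S)"
    by (simp flip: fps_const_add)
  have e0: "(1 - T^2*w)*G (1/q^2) + T*S'*(1 - Q^2*w)*G 1 = (1 + T*S')*(1 - T*Q*w)*G (1/q)"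
    using eq[of "1/q^2"]
    unfolding n(1-4) c unfolding n(5) by (simp add: w_def Q_def T_def S'_def cs1)
  have e1: "(1 - T^2*Q*w)*G (1/q) + T*S'*(1 - Q^3*w)*G q = (1 + T*S')*(1 - T*Q^2*w)*G 1"
    using eq[of "1/q"] unfolding n(6-9) c using q0 by (simp add: w_def Q_def T_def S'_def cs1)
  have e2: "(1 - T^2*Q^2*w)*G 1 + T*S'*(1 - Q^4*w)*G (q^2) = (1 + T*S')*(1 - T*Q^3*w)*G q"
    using eq[of 1] q43 unfolding n(10-13) c by (simp add: w_def Q_def T_def S'_def cs1)
  define P P' Y where "P = fps_const (1 / q) ^ i" and "P' = Q ^ i" and "Y = (fps_X :: complex fps) ^ i"
  have P: "P * P' = 1"
    using q0 by (simp add: P_def P'_def Q_def flip: power_mult_distrib)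
  have S': "S' = fps_const s * P'" unfolding P'_def
    by (simp add: S'_def S_def Q_def fps_const_power)
  have "t * s * (1 / (t * S) + t * S) = (1 / q) ^ i * (1 + t^2 * S^2)"
    using q0 t0 s0 by (simp add: S_def field_simps power2_eq_square)
  then have K: "fps_const (t * s * (1 / (t * S) + t * S)) = fps_const (1 / q) ^ i * (1 + T^2 * S'^2)"
    by (simp add: T_def S'_def fps_const_power flip: fps_const_mult fps_const_add)
  have psi: "psi_fps q t s i = fps_X ^ i * G 1"
    by (simp add: psi_fps_def G_def F_def)
  have sc: "fps_scale (1 / q) (fps_X ^ i * G 1) = fps_const (1 / q) ^ i * fps_X ^ i * G (1 / q^2)"
    "fps_scale q (fps_X ^ i * G 1) = Q ^ i * fps_X ^ i * G (q^2)"
    by (simp_all add: G_def fps_scale_even fps_scale_scale power_mult_distrib power_one_over Q_def)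
  have W: "fps_const (t * s) = T * fps_const s"
    by (simp add: T_def)
  show ?thesis
    using ring_elim[OF e0 e1 e2] P S'
    unfolding dual_op_def dual_den_def Let_def psi K sc W w_def fps_const_1_eq_1
    unfolding U_def [symmetric] Q_def[symmetric] T_def[symmetric]
      P_def[symmetric] P'_def[symmetric] Y_def[symmetric]
    by algebra
qed

text \<open>Multiplication by (1 + (t/q) X^2) / X thus sends an eigenfunction to a combination of
  its two neighbours, which have the opposite parity. This gives the companion series g that
  \<open>ring_band\<close> asks for.\<close>

lemma psi_contiguous:
  fixes i :: nat
  defines "S \<equiv> s * q ^ Suc i"
  shows "fps_X * (fps_const ((1 - S) / (1 - t * S)) * psi_fps q t s i +
      fps_const (t / q * ((1 - t^2 * S) / (1 - t * S))) * psi_fps q t s (Suc (Suc i))) =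
    (1 + fps_const (t / q) * fps_X^2) * psi_fps q t s (Suc i)"
proof -
  have "(1 + fps_const (t / q) * fps_X^2) * fps_even (hyp_fps q t s (Suc i)) =
     fps_const ((1 - S) / (1 - t * S)) * fps_even (hyp_fps q t s i) +
     fps_const (t / q * ((1 - t^2 * S) / (1 - t * S))) * fps_X^2 * fps_even (hyp_fps q t s (Suc (Suc i)))"
    using arg_cong[OF hyp_fps_contiguous[OF q0 t0 qk tsk, of i], of fps_even, folded S_def]
    by (simp del: fps_const_divide)
  moreover define Y where "Y = (fps_X :: complex fps) ^ i"
  ultimately show ?thesis
    unfolding psi_fps_def power_Suc Y_def [symmetric] by algebra
qed

end

lemma dual_op_add: "dual_op q t a w (f + g) = dual_op q t a w f + dual_op q t a w g"
  by (simp add: dual_op_def Let_def distrib_left)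

lemma dual_op_const: "dual_op q t a w (fps_const c * f) = fps_const c * dual_op q t a w f"
  by (simp add: dual_op_def Let_def distrib_left mult.left_commute)

text \<open>
  The operator \<open>dual_op\<close> is affine in \<open>a\<close>, which reduces the claim to the eigenvalue equations at \<open>a = 1\<close>
  and the contiguous relation.
\<close>
lemma dual_op_band:
  fixes q t s a :: complex and i :: nat
  assumes q0: "q \<noteq> 0" and t0: "t \<noteq> 0" and s0: "s \<noteq> 0"
    and qk: "\<And>k. k > 0 \<Longrightarrow> q ^ k \<noteq> 1"
    and tsk: "\<And>k. k > 0 \<Longrightarrow> t * s * q ^ k \<noteq> 1"
  fixes E :: complex
  defines "S \<equiv> s * q ^ Suc i"
  shows "(1 - fps_X) * (1 - fps_const (t / q) * fps_X) *
      (dual_op q t a (t * s) (psi_fps q t s (Suc i))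
        - fps_const (t * s * E) * dual_den q t * psi_fps q t s (Suc i)) =
    fps_const (t * s) * dual_den q t * fps_X *
      (fps_const ((1 - S) / (1 - t * S) * (a / (t * S) + t * S - E)) * psi_fps q t s i
       + fps_const ((1 + t / q) * E - (a + t / q) * (1 / (t * S) + t * S) + (t - q) * (a - 1) / q)
          * psi_fps q t s (Suc i)
       + fps_const (t / q * ((1 - t^2 * S) / (1 - t * S)) * (1 / (t * S) + a * t * S - E))
          * psi_fps q t s (Suc (Suc i)))"
proof -
  define p r where "p = (1 - S) / (1 - t * S)" and "r = t / q * ((1 - t^2 * S) / (1 - t * S))"
  define f where "f = psi_fps q t s (Suc i)"
  \<comment> \<open>By \<open>psi_contiguous\<close>, X g = (1 + (t/q) X^2) f. As a combination of
    two eigenfunctions, g has a known image under the operator at a = 1.\<close>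
  define g where "g = fps_const p * psi_fps q t s i + fps_const r * psi_fps q t s (Suc (Suc i))"
  define U where "U = fps_const (1 / q^2) * (fps_X :: complex fps)"
  define Q T A W where "Q = fps_const q" and "T = fps_const t" and "A = fps_const a"
    and "W = fps_const (t * s)"
  define x y where "x = 1 / (t * S)" and "y = t * S"
  define Qi where "Qi = fps_const (1 / q)"
  have Qi: "Q * Qi = 1" using q0 by (simp add: Q_def Qi_def)
  have X: "fps_X = Q^2 * U" using q0 by (simp add: U_def Q_def fps_const_power flip: mult.assoc)
  have TQ: "fps_const (t / q) = T * Qi" by (simp add: T_def Qi_def)
  have fg: "fps_X * g = (1 + T * Qi * fps_X^2) * f"
    using psi_contiguous[OF assms(1-3) qk tsk, of i] unfolding TQ [symmetric]
    by (simp add: f_def g_def p_def r_def S_def)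
  have c1: "Q^2 * U * g = (1 + T * Q^3 * U^2) * f"
    using fg Qi unfolding X by algebra
  have "Qi * fps_X * fps_scale (1/q) g = (1 + T * Qi * (Qi * fps_X)^2) * fps_scale (1/q) f"
    using arg_cong[OF fg, of "fps_scale (1/q)"] by (simp add: T_def Qi_def)
  then have c2: "Q * U * fps_scale (1/q) g = (1 + T * Q * U^2) * fps_scale (1/q) f"
    using Qi unfolding X by algebra
  have "Q * fps_X * fps_scale q g = (1 + T * Qi * (Q * fps_X)^2) * fps_scale q f"
    using arg_cong[OF fg, of "fps_scale q"] by (simp add: T_def Qi_def Q_def)
  then have c3: "Q^3 * U * fps_scale q g = (1 + T * Q^5 * U^2) * fps_scale q f"
    using Qi unfolding X by algebra
  have S: "S \<noteq> 0" using s0 q0 by (simp add: S_def)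
  have e: "1 / (t * (s * q ^ i)) + t * (s * q ^ i) = q * x + 1 / q * y"
     "1 / (t * (s * q ^ Suc i)) + t * (s * q ^ Suc i) = x + y"
     "1 / (t * (s * q ^ Suc (Suc i))) + t * (s * q ^ Suc (Suc i)) = 1 / q * x + q * y"
    using q0 t0 s0 by (simp_all add: x_def y_def S_def field_simps)
  have cm: "fps_const (u * v) = fps_const u * fps_const v"
    "fps_const (u + v) = fps_const u + fps_const v"
    "fps_const (u - v) = fps_const u - fps_const v" for u v :: complex
    by simp_all
  have eig: "dual_op q t 1 (t * s) (psi_fps q t s j) =
     fps_const (t * s * (1 / (t * (s * q ^ j)) + t * (s * q ^ j))) * dual_den q t * psi_fps q t s j" for j
    using psi_eigen[OF assms(1-3)] qk tsk by blast
  have N1: "dual_op q t 1 (t * s) f = W * (fps_const x + fps_const y) * dual_den q t * f"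
    using eig[of "Suc i"] unfolding e cm(1)[of "t * s"]
    unfolding f_def W_def cm(2) by simp
  have N2: "dual_op q t 1 (t * s) g = W * dual_den q t *
     (fps_const p * (Q * fps_const x + Qi * fps_const y) * psi_fps q t s i +
      fps_const r * (Qi * fps_const x + Q * fps_const y) * psi_fps q t s (Suc (Suc i)))"
    unfolding g_def dual_op_add dual_op_const eig e
    unfolding W_def Q_def Qi_def cm(1)[of "t * s"] cm(2) cm(1)[of q] cm(1)[of "1 / q"] by algebra
  define D where "D = dual_den q t"
  have Dd: "D = (1-T*Q^3*U^2)*(1-T*Q^4*U^2)*(1-T*Q^2*U^2)"
    by (simp add: D_def dual_den_def Let_def T_def Q_def U_def)
  have band: "(Q^2-1)*(1-Q^2*U)*(1-T*Q*U)*dual_op q t a (t * s) f =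
    (Q^2-1)*(-(A*Q+T)*Q*U)*dual_op q t 1 (t * s) f
    + (Q^2-A)*(1+T*Q^3*U^2)*dual_op q t 1 (t * s) f + (A-1)*Q^3*U*dual_op q t 1 (t * s) g
    + (Q^2-1)*(T-Q)*(A-1)*Q*U*W*D*f"
    using ring_band[OF c1 c2 c3, of A W] unfolding Dd dual_op_def Let_def fps_const_1_eq_1
    unfolding Q_def [symmetric] T_def [symmetric] A_def [symmetric] W_def[symmetric]
      U_def [symmetric] .
  have ra: "a / (t * S) + t * S - E = a * x + y - E" "1 / (t * S) + a * t * S - E = x + a * y - E"
     "(1 + t / q) * E - (a + t / q) * (1 / (t * S) + t * S) + (t - q) * (a - 1) / q =
      (1 + t * (1/q)) * E - (a + t * (1/q)) * (x + y) + (t - q) * (a - 1) * (1/q)"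
    by (simp_all add: x_def y_def)
  have "(Q^2 - 1) * ((1 - fps_X) * (1 - T * Qi * fps_X) *
      (dual_op q t a (t * s) f - W * fps_const E * dual_den q t * f)) =
     (Q^2 - 1) * (W * dual_den q t * fps_X *
      (fps_const p * (A * fps_const x + fps_const y - fps_const E) * psi_fps q t s i
       + ((1 + T * Qi) * fps_const E - (A + T * Qi) * (fps_const x + fps_const y) + (T - Q) * (A - 1) * Qi)
          * f
       + fps_const r * (fps_const x + A * fps_const y - fps_const E)
          * psi_fps q t s (Suc (Suc i))))"
    using band N1 N2 g_def Qi fg X unfolding D_def[symmetric] by algebra
  moreover have "Q^2 - 1 \<noteq> 0"
    using qk[of 2] by (simp add: Q_def fps_const_power flip: fps_const_1_eq_1)
  ultimately have "(1 - fps_X) * (1 - T * Qi * fps_X) *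
      (dual_op q t a (t * s) f - W * fps_const E * dual_den q t * f) =
     W * dual_den q t * fps_X *
      (fps_const p * (A * fps_const x + fps_const y - fps_const E) * psi_fps q t s i
       + ((1 + T * Qi) * fps_const E - (A + T * Qi) * (fps_const x + fps_const y) + (T - Q) * (A - 1) * Qi)
          * f
       + fps_const r * (fps_const x + A * fps_const y - fps_const E)
          * psi_fps q t s (Suc (Suc i)))"
    using mult_cancel_left by blast
  then show ?thesis
    unfolding ra p_def[symmetric] r_def[symmetric] TQ cm(1)[of "t * s"]
    unfolding f_def W_def T_def Q_def A_def Qi_def by (simp add: mult_ac)
qed

section \<open>Three-term recurrence and the adjoint equation for general a\<close>

text \<open>
  The product solution of the three-term recurrence, and the resulting eigenfunction. The summand
  \<open>psi_fps q t (s / q) (Suc i)\<close> has order \<open>i + 1\<close>; dividing by this extra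
  factor \<open>X\<close> shifts the parameter of the equation from \<open>s / q\<close> to \<open>s\<close>.
\<close>
definition conn_coeff :: "complex \<Rightarrow> complex \<Rightarrow> complex \<Rightarrow> complex \<Rightarrow> nat \<Rightarrow> complex" where
  "conn_coeff q t a s i = qpoch a q i * qpoch (t^2 * s^2) q i * (1 - t * s * q ^ i) /
     (qpoch q q i * qpoch (t^2 * s^2 * q / a) q i * (1 - t * s)) * (t / a) ^ i"

definition conn_fps :: "complex \<Rightarrow> complex \<Rightarrow> complex \<Rightarrow> complex \<Rightarrow> complex fps" where
  "conn_fps q t a s = Abs_fps (\<lambda>k. \<Sum>i\<le>k. conn_coeff q t a s i * fps_nth (psi_fps q t (s / q) (Suc i)) k)"

text \<open>For s = t^(-n) q^(-r) this is the factor of G_(r-i-2j) in the theorem. The quotient (t s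
  q; q)_i / (t s q; q)_(i+j) appears in its reduced form.\<close>

definition row_coeff :: "complex \<Rightarrow> complex \<Rightarrow> complex \<Rightarrow> complex \<Rightarrow> nat \<Rightarrow> nat \<Rightarrow> complex" where
  "row_coeff q t a s i j =
     (qpoch a q i * qpoch s q (i + j) * qpoch (t^2 * s^2) q i * qpoch (1 / t) q j) /
     (qpoch q q i * qpoch (t * s) q i * qpoch (q ^ i * (t * s * q)) q j *
      qpoch (t^2 * s^2 * q / a) q i * qpoch q q j) *
     ((1 - s * q ^ (i + 2 * j)) / (1 - s)) * (t / a) ^ i * (t^2 / q) ^ j"

definition row_fps :: "complex \<Rightarrow> complex \<Rightarrow> complex \<Rightarrow> complex \<Rightarrow> complex fps" where
  "row_fps q t a s = Abs_fps (\<lambda>k. \<Sum>i\<le>k. if even (k - i) then row_coeff q t a s i ((k - i) div 2) else 0)"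

text \<open>Up to powers of t, \<open>dualA\<close>, \<open>dualB\<close> and \<open>dualC\<close>
  are the coefficients of g(qu), g(u/q) and g(u) in the image of g, the first taken at u/q and the
  second at qu. These are the arguments produced when the rescaling is moved from g to the other
  factor.\<close>

definition dualA :: "complex \<Rightarrow> complex \<Rightarrow> complex \<Rightarrow> complex fps" where
  "dualA q t a = (fps_const a - fps_const (t / q) * fps_X) * (1 + fps_const (t / q) * fps_X) *
     (1 - fps_const (t^2 / q^3) * fps_X^2) *
     inverse ((1 - fps_const (t / q^2) * fps_X^2) * (1 - fps_const (t / q^3) * fps_X^2))"

definition dualB :: "complex \<Rightarrow> complex \<Rightarrow> complex \<Rightarrow> complex fps" where
  "dualB q t a = (1 - fps_const a * fps_X) * (1 + fps_X) * (1 - fps_const q * fps_X^2) *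
     inverse ((1 - fps_const t * fps_X^2) * (1 - fps_const (t * q) * fps_X^2))"

definition dualC :: "complex \<Rightarrow> complex \<Rightarrow> complex \<Rightarrow> complex fps" where
  "dualC q t a = fps_const ((q - t) / q) * fps_X *
     (fps_const ((t - a) * (q + 1) / q) * fps_X + fps_const (1 - a) * (1 + fps_const (t / q) * fps_X^2)) *
     inverse ((1 - fps_const t * fps_X^2) * (1 - fps_const (t / q^2) * fps_X^2))"

lemma dualA_mult_den:
  "dualA q t a * ((1 - fps_const (t / q^2) * fps_X^2) * (1 - fps_const (t / q^3) * fps_X^2)) =
   (fps_const a - fps_const (t / q) * fps_X) * (1 + fps_const (t / q) * fps_X) * (1 - fps_const (t^2 / q^3) * fps_X^2)"
  unfolding dualA_def mult.assoc by (subst inverse_mult_eq_1) simp_all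

lemma dualB_mult_den:
  "dualB q t a * ((1 - fps_const t * fps_X^2) * (1 - fps_const (t * q) * fps_X^2)) =
   (1 - fps_const a * fps_X) * (1 + fps_X) * (1 - fps_const q * fps_X^2)"
  unfolding dualB_def mult.assoc by (subst inverse_mult_eq_1) simp_all

lemma dualC_mult_den:
  "dualC q t a * ((1 - fps_const t * fps_X^2) * (1 - fps_const (t / q^2) * fps_X^2)) =
   fps_const ((q - t) / q) * fps_X *
     (fps_const ((t - a) * (q + 1) / q) * fps_X + fps_const (1 - a) * (1 + fps_const (t / q) * fps_X^2))"
  unfolding dualC_def mult.assoc by (subst inverse_mult_eq_1) simp_all

lemma fps_mult_nth_cong:
  assumes "\<And>j. j \<le> k \<Longrightarrow> fps_nth f j = fps_nth g j"
  shows "fps_nth (h * f) k = fps_nth (h * g) k"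
  unfolding fps_mult_nth using assms by (intro sum.cong) auto

lemma psi_fps_nth_0: "j < i \<Longrightarrow> fps_nth (psi_fps q t s i) j = 0"
  by (simp add: psi_fps_def fps_X_power_mult_nth)

text \<open>The i-th summand has order at least i + 1, so the infinite series agrees up to X^k with
  a finite sum. Linearity of the operator is thereby needed for finite sums only.\<close>

lemma conn_fps_nth:
  assumes "j \<le> k"
  shows "fps_nth (conn_fps q t a s) j =
    fps_nth (\<Sum>i\<le>k. fps_const (conn_coeff q t a s i) * psi_fps q t (s / q) (Suc i)) j"
proof -
  have "(\<Sum>i\<le>k. conn_coeff q t a s i * fps_nth (psi_fps q t (s / q) (Suc i)) j) =
    (\<Sum>i\<le>j. conn_coeff q t a s i * fps_nth (psi_fps q t (s / q) (Suc i)) j)"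
    by (rule sum.mono_neutral_right) (use assms in \<open>auto simp: psi_fps_nth_0\<close>)
  then show ?thesis by (simp add: conn_fps_def fps_sum_nth)
qed

lemma dual_op_nth_cong:
  assumes "\<And>j. j \<le> k \<Longrightarrow> fps_nth f j = fps_nth g j"
  shows "fps_nth (dual_op q t a w f) k = fps_nth (dual_op q t a w g) k"
  unfolding dual_op_def Let_def fps_add_nth
  by (intro arg_cong2[of _ _ _ _ "(+)"] fps_mult_nth_cong) (auto simp: assms)

context
  fixes q t s a :: complex
  assumes q0: "q \<noteq> 0" and t0: "t \<noteq> 0" and s0: "s \<noteq> 0" and a0: "a \<noteq> 0"
    and qk: "\<And>k. k > 0 \<Longrightarrow> q ^ k \<noteq> 1"
    and tsk: "\<And>k. t * s * q ^ k \<noteq> 1"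
    and sk: "s \<noteq> 1"
    and ak: "\<And>k. t^2 * s^2 * q * q ^ k \<noteq> a"
begin

text \<open>\<open>bandL i\<close>, \<open>bandM i\<close> and \<open>bandR i\<close> are the
  entries of \<open>dual_op_band\<close> in the image of \<psi>_(i+1), at \<psi>_i, \<psi>_(i+1) and
  \<psi>_(i+2), with s/q in place of s and E = a/(t s) + t s. This E makes \<open>bandL 0\<close>
  vanish, so that \<psi>_0 never occurs and an expansion can start with \<psi>_1.\<close>

definition bandL where "bandL i = (1 - s * q ^ i) / (1 - t * (s * q ^ i)) *
  (a / (t * (s * q ^ i)) + t * (s * q ^ i) - (a / (t * s) + t * s))"
definition bandM where "bandM i = (1 + t / q) * (a / (t * s) + t * s) -
  (a + t / q) * (1 / (t * (s * q ^ i)) + t * (s * q ^ i)) + (t - q) * (a - 1) / q"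
definition bandR where "bandR i = t / q * ((1 - t^2 * (s * q ^ i)) / (1 - t * (s * q ^ i))) *
  (1 / (t * (s * q ^ i)) + a * t * (s * q ^ i) - (a / (t * s) + t * s))"

lemma conn_coeff_Suc:
  "conn_coeff q t a s (Suc i) * ((1 - q * q ^ i) * (a - t^2 * s^2 * q * q ^ i) * (1 - t * s * q ^ i)) =
   conn_coeff q t a s i * ((1 - a * q ^ i) * (1 - t^2 * s^2 * q ^ i) * (1 - t * s * q * q ^ i) * t)"
proof -
  have "qpoch q q k \<noteq> 0" "qpoch (t^2 * s^2 * q / a) q k \<noteq> 0" for k
    using qk[of "Suc _"] ak a0 by (auto simp: qpoch_eq_0_iff mult_ac field_simps)
  moreover have "1 - q * q ^ i \<noteq> 0" "a - t^2 * s^2 * q * q ^ i \<noteq> 0" "1 - t * s \<noteq> 0"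
    using qk[of "Suc i"] ak[of i] tsk[of 0] by auto
  ultimately show ?thesis using a0
    by (simp add: conn_coeff_def qpoch_Suc divide_simps) (simp add: mult_ac)
qed

text \<open>Here the product form of the coefficients becomes visible: \<open>bandL (Suc i)\<close>
  contains the factors (1 - q^(i+1)) (a - t^2 s^2 q^(i+1)) of the denominator of the ratio of
  consecutive coefficients, and \<open>bandR i\<close> contains the factors (1 - a q^i) (1 - t^2 s^2
  q^i) of its numerator.\<close>

lemma band_step_L:
  "conn_coeff q t a s (Suc i) * bandL (Suc i) = conn_coeff q t a s i *
   ((1 - a * q ^ i) * (1 - t^2 * s^2 * q ^ i) * (1 - s * (q * q ^ i)) / ((1 - t * s * q ^ i) * (s * (q * q ^ i))))"
proof -
  define x where "x = q ^ i"
  have x0: "x \<noteq> 0" using q0 by (simp add: x_def)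
  have nz: "1 - t * s * x \<noteq> 0" "1 - t * s * (q * x) \<noteq> 0"
    using tsk[of i] tsk[of "Suc i"] by (auto simp: x_def)
  have "bandL (Suc i) = (1 - s * (q * x)) / (1 - t * s * (q * x)) *
      ((1 - q * x) * (a - t^2 * s^2 * q * x) / (t * s * q * x))"
  proof -
    have "a / (t * (s * (q * x))) + t * (s * (q * x)) - (a / (t * s) + t * s) =
        (1 - q * x) * (a - t^2 * s^2 * q * x) / (t * s * q * x)"
      using x0 q0 t0 s0 by (simp add: field_simps power2_eq_square)
    then show ?thesis unfolding bandL_def power_Suc x_def[symmetric] by (simp add: mult.assoc)
  qed
  then have "conn_coeff q t a s (Suc i) * bandL (Suc i) =
     conn_coeff q t a s (Suc i) * ((1 - q * x) * (a - t^2 * s^2 * q * x) * (1 - t * s * x)) *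
       ((1 - s * (q * x)) / ((1 - t * s * x) * (1 - t * s * (q * x)) * (t * s * q * x)))"
    using nz by (simp add: mult_ac)
  also have "\<dots> = conn_coeff q t a s i *
   ((1 - a * x) * (1 - t^2 * s^2 * x) * (1 - s * (q * x)) / ((1 - t * s * x) * (s * (q * x))))"
    unfolding conn_coeff_Suc[of i, folded x_def] using nz t0
    by (simp add: mult_ac)
  finally show ?thesis by (simp add: x_def)
qed

lemma band_step_R:
  "conn_coeff q t a s i * bandR i = conn_coeff q t a s (Suc i) *
   ((1 - t^2 * s * q ^ i) * (1 - q * q ^ i) * (a - t^2 * s^2 * q * q ^ i) /
    ((1 - t * s * (q * q ^ i)) * (t * s * q * q ^ i)))"
proof -
  define x where "x = q ^ i"
  have x0: "x \<noteq> 0" using q0 by (simp add: x_def)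
  have nz: "1 - t * s * x \<noteq> 0" "1 - t * s * (q * x) \<noteq> 0"
    using tsk[of i] tsk[of "Suc i"] by (auto simp: x_def)
  have "bandR i = t / q * ((1 - t^2 * s * x) / (1 - t * s * x)) * ((1 - a * x) * (1 - t^2 * s^2 * x) / (t * s * x))"
  proof -
    have "1 / (t * (s * x)) + a * t * (s * x) - (a / (t * s) + t * s) =
        (1 - a * x) * (1 - t^2 * s^2 * x) / (t * s * x)"
      using x0 q0 t0 s0 by (simp add: field_simps power2_eq_square)
    then show ?thesis unfolding bandR_def x_def[symmetric] by (simp add: mult.assoc)
  qed
  then have "conn_coeff q t a s i * bandR i =
     conn_coeff q t a s i * ((1 - a * x) * (1 - t^2 * s^2 * x) * (1 - t * s * q * x) * t) *
       ((1 - t^2 * s * x) / ((1 - t * s * x) * (1 - t * s * q * x) * (t * s * q * x)))"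
    using nz t0 by (simp add: mult_ac)
  also have "\<dots> = conn_coeff q t a s (Suc i) *
   ((1 - t^2 * s * x) * (1 - q * x) * (a - t^2 * s^2 * q * x) / ((1 - t * s * (q * x)) * (t * s * q * x)))"
    unfolding conn_coeff_Suc[of i, folded x_def, symmetric] using nz t0
    by (simp add: mult_ac)
  finally show ?thesis by (simp add: x_def)
qed

text \<open>\<open>band_step_L\<close> and \<open>band_step_R\<close> express both outer terms by
  the middle coefficient. Once this is divided out, a rational identity in q^i remains.\<close>

lemma band_three_term:
  "conn_coeff q t a s (Suc (Suc i)) * bandL (Suc (Suc i)) + conn_coeff q t a s (Suc i) * bandM (Suc i)
    + conn_coeff q t a s i * bandR i = 0"
proof -
  define x where "x = q ^ i"
  have x0: "x \<noteq> 0" using q0 by (simp add: x_def)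
  have nz: "1 - t * s * (q * x) \<noteq> 0"
    using tsk[of "Suc i"] by (auto simp: x_def)
  have "(1 - a * (q * x)) * (1 - t^2 * s^2 * (q * x)) * (1 - s * (q * (q * x))) / ((1 - t * s * (q * x)) * (s * (q * (q * x))))
    + bandM (Suc i) + (1 - t^2 * s * x) * (1 - q * x) * (a - t^2 * s^2 * q * x) / ((1 - t * s * (q * x)) * (t * s * q * x)) = 0"
    using x0 q0 t0 s0 nz unfolding bandM_def power_Suc x_def[symmetric]
    by (simp add: divide_simps) algebra
  then show ?thesis
    unfolding band_step_L band_step_R unfolding power_Suc x_def[symmetric] distrib_left[symmetric] by simp
qed

lemma band_first: "conn_coeff q t a s (Suc 0) * bandL (Suc 0) + conn_coeff q t a s 0 * bandM 0 = 0" "bandL 0 = 0"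
proof -
  have nz: "1 - t * s \<noteq> 0"
    using tsk[of 0] by auto
  have "(1 - a) * (1 - t^2 * s^2) * (1 - s * q) / ((1 - t * s) * (s * q)) + bandM 0 = 0"
    using q0 t0 s0 nz unfolding bandM_def
    by (simp add: divide_simps) algebra
  then show "conn_coeff q t a s (Suc 0) * bandL (Suc 0) + conn_coeff q t a s 0 * bandM 0 = 0"
    unfolding band_step_L distrib_left[symmetric] by simp
qed (simp add: bandL_def)

text \<open>By the recurrence the coefficients of all \<psi>_i with i \<le> n cancel; truncation
  leaves only two boundary terms.\<close>

lemma band_sum:
  fixes \<Psi> :: "nat \<Rightarrow> complex fps"
  shows "(\<Sum>i\<le>n. fps_const (conn_coeff q t a s i) * (fps_const (bandL i) * \<Psi> i + fps_const (bandM i) * \<Psi> (Suc i)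
    + fps_const (bandR i) * \<Psi> (Suc (Suc i)))) =
    fps_const (conn_coeff q t a s n * bandR n) * \<Psi> (Suc (Suc n))
    - fps_const (conn_coeff q t a s (Suc n) * bandL (Suc n)) * \<Psi> (Suc n)"
proof (induction n)
  case 0
  have "conn_coeff q t a s 0 * bandM 0 = - (conn_coeff q t a s (Suc 0) * bandL (Suc 0))"
    using band_first(1) by (simp add: add_eq_0_iff)
  then have "fps_const (conn_coeff q t a s 0) * fps_const (bandM 0) =
    - fps_const (conn_coeff q t a s (Suc 0) * bandL (Suc 0))"
    by simp
  then show ?case
    by (simp only: atMost_0 sum.insert finite.emptyI empty_iff not_False_eq_True sum.empty band_first(2)
      fps_const_0_eq_0 mult_zero_left add_0_left add_0_right fps_const_mult[symmetric]) algebra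
next
  case (Suc n)
  have "conn_coeff q t a s (Suc n) * bandM (Suc n) = - (conn_coeff q t a s (Suc (Suc n)) * bandL (Suc (Suc n)))
     - conn_coeff q t a s n * bandR n"
    using band_three_term[of n] by algebra
  then have "fps_const (conn_coeff q t a s (Suc n)) * fps_const (bandM (Suc n)) =
    - fps_const (conn_coeff q t a s (Suc (Suc n)) * bandL (Suc (Suc n))) - fps_const (conn_coeff q t a s n * bandR n)"
    by simp
  then show ?case unfolding sum.atMost_Suc Suc fps_const_mult[symmetric] by algebra
qed

text \<open>For the truncation at k the boundary terms of \<open>band_sum\<close> have order above k
  and do not reach the coefficient of X^k. The factor (1 - X) (1 - (t/q) X) in front is invertible
  as a power series.\<close>

lemma conn_fps_eigen:
  "dual_op q t a (t * s / q) (conn_fps q t a s) =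
    fps_const (t * s / q * (a / (t * s) + t * s)) * dual_den q t * conn_fps q t a s"
proof (rule fps_ext)
  fix k
  define \<Psi> where "\<Psi> = psi_fps q t (s / q)"
  define E where "E = a / (t * s) + t * s"
  define g where "g = (\<Sum>i\<le>k. fps_const (conn_coeff q t a s i) * \<Psi> (Suc i))"
  have S: "s / q * q ^ Suc i = s * q ^ i" for i using q0 by simp
  have cong: "fps_nth (conn_fps q t a s) j = fps_nth g j" if "j \<le> k" for j
    unfolding g_def \<Psi>_def by (rule conn_fps_nth[OF that])
  have tsk': "t * (s / q) * q ^ j \<noteq> 1" if "j > 0" for j
    using that tsk[of "j - 1"] q0 by (cases j) (auto simp: mult.assoc)
  have band: "(1 - fps_X) * (1 - fps_const (t / q) * fps_X) *
      (dual_op q t a (t * (s / q)) (\<Psi> (Suc i)) - fps_const (t * (s / q) * E) * dual_den q t * \<Psi> (Suc i)) =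
    fps_const (t * (s / q)) * dual_den q t * fps_X *
      (fps_const (bandL i) * \<Psi> i + fps_const (bandM i) * \<Psi> (Suc i) + fps_const (bandR i) * \<Psi> (Suc (Suc i)))" for i
    using dual_op_band[OF q0 t0 _ qk tsk', where E = E and a = a and i = i] s0 q0
    unfolding \<Psi>_def[symmetric] S E_def bandL_def bandM_def bandR_def by simp
  have g_op: "dual_op q t a w g = (\<Sum>i\<le>k. fps_const (conn_coeff q t a s i) * dual_op q t a w (\<Psi> (Suc i)))" for w
  proof -
    have "dual_op q t a w (\<Sum>i\<in>A. fps_const (conn_coeff q t a s i) * \<Psi> (Suc i)) =
      (\<Sum>i\<in>A. fps_const (conn_coeff q t a s i) * dual_op q t a w (\<Psi> (Suc i)))" if "finite A" for A
      using that
    proof induction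
      case empty
      show ?case by (simp add: dual_op_def Let_def fps_scale_def flip: fps_zero_def)
    qed (simp_all add: dual_op_add dual_op_const)
    then show ?thesis by (simp add: g_def)
  qed
  have "(1 - fps_X) * (1 - fps_const (t / q) * fps_X) *
      (dual_op q t a (t * (s / q)) g - fps_const (t * (s / q) * E) * dual_den q t * g) =
    (\<Sum>i\<le>k. fps_const (conn_coeff q t a s i) * ((1 - fps_X) * (1 - fps_const (t / q) * fps_X) *
      (dual_op q t a (t * (s / q)) (\<Psi> (Suc i)) - fps_const (t * (s / q) * E) * dual_den q t * \<Psi> (Suc i))))"
    unfolding g_op unfolding g_def
    by (simp only: sum_distrib_left right_diff_distrib sum_subtractf mult_ac)
  also have "\<dots> = fps_const (t * (s / q)) * dual_den q t * fps_X *
    (\<Sum>i\<le>k. fps_const (conn_coeff q t a s i) * (fps_const (bandL i) * \<Psi> i + fps_const (bandM i) * \<Psi> (Suc i)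
    + fps_const (bandR i) * \<Psi> (Suc (Suc i))))"
    unfolding band by (simp only: sum_distrib_left mult_ac)
  also have "\<dots> = fps_X * (fps_const (t * (s / q)) * dual_den q t *
     (fps_const (conn_coeff q t a s k * bandR k) * \<Psi> (Suc (Suc k))
    - fps_const (conn_coeff q t a s (Suc k) * bandL (Suc k)) * \<Psi> (Suc k)))" (is "_ = fps_X * (?c * ?h)")
    unfolding band_sum by (simp only: mult_ac)
  finally have eq: "(1 - fps_X) * (1 - fps_const (t / q) * fps_X) *
      (dual_op q t a (t * (s / q)) g - fps_const (t * (s / q) * E) * dual_den q t * g) = fps_X * (?c * ?h)" .
  define d where "d = dual_op q t a (t * (s / q)) g - fps_const (t * (s / q) * E) * dual_den q t * g"
  have unit: "inverse ((1 - fps_X) * (1 - fps_const (t / q) * fps_X)) *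
     ((1 - fps_X) * (1 - fps_const (t / q) * fps_X)) = 1"
    by (rule inverse_mult_eq_1) simp
  have "d = inverse ((1 - fps_X) * (1 - fps_const (t / q) * fps_X)) *
     ((1 - fps_X) * (1 - fps_const (t / q) * fps_X) * d)"
    using unit by (simp add: mult.assoc [symmetric])
  also have "\<dots> = inverse ((1 - fps_X) * (1 - fps_const (t / q) * fps_X)) * fps_X * ?c * ?h"
    unfolding eq[folded d_def] by (simp only: mult_ac)
  also have "fps_nth \<dots> k = fps_nth (inverse ((1 - fps_X) * (1 - fps_const (t / q) * fps_X)) * fps_X * ?c * 0) k"
    by (rule fps_mult_nth_cong) (simp add: \<Psi>_def psi_fps_nth_0)
  finally have "fps_nth d k = 0" by simp
  then have "fps_nth (dual_op q t a (t * (s / q)) g) k = fps_nth (fps_const (t * (s / q) * E) * dual_den q t * g) k"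
    by (simp add: d_def)
  with dual_op_nth_cong[OF cong] fps_mult_nth_cong[OF cong]
  show "fps_nth (dual_op q t a (t * s / q) (conn_fps q t a s)) k =
    fps_nth (fps_const (t * s / q * (a / (t * s) + t * s)) * dual_den q t * conn_fps q t a s) k"
    by (simp add: E_def)
qed

text \<open>Subtracting t/q times the preceding coefficient makes the result factor again: it splits
  off 1 - s q^(i+2j) and turns (q/t; q)_j into (1/t; q)_j. This is the origin of both factors in the
  theorem.\<close>

lemma hyp_fps_row_coeff:
  "fps_const (conn_coeff q t a s i) * ((1 - fps_const (t / q) * fps_X) * hyp_fps q t (s / q) (Suc i)) =
   fps_const ((1 - s) / (1 - t * s)) * Abs_fps (row_coeff q t a s i)"
proof (rule fps_ext)
  fix j
  have qp: "qpoch q q k \<noteq> 0" "qpoch (t * s) q k \<noteq> 0" "qpoch (t * s * q) q k \<noteq> 0"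
      "qpoch (q ^ i * (t * s * q)) q k \<noteq> 0" for k
    using qk[of "Suc _"] tsk tsk[of "Suc _"] tsk[of "_ + Suc i"]
    by (auto simp: qpoch_eq_0_iff power_add mult_ac)
  have ts: "1 - t * s * q ^ k \<noteq> 0" "1 - t * s \<noteq> 0" for k using tsk[of k] tsk[of 0] by auto
  have shift: "qpoch (t * s) q (Suc k) = (1 - t * s) * qpoch (t * s * q) q k" for k
    by (induction k) (simp_all add: qpoch_Suc mult_ac)
  define m where "m = i + j"
  define \<beta> where "\<beta> = qpoch s q m / qpoch (t * s) q m"
  define c where "c = qpoch a q i * qpoch (t^2 * s^2) q i / (qpoch q q i * qpoch (t^2 * s^2 * q / a) q i) * (t / a) ^ i"
  have cc: "conn_coeff q t a s i = c * ((1 - t * s * q ^ i) / (1 - t * s))"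
    by (simp add: conn_coeff_def c_def)
  \<comment> \<open>The factor 1 - t s q^i of \<open>conn_coeff\<close> fills the gap between (t s;
    q)_i and (t s q^(i+1); q)_j, so that the two join to one shifted factorial of length i + j +
    1.\<close>
  have r1: "qpoch (t * s) q i * qpoch (q ^ i * (t * s * q)) q j * (1 - t * s * q ^ i) =
      qpoch (t * s) q m * (1 - t * s * q ^ m)"
  proof -
    have "qpoch (t * s) q i * (1 - t * s * q ^ i) = (1 - t * s) * qpoch (t * s * q) q i"
      using shift[of i] by (simp add: qpoch_Suc mult_ac)
    moreover have "qpoch (t * s * q) q m = qpoch (t * s * q) q i * qpoch (q ^ i * (t * s * q)) q j"
      unfolding m_def by (rule qpoch_add)
    moreover have "qpoch (t * s) q m * (1 - t * s * q ^ m) = (1 - t * s) * qpoch (t * s * q) q m"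
      using shift[of m] by (simp add: qpoch_Suc mult_ac)
    ultimately show ?thesis by (simp add: mult_ac)
  qed
  have rc: "row_coeff q t a s i j = c * (1 - t * s * q ^ i) * \<beta> / (1 - t * s * q ^ m) *
      (qpoch (1 / t) q j / qpoch q q j) * ((1 - s * q ^ (i + 2 * j)) / (1 - s)) * (t^2 / q) ^ j"
  proof -
    have "1 / (qpoch (t * s) q i * qpoch (q ^ i * (t * s * q)) q j) =
       (1 - t * s * q ^ i) / (qpoch (t * s) q m * (1 - t * s * q ^ m))"
      using r1 qp ts by (simp add: divide_simps mult_ac)
    then have *: "X / (qpoch (t * s) q i * qpoch (q ^ i * (t * s * q)) q j) =
       X * ((1 - t * s * q ^ i) / (qpoch (t * s) q m * (1 - t * s * q ^ m)))" for X
      by (metis (no_types) mult.comm_neutral times_divide_eq_right)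
    have "row_coeff q t a s i j = c * qpoch s q m * (qpoch (1 / t) q j / qpoch q q j) /
       (qpoch (t * s) q i * qpoch (q ^ i * (t * s * q)) q j) * ((1 - s * q ^ (i + 2 * j)) / (1 - s)) * (t^2 / q) ^ j"
      by (simp add: row_coeff_def c_def m_def) (simp only: mult_ac)
    then show ?thesis unfolding * \<beta>_def by (simp add: mult_ac)
  qed
  show "fps_nth (fps_const (conn_coeff q t a s i) * ((1 - fps_const (t / q) * fps_X) * hyp_fps q t (s / q) (Suc i))) j =
   fps_nth (fps_const ((1 - s) / (1 - t * s)) * Abs_fps (row_coeff q t a s i)) j"
  proof (cases j)
    case 0
    then have "m = i" by (simp add: m_def)
    then have "row_coeff q t a s i 0 = c * (1 - t * s * q ^ i) * \<beta> / (1 - t * s * q ^ i) * ((1 - s * q ^ i) / (1 - s))"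
      using rc 0 by simp
    moreover have "fps_nth (hyp_fps q t (s / q) (Suc i)) 0 = \<beta> * (1 - s * q ^ i) / (1 - t * s * q ^ i)"
      using q0 \<open>m = i\<close> by (simp add: hyp_fps_def qpoch_Suc \<beta>_def mult_ac)
    ultimately show ?thesis using 0 ts(1)[of i] ts(2) sk by (simp add: cc)
  next
    case (Suc l)
    define y M where "y = q * q ^ l" and "M = q ^ m"
    define g where "g = qpoch (q / t) q l / qpoch q q l * (t^2 / q) ^ l"
    have y1: "1 - y \<noteq> 0" using qk[of "Suc l"] by (simp add: y_def)
    have M1: "1 - t * s * M \<noteq> 0" using ts(1)[of m] by (simp add: M_def)
    have shift': "qpoch (1 / t) q (Suc k) = (1 - 1 / t) * qpoch (q / t) q k" for k
      by (induction k) (simp_all add: qpoch_Suc mult_ac)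
    have h1: "fps_nth (hyp_fps q t (s / q) (Suc i)) l = \<beta> * g"
      using q0 by (simp add: hyp_fps_def \<beta>_def g_def m_def Suc)
    have h2: "fps_nth (hyp_fps q t (s / q) (Suc i)) j = \<beta> * ((1 - s * M) / (1 - t * s * M)) *
       (g * ((1 - y / t) * (t^2 / q) / (1 - y)))"
      using q0 by (simp add: hyp_fps_def \<beta>_def g_def m_def Suc qpoch_Suc M_def y_def) (simp add: mult_ac)
    have r: "row_coeff q t a s i j = c * (1 - t * s * q ^ i) * \<beta> / (1 - t * s * M) *
       ((1 - 1 / t) / (1 - y) * g * (t^2 / q)) * ((1 - s * M * y) / (1 - s))"
    proof -
      have "q ^ (i + 2 * j) = M * y" by (simp add: M_def y_def m_def Suc power_add mult_2)
      moreover have "qpoch (1 / t) q j = (1 - 1 / t) * qpoch (q / t) q l"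
        "qpoch q q j = qpoch q q l * (1 - y)" "(t^2 / q) ^ j = (t^2 / q) ^ l * (t^2 / q)"
        unfolding Suc shift' by (simp_all add: qpoch_Suc y_def mult_ac)
      ultimately show ?thesis unfolding rc M_def[symmetric] g_def by (simp add: mult_ac)
    qed
    have "fps_nth (fps_const (conn_coeff q t a s i) * ((1 - fps_const (t / q) * fps_X) * hyp_fps q t (s / q) (Suc i))) j
      = c * ((1 - t * s * q ^ i) / (1 - t * s)) * (\<beta> * ((1 - s * M) / (1 - t * s * M)) *
       (g * ((1 - y / t) * (t^2 / q) / (1 - y))) - t / q * (\<beta> * g))"
      using h1 h2 by (simp add: cc Suc algebra_simps)
    also have "\<dots> = (1 - s) / (1 - t * s) * (c * (1 - t * s * q ^ i) * \<beta> / (1 - t * s * M) *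
       ((1 - 1 / t) / (1 - y) * g * (t^2 / q)) * ((1 - s * M * y) / (1 - s)))"
    proof -
      have "(1 - s * M) / (1 - t * s * M) * ((1 - y / t) * (t^2 / q) / (1 - y)) - t / q =
        ((1 - 1 / t) / (1 - y) * (t^2 / q)) * (1 - s * M * y) / (1 - t * s * M)"
        using M1 y1 q0 t0 by (simp add: divide_simps) algebra
      then have "\<beta> * g * ((1 - s * M) / (1 - t * s * M) * ((1 - y / t) * (t^2 / q) / (1 - y)) - t / q) =
        \<beta> * g * (((1 - 1 / t) / (1 - y) * (t^2 / q)) * (1 - s * M * y) / (1 - t * s * M))"
        by simp
      then have "(\<beta> * ((1 - s * M) / (1 - t * s * M)) *
       (g * ((1 - y / t) * (t^2 / q) / (1 - y))) - t / q * (\<beta> * g)) =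
        \<beta> * g * (((1 - 1 / t) / (1 - y) * (t^2 / q)) * (1 - s * M * y) / (1 - t * s * M))"
        by (simp add: algebra_simps)
      then show ?thesis using sk by (simp add: mult_ac)
    qed
    finally show ?thesis unfolding r[symmetric] by simp
  qed
qed

lemma row_fps_eq:
  "(1 - fps_const (t / q) * fps_X^2) * conn_fps q t a s = fps_const ((1 - s) / (1 - t * s)) * fps_X * row_fps q t a s"
proof (rule fps_ext)
  fix k
  define \<Psi> where "\<Psi> = psi_fps q t (s / q)"
  define g where "g = (\<Sum>i\<le>k. fps_const (conn_coeff q t a s i) * \<Psi> (Suc i))"
  define C where "C = (\<lambda>i. fps_X ^ i * fps_even (Abs_fps (row_coeff q t a s i)))"
  have cong: "fps_nth (conn_fps q t a s) j = fps_nth g j" if "j \<le> k" for j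
    unfolding g_def \<Psi>_def by (rule conn_fps_nth[OF that])
  have C: "fps_const (conn_coeff q t a s i) * ((1 - fps_const (t / q) * fps_X^2) * \<Psi> (Suc i)) =
     fps_const ((1 - s) / (1 - t * s)) * fps_X * C i" for i
    using arg_cong[OF hyp_fps_row_coeff[of i], of "\<lambda>f. fps_X ^ Suc i * fps_even f"]
    by (simp add: \<Psi>_def psi_fps_def C_def mult_ac del: fps_const_divide)
  have "(1 - fps_const (t / q) * fps_X^2) * g = (\<Sum>i\<le>k. fps_const ((1 - s) / (1 - t * s)) * fps_X * C i)"
    unfolding g_def C[symmetric] by (simp only: sum_distrib_left mult_ac)
  also have "\<dots> = fps_const ((1 - s) / (1 - t * s)) * (fps_X * (\<Sum>i\<le>k. C i))"
    by (simp only: sum_distrib_left mult.assoc)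
  finally have g: "(1 - fps_const (t / q) * fps_X^2) * g = \<dots>" .
  have "fps_nth (fps_X * (\<Sum>i\<le>k. C i)) k = fps_nth (fps_X * row_fps q t a s) k"
  proof (cases k)
    case (Suc m)
    have "(\<Sum>i\<le>Suc m. fps_nth (C i) m) = (\<Sum>i\<le>m. fps_nth (C i) m)"
      by (simp add: C_def fps_X_power_mult_nth)
    also have "\<dots> = fps_nth (row_fps q t a s) m"
      unfolding row_fps_def C_def by (simp add: fps_X_power_mult_nth fps_even_nth cong: if_cong)
    finally show ?thesis using Suc by (simp add: fps_sum_nth)
  qed simp
  then have "fps_nth ((1 - fps_const (t / q) * fps_X^2) * g) k =
     fps_nth (fps_const ((1 - s) / (1 - t * s)) * fps_X * row_fps q t a s) k"
    unfolding g by (simp only: mult.assoc fps_mult_left_const_nth)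
  then show "fps_nth ((1 - fps_const (t / q) * fps_X^2) * conn_fps q t a s) k =
     fps_nth (fps_const ((1 - s) / (1 - t * s)) * fps_X * row_fps q t a s) k"
    using fps_mult_nth_cong[OF cong] by simp
qed

lemma row_fps_equation:
  "fps_const (1 / (t * s)) * dualA q t a * fps_scale (1 / q) (row_fps q t a s) +
   fps_const (t * s) * dualB q t a * fps_scale q (row_fps q t a s) +
   dualC q t a * row_fps q t a s = fps_const (a / (t * s) + t * s) * row_fps q t a s"
proof -
  define f where "f = conn_fps q t a s"
  define R where "R = row_fps q t a s"
  define Q Qi T A K W P E X where "Q = fps_const q" and "Qi = fps_const (1 / q)" and "T = fps_const t"
    and "A = fps_const a" and "K = fps_const ((1 - s) / (1 - t * s))" and "W = fps_const (t * s / q)"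
    and "P = fps_const (1 / (t * s))" and "E = fps_const (a / (t * s) + t * s)"
    and "X = (fps_X :: complex fps)"
  have QQi: "Q * Qi = 1" and WP: "W * P = Qi" and WQ: "fps_const (t * s) = W * Q"
    using q0 t0 s0 by (simp_all add: Q_def Qi_def W_def P_def)
  define fm fp Rm Rp where "fm = fps_scale (1 / q) f" and "fp = fps_scale q f"
    and "Rm = fps_scale (1 / q) R" and "Rp = fps_scale q R"
  have TQ: "fps_const (t / q) = T * Qi" "fps_const (t / q^2) = T * Qi^2" "fps_const (t / q^3) = T * Qi^3"
     "fps_const (t^2 / q^3) = T^2 * Qi^3" "fps_const (t * q) = T * Q"
     "fps_const ((q - t) / q) = (Q - T) * Qi" "fps_const ((t - a) * (q + 1) / q) = (T - A) * (Q + 1) * Qi"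
     "fps_const (1 - a) = 1 - A" "fps_const (1 / q ^ 2) = Qi^2"
    by (simp_all add: T_def Qi_def Q_def A_def fps_const_power power_one_over flip: fps_const_1_eq_1)
  have f: "(1 - T * Qi * X^2) * f = K * X * R"
    using row_fps_eq unfolding TQ f_def R_def K_def X_def .
  from arg_cong[OF f, of "fps_scale (1 / q)"]
  have fm: "(1 - T * Qi * (Qi * X)^2) * fm = K * (Qi * X) * Rm"
    by (simp add: T_def Qi_def K_def X_def fm_def Rm_def)
  from arg_cong[OF f, of "fps_scale q"]
  have fp: "(1 - T * Qi * (Q * X)^2) * fp = K * (Q * X) * Rp"
    by (simp add: T_def Qi_def Q_def K_def X_def fp_def Rp_def)
  define d1 d2 where "d1 = 1 - T * X^2" and "d2 = 1 - T * Qi^2 * X^2"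
  define n1 n2 n3 where "n1 = (A - T*Qi*X) * (1 + T*Qi*X) * (1 - T^2*Qi^3*X^2)"
    and "n2 = (1 - A*X) * (1 + X) * (1 - Q*X^2)"
    and "n3 = (Q-T)*Qi*X*((T-A)*(Q+1)*Qi*X + (1-A)*(1 + T*Qi*X^2))"
  have dA: "dualA q t a * (d2 * (1 - T * Qi^3 * X^2)) = n1"
    using dualA_mult_den[of q t a] unfolding TQ A_def[symmetric] n1_def d2_def X_def[symmetric] .
  have dB: "dualB q t a * (d1 * (1 - T * Q * X^2)) = n2"
    using dualB_mult_den[of q t a]
    unfolding TQ A_def[symmetric] Q_def[symmetric] T_def[symmetric] n2_def d1_def X_def[symmetric] .
  have dC: "dualC q t a * (d1 * d2) = n3"
    using dualC_mult_den[of q t a] unfolding TQ T_def[symmetric] n3_def d1_def d2_def X_def[symmetric] .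
  have main: "n1 * d1 * fm + W^2 * n2 * d2 * fp + W * n3 * (1 - T * Qi * X^2) * f =
     W * E * ((1 - T * Qi * X^2) * d1 * d2) * f"
  proof -
    have cm: "fps_const (t * s / q * (a / (t * s) + t * s)) = W * E" by (simp add: W_def E_def)
    show ?thesis
      using conn_fps_eigen QQi unfolding f_def[symmetric] cm dual_op_def dual_den_def Let_def TQ
      unfolding fm_def[symmetric] fp_def[symmetric] X_def[symmetric] Q_def[symmetric] T_def[symmetric]
        A_def[symmetric] W_def[symmetric] n1_def n2_def n3_def d1_def d2_def
      by algebra
  qed
  \<comment> \<open>Z is a common multiple of all denominators and of the conjugating factor.
    Multiplied by Z, each term of the claim becomes the corresponding term of
    \<open>main\<close>.\<close>
  define Z where "Z = W * K * X * (d1 * d2)"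
  have s1: "Z * (P * dualA q t a * Rm) = n1 * d1 * fm"
    using fm dA WP unfolding Z_def by algebra
  have s2: "Z * (W * Q * dualB q t a * Rp) = W^2 * n2 * d2 * fp"
    using fp dB QQi unfolding Z_def by algebra
  have s3: "Z * (dualC q t a * R) = W * n3 * (1 - T * Qi * X^2) * f"
    using f dC unfolding Z_def by algebra
  have s4: "Z * (E * R) = W * E * ((1 - T * Qi * X^2) * d1 * d2) * f"
    using f unfolding Z_def by algebra
  have "Z * (P * dualA q t a * Rm + W * Q * dualB q t a * Rp + dualC q t a * R) = Z * (E * R)"
    unfolding distrib_left s1 s2 s3 s4 main ..
  moreover have "Z \<noteq> 0"
  proof -
    have "d1 \<noteq> 0" "d2 \<noteq> 0"
      by (auto simp: d1_def d2_def X_def fps_eq_iff intro!: exI[of _ 0])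
    then show ?thesis
      using q0 t0 s0 sk tsk[of 0] by (simp add: Z_def W_def K_def X_def)
  qed
  ultimately show ?thesis
    unfolding WQ P_def[symmetric] E_def[symmetric] R_def[symmetric] Rm_def[symmetric] Rp_def[symmetric]
    by (simp only: mult_cancel_left) simp
qed

end

section \<open>The Koornwinder operator on the generating function\<close>

text \<open>A polynomial of degree below \<open>card W\<close> equals its Lagrange interpolant on W.
  The numerators of the Lagrange basis are monic of degree \<open>card W - 1\<close>, so comparing
  top coefficients gives the sum.\<close>

lemma lagrange_leading_coeff:
  fixes p :: "'a::field poly"
  assumes "finite W" "degree p < card W"
  shows "(\<Sum>w\<in>W. poly p w / (\<Prod>v\<in>W-{w}. w - v)) = coeff p (card W - 1)"
proof -
  define L where "L = (\<lambda>w. \<Prod>v\<in>W-{w}. [:-v, 1:])"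
  define c where "c = (\<lambda>w. poly p w / (\<Prod>v\<in>W-{w}. w - v))"
  define P where "P = (\<Sum>w\<in>W. smult (c w) (L w))"
  have W: "card W > 0" using assms by auto
  have degL: "degree (L w) = card W - 1" "coeff (L w) (card W - 1) = 1" if "w \<in> W" for w
  proof -
    have d: "degree (\<Prod>v\<in>A. [:-v, 1:]) = card A" if "finite A" for A :: "'a set"
      using that by (subst degree_prod_eq_sum_degree) auto
    have "lead_coeff (\<Prod>v\<in>W-{w}. [:-v, 1:]) = 1"
      by (simp add: lead_coeff_prod)
    then show "degree (L w) = card W - 1" "coeff (L w) (card W - 1) = 1"
      using that assms(1) by (simp_all add: L_def d)
  qed
  have root: "poly (p - P) w = 0" if "w \<in> W" for w
  proof -
    have "poly (L v) w = (if v = w then \<Prod>v\<in>W-{w}. w - v else 0)" if "v \<in> W" for v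
      using \<open>w \<in> W\<close> assms(1) by (auto simp: L_def poly_prod)
    then have "poly P w = (\<Sum>v\<in>W. if v = w then c v * (\<Prod>v\<in>W-{w}. w - v) else 0)"
      unfolding P_def poly_sum by (intro sum.cong) auto
    also have "\<dots> = poly p w"
      using that assms(1) by (simp add: c_def)
    finally show ?thesis by simp
  qed
  have deg: "degree (p - P) < card W"
    unfolding P_def using assms(2) W degL(1)
    by (intro degree_diff_less degree_sum_less) (auto intro: le_less_trans[OF degree_smult_le])
  have "p - P = 0"
  proof (rule ccontr)
    assume nz: "p - P \<noteq> 0"
    have "card W \<le> card {w. poly (p - P) w = 0}"
      by (rule card_mono[OF poly_roots_finite[OF nz]]) (use root in blast)
    also have "\<dots> \<le> degree (p - P)"
      by (rule card_poly_roots_bound[OF nz])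
    finally show False using deg by simp
  qed
  then have "coeff p (card W - 1) = coeff P (card W - 1)" by simp
  also have "\<dots> = (\<Sum>w\<in>W. c w)"
    unfolding P_def coeff_sum by (intro sum.cong) (auto simp: degL(2)[simplified])
  finally show ?thesis by (simp add: c_def)
qed

lemma degree_prod_linear: "degree (\<Prod>i\<in>A. [:1, f i:]) \<le> card A"
  and coeff_prod_linear: "finite A \<Longrightarrow> coeff (\<Prod>i\<in>A. [:1, f i:]) (card A) = (\<Prod>i\<in>A. f i :: 'a :: field)"
proof -
  show d: "degree (\<Prod>i\<in>A. [:1, f i:]) \<le> card A" for A
  proof (induction A rule: infinite_finite_induct)
    case (insert x A)
    then show ?case
      using degree_mult_le[of "[:1, f x:]" "\<Prod>i\<in>A. [:1, f i:]"] by (simp add: degree_pCons_eq_if split: if_splits)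
  qed auto
  show "finite A \<Longrightarrow> coeff (\<Prod>i\<in>A. [:1, f i:]) (card A) = (\<Prod>i\<in>A. f i)"
  proof (induction A rule: finite_induct)
    case (insert x A)
    then show ?case using coeff_eq_0[of "\<Prod>i\<in>A. [:1, f i:]" "Suc (card A)"] d[of A]
      by (simp add: mult_pCons_left)
  qed auto
qed

text \<open>
  Lagrange interpolation at the points of \<open>Y\<close> and the five zeros of \<open>h\<close>.
\<close>
lemma residue_sum:
  fixes Y :: "'a::field set" and a q t u \<theta> :: 'a
  assumes "finite Y" and t: "t * \<theta>^2 = 1" "(2::'a) \<noteq> 0" and nz: "t \<noteq> 0" "u \<noteq> 0" "q \<noteq> 0"
    and disj: "0 \<notin> Y" "1 / (t * u) \<notin> Y" "u / q \<notin> Y" "\<theta> \<notin> Y" "-\<theta> \<notin> Y"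
    and dist: "1 / (t * u) \<noteq> u / q" "1 / (t * u) \<noteq> \<theta>" "1 / (t * u) \<noteq> -\<theta>" "u / q \<noteq> \<theta>" "u / q \<noteq> -\<theta>"
    and p_def: "p = (\<lambda>w. (1 - a * w) * (1 + w) * (1 - q * w^2) * (\<Prod>z\<in>Y. 1 - t * z * w))"
    and h_def: "h = (\<lambda>w. w * (w - 1 / (t * u)) * (w - u / q) * (w^2 - 1 / t))"
  shows "(\<Sum>y\<in>Y. p y / (h y * (\<Prod>z\<in>Y-{y}. y - z))) +
     (- p 0 * t^2 * q / (\<Prod>z\<in>Y. - z)
     + p (1 / (t * u)) / ((1 / (t * u)) * (1 / (t * u) - u / q) * ((1 / (t * u))^2 - 1 / t) * (\<Prod>z\<in>Y. 1 / (t * u) - z))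
     + p (u / q) / ((u / q) * (u / q - 1 / (t * u)) * ((u / q)^2 - 1 / t) * (\<Prod>z\<in>Y. u / q - z))
     + p \<theta> * t / (2 * (\<theta> - 1 / (t * u)) * (\<theta> - u / q) * (\<Prod>z\<in>Y. \<theta> - z))
     + p (-\<theta>) * t / (2 * (-\<theta> - 1 / (t * u)) * (-\<theta> - u / q) * (\<Prod>z\<in>Y. -\<theta> - z)))
     = a * q * (\<Prod>z\<in>Y. - t * z)"
proof -
  define w1 w2 where "w1 = 1 / (t * u)" and "w2 = u / q"
  have th: "\<theta> \<noteq> 0" using t nz by auto
  have th2: "1 / t = \<theta>^2" using t(1) nz by (simp add: field_simps)
  then have ti: "inverse t = \<theta>^2" by (simp add: inverse_eq_divide)
  have thn: "\<theta> \<noteq> - \<theta>"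
    using th t(2) by (metis add.right_inverse mult_2 mult_eq_0_iff)
  define Z where "Z = {0, w1, w2, \<theta>, -\<theta>}"
  have w: "w1 \<noteq> 0" "w2 \<noteq> 0" "w1 \<noteq> w2" "w1 \<noteq> \<theta>" "w1 \<noteq> -\<theta>" "w2 \<noteq> \<theta>" "w2 \<noteq> -\<theta>"
    using nz dist by (auto simp: w1_def w2_def)
  have YZ: "Y \<inter> Z = {}" using disj by (auto simp: Z_def w1_def w2_def)
  have finZ: "finite Z" by (simp add: Z_def)
  have cardZ: "card Z = 5" using w th thn by (auto simp: Z_def card_insert_if eq_commute[of _ \<theta>])
  define P where "P = [:1, -a:] * [:1, 1:] * [:1, 0, -q:] * (\<Prod>z\<in>Y. [:1, - t * z:])"
  have polyP: "poly P w = p w" for w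
    by (simp add: P_def p_def poly_prod power2_eq_square algebra_simps)
  have card: "card (Y \<union> Z) = card Y + 5"
    using card_Un_disjoint[OF \<open>finite Y\<close> finZ YZ] cardZ by simp
  have deg3: "degree ([:1, -a:] * [:1, 1:] * [:1, 0, -q:]) \<le> 4"
    by (auto intro!: degree_le simp: coeff_eq_0 coeff_mult)
  \<comment> \<open>There are \<open>card Y + 5\<close> nodes, so the interpolation sum picks out
    the coefficient in degree \<open>4 + card Y\<close>; it plays the role of the residue at
    infinity.\<close>
  have "degree P \<le> 4 + card Y"
    unfolding P_def using degree_mult_le[of "[:1, -a:] * [:1, 1:] * [:1, 0, -q:]" "\<Prod>z\<in>Y. [:1, - t * z:]"]
      deg3 degree_prod_linear[of "\<lambda>z. - t * z" Y] by linarith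
  then have "degree P < card (Y \<union> Z)" using card by simp
  have c4: "coeff ([:1, -a:] * [:1, 1:] * [:1, 0, -q:]) 4 = a * q"
    by (simp add: eval_nat_numeral)
  have coeffP: "coeff P (4 + card Y) = a * q * (\<Prod>z\<in>Y. - t * z)"
  proof -
    let ?A = "[:1, -a:] * [:1, 1:] * [:1, 0, -q:]" and ?B = "\<Prod>z\<in>Y. [:1, - t * z:]"
    have "coeff (?A * ?B) (4 + card Y) = (\<Sum>i\<le>4 + card Y. coeff ?A i * coeff ?B (4 + card Y - i))"
      by (rule coeff_mult)
    also have "\<dots> = (\<Sum>i\<in>{4}. coeff ?A i * coeff ?B (4 + card Y - i))"
    proof (rule sum.mono_neutral_right)
      show "\<forall>i\<in>{..4 + card Y} - {4}. coeff ?A i * coeff ?B (4 + card Y - i) = 0"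
      proof
        fix i assume "i \<in> {..4 + card Y} - {4}"
        then consider "degree ?A < i" | "degree ?B < 4 + card Y - i"
          using deg3 degree_prod_linear[of "\<lambda>z. - t * z" Y] by fastforce
        then show "coeff ?A i * coeff ?B (4 + card Y - i) = 0"
          by cases (simp_all only: coeff_eq_0 mult_zero_left mult_zero_right)
      qed
    qed auto
    also have "\<dots> = a * q * (\<Prod>z\<in>Y. - t * z)"
      using c4 coeff_prod_linear[OF \<open>finite Y\<close>, of "\<lambda>z. - t * z"] by simp
    finally show ?thesis unfolding P_def .
  qed
  have s1: "(\<Sum>w\<in>Y \<union> Z. poly P w / (\<Prod>v\<in>Y \<union> Z-{w}. w - v)) = a * q * (\<Prod>z\<in>Y. - t * z)"
    using lagrange_leading_coeff[of "Y \<union> Z" P] \<open>finite Y\<close> finZ \<open>degree P < card (Y \<union> Z)\<close>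
    unfolding card by (simp add: coeffP)
  have s2: "(\<Sum>w\<in>Y \<union> Z. poly P w / (\<Prod>v\<in>Y \<union> Z-{w}. w - v)) =
    (\<Sum>w\<in>Y. poly P w / (\<Prod>v\<in>Y \<union> Z-{w}. w - v)) + (\<Sum>w\<in>Z. poly P w / (\<Prod>v\<in>Y \<union> Z-{w}. w - v))"
    using \<open>finite Y\<close> finZ YZ by (rule sum.union_disjoint)
  have s3: "(\<Sum>w\<in>Y. poly P w / (\<Prod>v\<in>Y \<union> Z-{w}. w - v)) = (\<Sum>y\<in>Y. p y / (h y * (\<Prod>z\<in>Y-{y}. y - z)))"
  proof (intro sum.cong refl)
    fix y assume y: "y \<in> Y"
    then have "Y \<union> Z - {y} = (Y - {y}) \<union> Z" using YZ by auto
    then have "(\<Prod>v\<in>Y \<union> Z-{y}. y - v) = (\<Prod>z\<in>Y-{y}. y - z) * (\<Prod>z\<in>Z. y - z)"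
      using \<open>finite Y\<close> finZ YZ by (simp only:) (rule prod.union_disjoint, auto)
    also have "(\<Prod>z\<in>Z. y - z) = h y"
      using w th thn unfolding Z_def h_def w1_def[symmetric] w2_def[symmetric] th2
      by (auto simp: eq_commute[of _ \<theta>]) (simp add: algebra_simps power2_eq_square)
    finally show "poly P y / (\<Prod>v\<in>Y \<union> Z-{y}. y - v) = p y / (h y * (\<Prod>z\<in>Y-{y}. y - z))"
      by (simp add: polyP mult.commute)
  qed
  have Zt: "poly P w / (\<Prod>v\<in>Y \<union> Z-{w}. w - v) = p w / ((\<Prod>v\<in>Z-{w}. w - v) * (\<Prod>z\<in>Y. w - z))"
    if "w \<in> Z" for w
  proof -
    have "Y \<union> Z - {w} = Y \<union> (Z - {w})" using that YZ by auto
    then show ?thesis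
      using \<open>finite Y\<close> finZ YZ by (simp add: polyP prod.union_disjoint disjoint_iff mult.commute)
  qed
  have s4: "(\<Sum>w\<in>Z. poly P w / (\<Prod>v\<in>Y \<union> Z-{w}. w - v)) =
     (\<Sum>w\<in>Z. p w / ((\<Prod>v\<in>Z-{w}. w - v) * (\<Prod>z\<in>Y. w - z)))"
    by (intro sum.cong refl Zt)
  also have "\<dots> = - p 0 * t^2 * q / (\<Prod>z\<in>Y. - z)
     + p w1 / (w1 * (w1 - w2) * (w1^2 - 1 / t) * (\<Prod>z\<in>Y. w1 - z))
     + p w2 / (w2 * (w2 - w1) * (w2^2 - 1 / t) * (\<Prod>z\<in>Y. w2 - z))
     + p \<theta> * t / (2 * (\<theta> - w1) * (\<theta> - w2) * (\<Prod>z\<in>Y. \<theta> - z))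
     + p (-\<theta>) * t / (2 * (-\<theta> - w1) * (-\<theta> - w2) * (\<Prod>z\<in>Y. -\<theta> - z))"
  proof -
    have Zd: "Z - {0} = {w1, w2, \<theta>, -\<theta>}" "Z - {w1} = {0, w2, \<theta>, -\<theta>}"
      "Z - {w2} = {0, w1, \<theta>, -\<theta>}" "Z - {\<theta>} = {0, w1, w2, -\<theta>}" "Z - {-\<theta>} = {0, w1, w2, \<theta>}"
      using w th thn by (auto simp: Z_def)
    have ne: "0 \<noteq> w1" "0 \<noteq> w2" "w2 \<noteq> w1" "\<theta> \<noteq> w1" "-\<theta> \<noteq> w1" "\<theta> \<noteq> w2" "-\<theta> \<noteq> w2" "0 \<noteq> \<theta>" "0 \<noteq> -\<theta>" "-\<theta> \<noteq> \<theta>"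
      using w th thn by auto
    have P0: "(\<Prod>v\<in>Z-{0}. 0 - v) = - (1 / (t^2 * q))"
      unfolding Zd using ne w thn nz th2
      by (simp add: w1_def w2_def field_simps power2_eq_square)
    have P1: "(\<Prod>v\<in>Z-{w1}. w1 - v) = w1 * (w1 - w2) * (w1^2 - 1 / t)"
      unfolding Zd th2 using ne w thn by simp (simp add: algebra_simps power2_eq_square)
    have P2: "(\<Prod>v\<in>Z-{w2}. w2 - v) = w2 * (w2 - w1) * (w2^2 - 1 / t)"
      unfolding Zd th2 using ne w thn by simp (simp add: algebra_simps power2_eq_square)
    have P3: "(\<Prod>v\<in>Z-{\<theta>}. \<theta> - v) = 2 * (\<theta> - w1) * (\<theta> - w2) / t"
      unfolding Zd divide_inverse ti using ne w thn by simp (simp add: algebra_simps power2_eq_square)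
    have P4: "(\<Prod>v\<in>Z-{-\<theta>}. -\<theta> - v) = 2 * (-\<theta> - w1) * (-\<theta> - w2) / t"
      unfolding Zd divide_inverse ti using ne w thn by simp (simp add: algebra_simps power2_eq_square)
    have sumZ: "(\<Sum>w\<in>Z. F w) = F 0 + F w1 + F w2 + F \<theta> + F (-\<theta>)" for F :: "'a \<Rightarrow> 'a"
      unfolding Z_def using ne w thn by (simp add: add.assoc)
    show ?thesis
      unfolding sumZ P0 P1 P2 P3 P4 by simp
  qed
  finally show ?thesis
    using s1 unfolding s2 s3 w1_def[symmetric] w2_def[symmetric] by (simp only:)
qed

text \<open>The functions p and h are chosen so that the residue at a node y in Y is, up to a
  constant, \<kappa> i y * (\<rho> y - 1). The product over Y in p also contains the indices z = y
  and z = 1/y, hence the factors 1 - t y^2 and 1 - t; the factor w^2 - 1/t of h cancels the first,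
  which creates the poles \<theta> and -\<theta> with \<theta>^2 = 1/t. Of the other poles, 1/(t u)
  and u/q yield the two products, \<theta> and -\<theta> together the third summand, and 0 and
  infinity the final constant. The field is arbitrary because the identity will be used with a
  formal variable u.\<close>

lemma kernel_identity:
  fixes x :: "nat \<Rightarrow> 'a::field" and a q t u \<theta> :: 'a
  assumes t: "t * \<theta>^2 = 1" "(2::'a) \<noteq> 0" "t \<noteq> 1" and nz: "u \<noteq> 0" "q \<noteq> 0" "q \<noteq> 1" "n > 0"
    and x0: "\<And>i. i < n \<Longrightarrow> x i \<noteq> 0"
    and reg: "\<And>i. i < n \<Longrightarrow> (x i)^2 \<noteq> 1 \<and> q * (x i)^2 \<noteq> 1 \<and> (x i)^2 \<noteq> q \<and> t * (x i)^2 \<noteq> 1 \<and> (x i)^2 \<noteq> t"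
    and reg2: "\<And>i j. i < n \<Longrightarrow> j < n \<Longrightarrow> i \<noteq> j \<Longrightarrow> x i \<noteq> x j \<and> x i * x j \<noteq> 1"
    and ux: "\<And>i. i < n \<Longrightarrow> t * u * x i \<noteq> 1 \<and> t * u \<noteq> x i \<and> u \<noteq> q * x i \<and> u * x i \<noteq> q"
    and u: "t * u^2 \<noteq> q" "t * u^2 \<noteq> 1" "t * u^2 \<noteq> q^2"
  defines "\<kappa> \<equiv> \<lambda>i y. (1 + y) * (1 - a * y) * (1 - q * y^2) / (t ^ (n - 1) * (1 - y^2) * (1 - q * y^2)) *
      (\<Prod>j\<in>{..<n}-{i}. (1 - t * y * x j) * (1 - t * y / x j) / ((1 - y * x j) * (1 - y / x j)))"
    and "\<rho> \<equiv> \<lambda>y. (1 - u * y) * (1 - t * u / (q * y)) / ((1 - t * u * y) * (1 - u / (q * y)))"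
  shows "(\<Sum>i<n. \<kappa> i (x i) * (\<rho> (x i) - 1) + \<kappa> i (1 / x i) * (\<rho> (1 / x i) - 1)) =
    t ^ (n - 1) * (1 + t * u) * (a - t * u) * (1 - t^2 * u^2 / q) / ((1 - t * u^2) * (1 - t * u^2 / q)) *
      (\<Prod>i<n. (1 - u * x i) * (1 - u / x i) / ((1 - t * u * x i) * (1 - t * u / x i)))
    + (1 + u / q) * (1 - a * u / q) * (1 - u^2 / q) / (t ^ (n - 1) * (1 - t * u^2 / q^2) * (1 - t * u^2 / q)) *
      (\<Prod>i<n. (1 - t * u * x i / q) * (1 - t * u / (q * x i)) / ((1 - u * x i / q) * (1 - u / (q * x i))))
    + (q - t) * (u / q) * ((t - a) * (q + 1) * (u / q) + (1 - a) * (1 + t * u^2 / q)) / ((1 - t * u^2) * (1 - t * u^2 / q^2))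
    - (a * t ^ (n - 1) + 1 / t ^ (n - 1))"
proof -
  have t0: "t \<noteq> 0" using t by auto
  define Y where "Y = x ` {..<n} \<union> (\<lambda>i. 1 / x i) ` {..<n}"
  have inj: "inj_on x {..<n}" "inj_on (\<lambda>i. 1 / x i) {..<n}"
    using reg2 x0 by (force simp: inj_on_def)+
  have disj: "x ` {..<n} \<inter> (\<lambda>i. 1 / x i) ` {..<n} = {}"
  proof -
    have "x i \<noteq> 1 / x j" if "i < n" "j < n" for i j
      using that reg[of i] reg2[of i j] x0[of j] by (cases "i = j") (auto simp: field_simps power2_eq_square)
    then show ?thesis by auto
  qed
  have finY: "finite Y" by (simp add: Y_def)
  have sumY: "(\<Sum>y\<in>Y. f y) = (\<Sum>i<n. f (x i) + f (1 / x i))" for f :: "'a \<Rightarrow> 'a"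
    unfolding Y_def using disj inj by (simp add: sum.union_disjoint sum.reindex sum.distrib)
  have prodY: "(\<Prod>y\<in>Y. f y) = (\<Prod>i<n. f (x i) * f (1 / x i))" for f :: "'a \<Rightarrow> 'a"
    unfolding Y_def using disj inj by (simp add: prod.union_disjoint prod.reindex prod.distrib)
  define p where "p = (\<lambda>w. (1 - a * w) * (1 + w) * (1 - q * w^2) * (\<Prod>z\<in>Y. 1 - t * z * w))"
  define h where "h = (\<lambda>w. w * (w - 1 / (t * u)) * (w - u / q) * (w^2 - 1 / t))"
  have inv: "1 / y \<in> Y" if "y \<in> Y" for y using that by (auto simp: Y_def)
  have Y0: "0 \<notin> Y" using x0 by (auto simp: Y_def)
  have Yq: "y^2 \<noteq> 1" "q * y^2 \<noteq> 1" "t * y^2 \<noteq> 1" "t * u * y \<noteq> 1" "q * y \<noteq> u" if "y \<in> Y" for y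
  proof -
    from that obtain i where "i < n" "y = x i \<or> y = 1 / x i" by (auto simp: Y_def)
    then have "y^2 \<noteq> 1 \<and> q * y^2 \<noteq> 1 \<and> t * y^2 \<noteq> 1 \<and> t * u * y \<noteq> 1 \<and> q * y \<noteq> u"
    proof (elim disjE)
      assume "y = 1 / x i"
      show ?thesis unfolding \<open>y = 1 / x i\<close>
        using \<open>i < n\<close> reg[of i] ux[of i] x0[of i] by (auto simp: field_simps)
    qed (use \<open>i < n\<close> reg[of i] ux[of i] in auto)
    then show "y^2 \<noteq> 1" "q * y^2 \<noteq> 1" "t * y^2 \<noteq> 1" "t * u * y \<noteq> 1" "q * y \<noteq> u"
      by auto
  qed
  have prod1: "(\<Prod>z\<in>Y. c * z) = c ^ (2 * n)" for c
    unfolding prodY using x0 by (simp add: power_mult power2_eq_square)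
  \<comment> \<open>The difference \<rho> y - 1 has numerator u (1 - t) (1 - q y^2). This is why p
    carries the factor 1 - q w^2.\<close>
  have node: "\<kappa> i y * (\<rho> y - 1) = - 1 / (t^2 * q * t ^ (n - 1)) * (p y / (h y * (\<Prod>z\<in>Y-{y}. y - z)))"
    if "i < n" "y = x i \<or> y = 1 / x i" for i y
  proof -
    have y: "y \<in> Y" using that by (auto simp: Y_def)
    have y0: "y \<noteq> 0" using y Y0 by auto
    define v where "v = (\<lambda>c. \<Prod>j\<in>{..<n}-{i}. (1 - c * y * x j) * (1 - c * y / x j))"
    define Y' where "Y' = x ` ({..<n}-{i}) \<union> (\<lambda>i. 1 / x i) ` ({..<n}-{i})"
    have prodY': "(\<Prod>z\<in>Y'. f z) = (\<Prod>j\<in>{..<n}-{i}. f (x j) * f (1 / x j))" for f :: "'a \<Rightarrow> 'a"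
    proof -
      have "x ` ({..<n}-{i}) \<inter> (\<lambda>i. 1 / x i) ` ({..<n}-{i}) = {}" using disj by blast
      moreover have "inj_on x ({..<n}-{i})" "inj_on (\<lambda>i. 1 / x i) ({..<n}-{i})"
        using inj by (auto intro: inj_on_subset)
      ultimately show ?thesis
        unfolding Y'_def by (simp add: prod.union_disjoint prod.reindex prod.distrib)
    qed
    have "{..<n} = insert i ({..<n} - {i})" using that by auto
    then have "Y = insert (x i) (insert (1 / x i) Y')"
      unfolding Y_def Y'_def by (metis Un_insert_left Un_insert_right image_insert)
    moreover have "x i \<notin> Y'" "1 / x i \<notin> Y'"
    proof -
      have "x i \<noteq> 1 / x j" "1 / x i \<noteq> x j" "1 / x i \<noteq> 1 / x j" "x i \<noteq> x j" if "j < n" "j \<noteq> i" for j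
        using that reg2[of i j] x0[of j] x0[of i] \<open>i < n\<close> by (auto simp: field_simps)
      then show "x i \<notin> Y'" "1 / x i \<notin> Y'"
        unfolding Y'_def by blast+
    qed
    moreover have yy: "y \<noteq> 1 / y" "1 / y \<noteq> y" using Yq(1)[OF y] y0 by (auto simp: field_simps power2_eq_square)
    ultimately have Y: "Y = insert y (insert (1 / y) Y')" "y \<notin> Y'" "1 / y \<notin> Y'" "finite Y'"
      using that by (auto simp: Y'_def)
    have v: "(\<Prod>z\<in>Y. 1 - c * z * y) = (1 - c) * (1 - c * y^2) * v c" for c
      using Y yy y0 by (simp add: prodY' v_def power2_eq_square mult_ac)
    have D: "(\<Prod>z\<in>Y-{y}. y - z) = (y - 1 / y) * v 1"
    proof -
      have "Y - {y} = insert (1 / y) Y'" using Y yy by auto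
      moreover have "(y - x j) * (y - 1 / x j) = (1 - 1 * y * x j) * (1 - 1 * y / x j)" if "j < n" for j
        using x0[OF that] by (simp add: field_simps)
      ultimately show ?thesis using Y by (simp add: prodY' v_def)
    qed
    have den: "1 - t * u * y \<noteq> 0" "q * y - u \<noteq> 0" "1 - y^2 \<noteq> 0" "1 - q * y^2 \<noteq> 0" "1 - t * y^2 \<noteq> 0"
      using Yq[OF y] by auto
    have \<rho>: "\<rho> y - 1 = u * (1 - t) * (1 - q * y^2) / ((1 - t * u * y) * (q * y - u))"
    proof -
      have "1 - u / (q * y) = (q * y - u) / (q * y)" using y0 nz by (simp add: field_simps)
      moreover have "1 - t * u / (q * y) = (q * y - t * u) / (q * y)" using y0 nz by (simp add: field_simps)
      ultimately have "\<rho> y = (1 - u * y) * (q * y - t * u) / ((1 - t * u * y) * (q * y - u))"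
        using y0 nz by (simp add: \<rho>_def)
      then have "\<rho> y - 1 = ((1 - u * y) * (q * y - t * u) - (1 - t * u * y) * (q * y - u)) / ((1 - t * u * y) * (q * y - u))"
        using den by (simp add: diff_divide_distrib)
      moreover have "(1 - u * y) * (q * y - t * u) - (1 - t * u * y) * (q * y - u) = u * (1 - t) * (1 - q * y^2)"
        by algebra
      ultimately show ?thesis by simp
    qed
    have \<kappa>: "\<kappa> i y = (1 + y) * (1 - a * y) / (t ^ (n - 1) * (1 - y^2)) * (v t / v 1)"
      using den unfolding \<kappa>_def v_def prod_dividef by simp
    have h: "h y = y * (1 - t * u * y) * (q * y - u) * (1 - t * y^2) / (t^2 * u * q)"
      using nz t0 by (simp add: h_def field_simps power2_eq_square)
    have p: "p y = (1 - a * y) * (1 + y) * (1 - q * y^2) * ((1 - t) * (1 - t * y^2) * v t)"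
      by (simp add: p_def v)
    have D': "(\<Prod>z\<in>Y-{y}. y - z) = - ((1 - y^2) * v 1) / y"
      unfolding D using y0 by (simp add: field_simps power2_eq_square)
    show ?thesis
      unfolding \<rho> \<kappa> h p D' using den y0 nz t0 by (simp add: mult_ac)
  qed
  have th2: "\<theta>^2 = 1 / t" using t(1) t0 by (simp add: field_simps)
  have sq: "w \<noteq> \<theta>" "w \<noteq> -\<theta>" if "t * w^2 \<noteq> 1" for w
    using that t(1) by auto
  have sq_w: "t * (1 / (t * u))^2 \<noteq> 1" "t * (u / q)^2 \<noteq> 1"
    using u nz t0 by (auto simp: field_simps power2_eq_square)
  have dist: "1 / (t * u) \<noteq> u / q" "1 / (t * u) \<noteq> \<theta>" "1 / (t * u) \<noteq> -\<theta>" "u / q \<noteq> \<theta>" "u / q \<noteq> -\<theta>"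
    using u(1) nz t0 sq[OF sq_w(1)] sq[OF sq_w(2)] by (auto simp: field_simps power2_eq_square)
  have disjZ: "1 / (t * u) \<notin> Y" "u / q \<notin> Y" "\<theta> \<notin> Y" "-\<theta> \<notin> Y"
    using Yq(3)[of \<theta>] Yq(3)[of "-\<theta>"] t(1) Yq(4)[of "1 / (t * u)"] Yq(5)[of "u / q"] t0 nz
    by auto
  note res = residue_sum[OF finY t(1,2) t0 nz(1,2) Y0 disjZ dist p_def h_def]
  define w1 w2 where "w1 = 1 / (t * u)" and "w2 = u / q"
  have sumk: "(\<Sum>i<n. \<kappa> i (x i) * (\<rho> (x i) - 1) + \<kappa> i (1 / x i) * (\<rho> (1 / x i) - 1)) =
     - 1 / (t^2 * q * t ^ (n - 1)) * (\<Sum>y\<in>Y. p y / (h y * (\<Prod>z\<in>Y-{y}. y - z)))"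
    unfolding sumY sum_distrib_left by (intro sum.cong refl) (simp add: node distrib_left)
  define R1 where "R1 = (\<Prod>i<n. (1 - u * x i) * (1 - u / x i) / ((1 - t * u * x i) * (1 - t * u / x i)))"
  define R2 where "R2 = (\<Prod>i<n. (1 - t * u * x i / q) * (1 - t * u / (q * x i)) / ((1 - u * x i / q) * (1 - u / (q * x i))))"
  have R1: "(\<Prod>z\<in>Y. 1 - t * z * w1) / (\<Prod>z\<in>Y. w1 - z) = t^(2 * n) * R1"
  proof -
    have "(1 - t * x i * w1) * (1 - t * (1 / x i) * w1) / ((w1 - x i) * (w1 - 1 / x i)) =
       t^2 * ((1 - u * x i) * (1 - u / x i) / ((1 - t * u * x i) * (1 - t * u / x i)))" if "i < n" for i
    proof -
      have "1 - t * u * x i \<noteq> 0" "x i - t * u \<noteq> 0" using ux[OF that] by auto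
      then show ?thesis
        using x0[OF that] nz t0 unfolding w1_def
        by (simp add: divide_simps) (simp add: algebra_simps power2_eq_square)
    qed
    then have "(\<Prod>i<n. (1 - t * x i * w1) * (1 - t * (1 / x i) * w1) / ((w1 - x i) * (w1 - 1 / x i))) =
       (\<Prod>i<n. t^2 * ((1 - u * x i) * (1 - u / x i) / ((1 - t * u * x i) * (1 - t * u / x i))))"
      by (intro prod.cong refl) simp
    also have "\<dots> = t^(2 * n) * R1"
      by (simp only: prod.distrib prod_constant card_lessThan power_mult R1_def)
    finally show ?thesis
      unfolding prodY prod_dividef[symmetric] .
  qed
  have R2: "(\<Prod>z\<in>Y. 1 - t * z * w2) / (\<Prod>z\<in>Y. w2 - z) = R2"
  proof -
    have "(1 - t * x i * w2) * (1 - t * (1 / x i) * w2) / ((w2 - x i) * (w2 - 1 / x i)) =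
       (1 - t * u * x i / q) * (1 - t * u / (q * x i)) / ((1 - u * x i / q) * (1 - u / (q * x i)))" if "i < n" for i
    proof -
      have "(w2 - x i) * (w2 - 1 / x i) = (1 - u * x i / q) * (1 - u / (q * x i))"
        using x0[OF that] nz unfolding w2_def by (simp add: field_simps)
      moreover have "t * x i * w2 = t * u * x i / q" "t * (1 / x i) * w2 = t * u / (q * x i)"
        using nz by (simp_all add: w2_def)
      ultimately show ?thesis by simp
    qed
    then show ?thesis
      unfolding prodY R2_def prod_dividef[symmetric] by (intro prod.cong refl) simp
  qed
  \<comment> \<open>Because t w^2 = 1, each pair of nodes x i, 1 / x i contributes the constant t,
    independently of x.\<close>
  have R3: "(\<Prod>z\<in>Y. 1 - t * z * w) / (\<Prod>z\<in>Y. w - z) = t ^ n" if "w = \<theta> \<or> w = -\<theta>" for w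
  proof -
    have w: "t * w^2 = 1" using that t(1) by auto
    have "(1 - t * x i * w) * (1 - t * (1 / x i) * w) / ((w - x i) * (w - 1 / x i)) = t" if "i < n" for i
    proof -
      have "x i \<in> Y" "1 / x i \<in> Y" using that by (auto simp: Y_def)
      then have "w - x i \<noteq> 0" "w - 1 / x i \<noteq> 0" using Yq(3) w by auto
      moreover have "(1 - t * x i * w) * (1 - t * (1 / x i) * w) = 1 - t * w * (x i + 1 / x i) + t * (t * w^2)"
        using x0[OF that] by (simp add: field_simps power2_eq_square)
      moreover have "t * ((w - x i) * (w - 1 / x i)) = t * w^2 - t * w * (x i + 1 / x i) + t"
        using x0[OF that] by (simp add: field_simps power2_eq_square)
      ultimately have "(1 - t * x i * w) * (1 - t * (1 / x i) * w) = t * ((w - x i) * (w - 1 / x i))"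
        unfolding w by simp
      then show ?thesis using \<open>w - x i \<noteq> 0\<close> \<open>w - 1 / x i \<noteq> 0\<close> by simp
    qed
    then show ?thesis
      unfolding prodY prod_dividef[symmetric] by simp
  qed
  define q4 where "q4 = (\<lambda>w. (1 - a * w) * (1 + w) * (1 - q * w^2))"
  define \<tau> where "\<tau> = t ^ (n - 1)"
  have tn: "t ^ n = t * \<tau>" using nz(4) unfolding \<tau>_def by (metis Suc_diff_1 power_Suc)
  have t2n: "t ^ (2 * n) = t^2 * \<tau>^2" using tn by (simp add: power_mult mult.commute[of 2] power_mult_distrib)
  have \<tau>0: "\<tau> \<noteq> 0" using t0 by (simp add: \<tau>_def)
  have pq: "p w / (c * (\<Prod>z\<in>Y. w - z)) = q4 w / c * ((\<Prod>z\<in>Y. 1 - t * z * w) / (\<Prod>z\<in>Y. w - z))" for w c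
    by (simp add: p_def q4_def)
  have pq': "p w * t / (c * (\<Prod>z\<in>Y. w - z)) = q4 w * t / c * ((\<Prod>z\<in>Y. 1 - t * z * w) / (\<Prod>z\<in>Y. w - z))" for w c
    by (simp add: p_def q4_def)
  have p0: "p 0 = 1" by (simp add: p_def)
  have pm: "(\<Prod>z\<in>Y. - z) = 1" "(\<Prod>z\<in>Y. - t * z) = t ^ (2 * n)"
    using prod1[of "-1"] prod1[of "-t"] by simp_all
  have S: "(\<Sum>y\<in>Y. p y / (h y * (\<Prod>z\<in>Y-{y}. y - z))) = a * q * t ^ (2 * n) + t^2 * q
     - q4 w1 / (w1 * (w1 - w2) * (w1^2 - 1 / t)) * (t ^ (2 * n) * R1)
     - q4 w2 / (w2 * (w2 - w1) * (w2^2 - 1 / t)) * R2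
     - (q4 \<theta> * t / (2 * (\<theta> - w1) * (\<theta> - w2)) + q4 (-\<theta>) * t / (2 * (-\<theta> - w1) * (-\<theta> - w2))) * t ^ n"
  proof -
    have *: "X = U + V - A - B - (C + D) * T" if "X + (- 1 * t^2 * q / 1 + A + B + C * T + D * T) = U" "V = t^2 * q"
      for X U V A B C D T using that by (simp add: algebra_simps)
    show ?thesis
      by (rule *) (use res R3[of \<theta>] R3[of "-\<theta>"] in \<open>simp_all only: p0 pm w1_def[symmetric] w2_def[symmetric] pq pq' R1 R2 simp_thms\<close>)
  qed
  have e1: "1 / (t^2 * q * \<tau>) * (q4 w1 / (w1 * (w1 - w2) * (w1^2 - 1 / t)) * t ^ (2 * n)) =
     \<tau> * (1 + t * u) * (a - t * u) * (1 - t^2 * u^2 / q) / ((1 - t * u^2) * (1 - t * u^2 / q))"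
  proof -
    have d: "1 - t * u^2 \<noteq> 0" "1 - t * u^2 / q \<noteq> 0" "q - t * u^2 \<noteq> 0" using u nz by (auto simp: field_simps)
    have "q4 w1 = (1 + t * u) * (a - t * u) * (1 - t^2 * u^2 / q) * q / (t * u)^4"
      using t0 nz by (simp add: q4_def w1_def field_simps eval_nat_numeral)
    moreover have "w1 * (w1 - w2) * (w1^2 - 1 / t) = (1 - t * u^2 / q) * (1 - t * u^2) / (t * u)^4"
      using t0 nz by (simp add: w1_def w2_def field_simps eval_nat_numeral)
    ultimately have "q4 w1 / (w1 * (w1 - w2) * (w1^2 - 1 / t)) = (1 + t * u) * (a - t * u) * (1 - t^2 * u^2 / q) * q /
        ((1 - t * u^2 / q) * (1 - t * u^2))"
      using t0 nz by simp
    then show ?thesis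
      unfolding t2n using t0 nz \<tau>0 by (simp add: power2_eq_square mult_ac)
  qed
  have e2: "1 / (t^2 * q * \<tau>) * (q4 w2 / (w2 * (w2 - w1) * (w2^2 - 1 / t))) =
     (1 + u / q) * (1 - a * u / q) * (1 - u^2 / q) / (\<tau> * (1 - t * u^2 / q^2) * (1 - t * u^2 / q))"
  proof -
    have d: "1 - t * u^2 / q^2 \<noteq> 0" "1 - t * u^2 / q \<noteq> 0" using u nz by (auto simp: field_simps)
    have "w2 * (w2 - w1) * (w2^2 - 1 / t) = (1 - t * u^2 / q) * (1 - t * u^2 / q^2) / (t^2 * q)"
      using t0 nz by (simp add: w1_def w2_def field_simps eval_nat_numeral)
    moreover have "q4 w2 = (1 + u / q) * (1 - a * u / q) * (1 - u^2 / q)"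
      using nz by (simp add: q4_def w2_def power2_eq_square)
    ultimately show ?thesis
      using t0 nz \<tau>0 d by simp
  qed
  \<comment> \<open>Over a common denominator the contributions of \<theta> and -\<theta> add up to
    an expression in \<theta>^2 = 1/t, so the square root disappears.\<close>
  have e3: "1 / (t^2 * q * \<tau>) * ((q4 \<theta> * t / (2 * (\<theta> - w1) * (\<theta> - w2)) + q4 (-\<theta>) * t / (2 * (-\<theta> - w1) * (-\<theta> - w2))) * t ^ n) =
     (q - t) * (u / q) * ((t - a) * (q + 1) * (u / q) + (1 - a) * (1 + t * u^2 / q)) / ((1 - t * u^2) * (1 - t * u^2 / q^2))"
  proof -
    have d: "1 - t * u^2 / q^2 \<noteq> 0" "1 - t * u^2 \<noteq> 0" using u nz by (auto simp: field_simps)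
    have nw: "\<theta> - w1 \<noteq> 0" "\<theta> - w2 \<noteq> 0" "-\<theta> - w1 \<noteq> 0" "-\<theta> - w2 \<noteq> 0"
      using dist unfolding w1_def w2_def by (auto simp: eq_commute[of \<theta>] eq_commute[of "-\<theta>"])
    have den: "(\<theta> - w1) * (\<theta> - w2) * ((-\<theta> - w1) * (-\<theta> - w2)) = - (1 - t * u^2) * (1 - t * u^2 / q^2) / (t^3 * u^2)"
    proof -
      have "(\<theta> - w1) * (\<theta> - w2) * ((-\<theta> - w1) * (-\<theta> - w2)) = (\<theta>^2 - w1^2) * (\<theta>^2 - w2^2)" by algebra
      then show ?thesis unfolding th2 using t0 nz by (simp add: w1_def w2_def field_simps eval_nat_numeral)
    qed
    have "q4 \<theta> * ((-\<theta> - w1) * (-\<theta> - w2)) + q4 (-\<theta>) * ((\<theta> - w1) * (\<theta> - w2)) =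
      2 * (1 - q * \<theta>^2) * ((1 - a * \<theta>^2) * (\<theta>^2 + w1 * w2) + (1 - a) * \<theta>^2 * (w1 + w2))"
      unfolding q4_def by algebra
    also have "\<dots> = 2 * (1 - q / t) * ((1 - a / t) * (q + 1) / (t * q) + (1 - a) / t * (1 / (t * u) + u / q))"
      using t0 nz by (simp add: th2 w1_def w2_def field_simps)
    finally have num: "q4 \<theta> * ((-\<theta> - w1) * (-\<theta> - w2)) + q4 (-\<theta>) * ((\<theta> - w1) * (\<theta> - w2)) = \<dots>" .
    have "q4 \<theta> * t / (2 * (\<theta> - w1) * (\<theta> - w2)) + q4 (-\<theta>) * t / (2 * (-\<theta> - w1) * (-\<theta> - w2)) =
      t / 2 * ((q4 \<theta> * ((-\<theta> - w1) * (-\<theta> - w2)) + q4 (-\<theta>) * ((\<theta> - w1) * (\<theta> - w2))) /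
       ((\<theta> - w1) * (\<theta> - w2) * ((-\<theta> - w1) * (-\<theta> - w2))))"
    proof -
      have "X * t / (2 * b * c) + Y * t / (2 * d * e) = t / 2 * ((X * (d * e) + Y * (b * c)) / (b * c * (d * e)))"
        if "b \<noteq> 0" "c \<noteq> 0" "d \<noteq> 0" "e \<noteq> 0" for X Y b c d e :: 'a
        using that t(2) by (simp add: field_simps)
      then show ?thesis using nw by blast
    qed
    also have "\<dots> = t * ((1 - q / t) * ((1 - a / t) * (q + 1) / (t * q) + (1 - a) / t * (1 / (t * u) + u / q)) /
       (- (1 - t * u^2) * (1 - t * u^2 / q^2) / (t^3 * u^2)))"
    proof -
      have "t / 2 * (2 * A * B / D) = t * (A * B / D)" for A B D :: 'a
        using t(2) by simp
      then show ?thesis unfolding num den by blast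
    qed
    also have "\<dots> = t * q * ((q - t) * (u / q) * ((t - a) * (q + 1) * (u / q) + (1 - a) * (1 + t * u^2 / q)) / ((1 - t * u^2) * (1 - t * u^2 / q^2)))"
    proof -
      have "(1 - q / t) * ((1 - a / t) * (q + 1) / (t * q) + (1 - a) / t * (1 / (t * u) + u / q)) * (- (t^3 * u^2)) =
         q * ((q - t) * (u / q) * ((t - a) * (q + 1) * (u / q) + (1 - a) * (1 + t * u^2 / q)))"
        using t0 nz by (simp add: field_simps eval_nat_numeral)
      moreover have "t * (A / (- B * C / F)) = t * q * (G / (B * C))" if "A * (- F) = q * G" for A B C F G :: 'a
      proof -
        have "A / (- B * C / F) = A * (- F) / (B * C)" by simp
        then show ?thesis unfolding that by simp
      qed
      ultimately show ?thesis by blast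
    qed
    finally show ?thesis unfolding tn using t0 nz \<tau>0 by (simp add: power2_eq_square)
  qed
  have e0: "1 / (t^2 * q * \<tau>) * (a * q * t ^ (2 * n) + t^2 * q) = a * \<tau> + 1 / \<tau>"
    using t0 nz \<tau>0 unfolding t2n by (simp add: field_simps power2_eq_square)
  have "- 1 / (t^2 * q * \<tau>) * (A - B * (t ^ (2 * n) * R1) - C * R2 - D) =
     1 / (t^2 * q * \<tau>) * (B * t ^ (2 * n)) * R1 + 1 / (t^2 * q * \<tau>) * C * R2 + 1 / (t^2 * q * \<tau>) * D - 1 / (t^2 * q * \<tau>) * A"
    for A B C D
    by (simp add: algebra_simps)
  then show ?thesis
    unfolding sumk S R1_def[symmetric] R2_def[symmetric] \<tau>_def[symmetric]
    by (simp only: e0 e1 e2 e3)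
qed

section \<open>The q-binomial theorem and the generating function\<close>

lemma qpoch_inf_convergent:
  assumes "norm (q :: complex) < 1"
  shows "convergent_prod (\<lambda>k. 1 - q ^ k * z)"
proof (rule abs_convergent_prod_imp_convergent_prod)
  have "summable (\<lambda>k. norm q ^ k * norm z)"
    using assms by (intro summable_mult2 summable_geometric) auto
  then show "abs_convergent_prod (\<lambda>k. 1 - q ^ k * z)"
    by (simp add: abs_convergent_prod_conv_summable norm_mult norm_power)
qed

lemma qpoch_inf_tendsto:
  assumes "norm q < 1"
  shows "(\<lambda>N. qpoch z q N) \<longlonglongrightarrow> qpoch_inf z q"
  using convergent_prod_has_prod[OF qpoch_inf_convergent[OF assms]]
  unfolding qpoch_inf_def qpoch_def by (intro has_prod_imp_tendsto')

lemma qpoch_inf_functional: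
  assumes "norm q < 1"
  shows "qpoch_inf z q = (1 - z) * qpoch_inf (q * z) q"
proof -
  have "qpoch z q (Suc N) = (1 - z) * qpoch (q * z) q N" for N
    by (induction N) (simp_all add: qpoch_Suc mult_ac)
  then have "(\<lambda>N. qpoch z q (Suc N)) \<longlonglongrightarrow> (1 - z) * qpoch_inf (q * z) q"
    by (auto intro!: tendsto_intros qpoch_inf_tendsto assms)
  with LIMSEQ_Suc[OF qpoch_inf_tendsto[OF assms]] show ?thesis
    using LIMSEQ_unique by blast
qed

lemma qpoch_inf_holomorphic:
  assumes "norm q < 1"
  shows "(\<lambda>z. qpoch_inf z q) holomorphic_on ball 0 1"
proof (rule holomorphic_uniform_sequence[where f = "\<lambda>N z. qpoch z q N"])
  show "(\<lambda>z. qpoch z q N) holomorphic_on ball 0 1" for N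
    unfolding qpoch_def by (intro holomorphic_intros)
  have "uniformly_convergent_on (cball 0 1) (\<lambda>N z. \<Sum>k<N. norm ((1 - q ^ k * z) - 1))"
  proof (rule Weierstrass_m_test'_ev)
    show "\<forall>\<^sub>F k in sequentially. \<forall>z\<in>cball 0 1. norm (norm ((1 - q ^ k * z) - 1)) \<le> norm q ^ k"
      by (auto simp: norm_mult norm_power mult_left_le)
    show "summable (\<lambda>k. norm q ^ k)" using assms by (intro summable_geometric) auto
  qed
  then have "uniformly_convergent_on (cball 0 1) (\<lambda>N z. qpoch z q N)"
    unfolding qpoch_def by (intro uniformly_convergent_on_prod') (auto intro!: continuous_intros)
  then obtain l where l: "uniform_limit (cball 0 1) (\<lambda>N z. qpoch z q N) l sequentially"
    by (auto simp: uniformly_convergent_on_def)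
  have "l z = qpoch_inf z q" if "z \<in> cball 0 1" for z
    using tendsto_uniform_limitI[OF l that] qpoch_inf_tendsto[OF assms] LIMSEQ_unique by blast
  then have lim: "uniform_limit (cball 0 1) (\<lambda>N z. qpoch z q N) (\<lambda>z. qpoch_inf z q) sequentially"
    using l by (subst uniform_limit_cong'[where g = "\<lambda>N z. qpoch z q N" and i = l]) auto
  show "\<exists>d>0. cball x d \<subseteq> ball 0 1 \<and> uniform_limit (cball x d) (\<lambda>N z. qpoch z q N) (\<lambda>z. qpoch_inf z q) sequentially"
    if "x \<in> ball 0 1" for x
  proof -
    obtain d where "d > 0" "cball x d \<subseteq> ball 0 1"
      using \<open>x \<in> ball 0 1\<close> open_contains_cball[of "ball (0::complex) 1"] by blast
    moreover from this have "cball x d \<subseteq> cball 0 1" using ball_subset_cball by blast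
    ultimately show ?thesis using uniform_limit_on_subset[OF lim] by blast
  qed
qed auto

definition qbinom_fps :: "complex \<Rightarrow> complex \<Rightarrow> complex \<Rightarrow> complex fps" where
  "qbinom_fps q t y = Abs_fps (\<lambda>k. qpoch t q k / qpoch q q k * y ^ k)"

lemma norm_less_1_power_neq_1: "norm (q::complex) < 1 \<Longrightarrow> k > 0 \<Longrightarrow> q ^ k \<noteq> 1"
  using power_less_one_iff[of "norm q" k] by (metis less_irrefl norm_ge_zero norm_one norm_power)

text \<open>This is the q-binomial theorem. The relation (z; q)_\<infinity> = (1 - z) (q z;
  q)_\<infinity> gives the quotient a first-order q-difference equation, which determines its
  coefficients recursively from the constant term 1.\<close>

lemma qbinom_has_fps_expansion:
  assumes "norm q < 1"
  shows "(\<lambda>u. qpoch_inf (t * u * y) q / qpoch_inf (u * y) q) has_fps_expansion qbinom_fps q t y"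
proof -
  define f where "f = (\<lambda>z. qpoch_inf z q)"
  define \<Phi> where "\<Phi> = fps_expansion f 0"
  have f: "f has_fps_expansion \<Phi>"
    unfolding \<Phi>_def f_def using qpoch_inf_holomorphic[OF assms] by (intro has_fps_expansion_fps_expansion) auto
  have sc: "(\<lambda>u. f (c * u)) has_fps_expansion fps_scale c \<Phi>" for c
  proof -
    have "(f \<circ> (\<lambda>u. c * u)) has_fps_expansion fps_compose \<Phi> (fps_const c * fps_X)"
      by (intro has_fps_expansion_compose f fps_expansion_intros) auto
    then show ?thesis by (simp add: o_def fps_compose_linear fps_scale_def)
  qed
  have "f 0 = 1" by (simp add: f_def qpoch_inf_def)
  then have \<Phi>0: "fps_nth \<Phi> 0 = 1" using has_fps_expansion_imp_0_eq_fps_nth_0[OF f] by simp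
  have "(\<lambda>z. (1 - z) * f (q * z)) has_fps_expansion (1 - fps_X) * fps_scale q \<Phi>"
    by (intro fps_expansion_intros sc)
  moreover have "(\<lambda>z. (1 - z) * f (q * z)) = f"
    unfolding f_def by (intro ext) (rule qpoch_inf_functional[OF assms, symmetric])
  ultimately have "f has_fps_expansion (1 - fps_X) * fps_scale q \<Phi>"
    by (simp only:)
  then have \<Phi>: "\<Phi> = (1 - fps_X) * fps_scale q \<Phi>"
    by (rule fps_expansion_unique_complex[OF f])
  define F where "F = fps_scale t \<Phi> * inverse \<Phi>"
  have inv: "\<Phi> * inverse \<Phi> = 1" using \<Phi>0 by (intro inverse_mult_eq_1') simp
  have inv2: "fps_scale q \<Phi> * fps_scale q (inverse \<Phi>) = 1"
    using arg_cong[OF inv, of "fps_scale q"] by simp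
  have comm: "fps_scale t (fps_scale q \<Phi>) = fps_scale q (fps_scale t \<Phi>)"
    by (simp add: fps_scale_scale mult.commute)
  have t\<Phi>: "fps_scale t \<Phi> = (1 - fps_const t * fps_X) * fps_scale q (fps_scale t \<Phi>)"
    using arg_cong[OF \<Phi>, of "fps_scale t"] unfolding fps_scale_mult comm by simp
  have "(1 - fps_X) * F = (1 - fps_const t * fps_X) * fps_scale q F"
  proof -
    define A B C D E where "A = fps_scale t \<Phi>" and "B = fps_scale q \<Phi>" and "C = inverse \<Phi>"
      and "D = fps_scale q (inverse \<Phi>)" and "E = fps_scale q (fps_scale t \<Phi>)"
    note defs = A_def B_def C_def D_def E_def
    have "A = (1 - fps_const t * fps_X) * E"
      unfolding defs by (fact t\<Phi>)
    moreover have "\<Phi> = (1 - fps_X) * B"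
      unfolding defs by (fact \<Phi>)
    moreover have "\<Phi> * C = 1" "B * D = 1"
      unfolding defs by (fact inv inv2)+
    ultimately have "(1 - fps_X) * (A * C) = (1 - fps_const t * fps_X) * (E * D)"
      by algebra
    then show ?thesis unfolding F_def fps_scale_mult defs .
  qed
  note eq = this
  have "fps_nth F k = qpoch t q k / qpoch q q k" for k
  proof (induction k)
    case 0
    then show ?case by (simp add: F_def \<Phi>0 qpoch_def)
  next
    case (Suc k)
    have "fps_nth ((1 - fps_X) * F) (Suc k) = fps_nth F (Suc k) - fps_nth F k"
      by (simp add: algebra_simps)
    moreover have "fps_nth ((1 - fps_const t * fps_X) * fps_scale q F) (Suc k) =
       q ^ Suc k * fps_nth F (Suc k) - t * q ^ k * fps_nth F k"
      by (simp add: algebra_simps)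
    ultimately have "fps_nth F (Suc k) * (1 - q ^ k * q) = fps_nth F k * (1 - q ^ k * t)"
      using arg_cong[OF eq, of "\<lambda>f. fps_nth f (Suc k)"] by (simp only:) (simp add: algebra_simps)
    moreover have "1 - q ^ k * q \<noteq> 0" using norm_less_1_power_neq_1[OF assms, of "Suc k"] by (simp add: mult.commute)
    ultimately have "fps_nth F (Suc k) = fps_nth F k * (1 - q ^ k * t) / (1 - q ^ k * q)"
      by (simp add: eq_divide_eq)
    then show ?case by (simp add: Suc qpoch_Suc)
  qed
  then have "fps_scale y F = qbinom_fps q t y"
    by (intro fps_ext) (simp add: qbinom_fps_def)
  moreover have "(\<lambda>u. f ((t * y) * u) * inverse (f (y * u))) has_fps_expansion
      fps_scale (t * y) \<Phi> * inverse (fps_scale y \<Phi>)"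
    by (intro fps_expansion_intros sc) (simp add: \<Phi>0)
  moreover have "fps_scale (t * y) \<Phi> * inverse (fps_scale y \<Phi>) = fps_scale y F"
  proof -
    have "inverse (fps_scale y \<Phi>) = fps_scale y (inverse \<Phi>)"
      using arg_cong[OF inv, of "fps_scale y"] \<Phi>0
      by (intro fps_inverse_unique) simp
    then show ?thesis by (simp add: F_def fps_scale_scale mult.commute)
  qed
  ultimately show ?thesis
    by (simp add: f_def divide_inverse mult_ac)
qed

definition gen_fps :: "nat \<Rightarrow> complex \<Rightarrow> complex \<Rightarrow> (nat \<Rightarrow> complex) \<Rightarrow> complex fps" where
  "gen_fps n q t x = (\<Prod>i<n. qbinom_fps q t (x i) * qbinom_fps q t (1 / x i))"

lemma G_poly_eq:
  assumes "norm q < 1"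
  shows "G_poly n q t r x = fps_nth (gen_fps n q t x) r"
proof -
  have "(\<lambda>u. \<Prod>i<n. (qpoch_inf (t * u * x i) q / qpoch_inf (u * x i) q) *
      (qpoch_inf (t * u * (1 / x i)) q / qpoch_inf (u * (1 / x i)) q)) has_fps_expansion gen_fps n q t x"
    unfolding gen_fps_def by (intro fps_expansion_intros qbinom_has_fps_expansion assms)
  then show ?thesis
    unfolding G_poly_def by (subst fps_expansion_eqI[symmetric, of _ "gen_fps n q t x"]) simp_all
qed

lemma qbinom_shift:
  assumes "norm q < 1"
  shows "(1 - fps_const (t * y) * fps_X) * qbinom_fps q t (q * y) = (1 - fps_const y * fps_X) * qbinom_fps q t y"
proof (rule fps_ext)
  fix k
  show "fps_nth ((1 - fps_const (t * y) * fps_X) * qbinom_fps q t (q * y)) k =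
    fps_nth ((1 - fps_const y * fps_X) * qbinom_fps q t y) k"
  proof (cases k)
    case (Suc j)
    have nz: "qpoch q q j \<noteq> 0" "1 - q ^ j * q \<noteq> 0"
      using norm_less_1_power_neq_1[OF assms, of "Suc _"] by (auto simp: qpoch_eq_0_iff mult.commute)
    show ?thesis using nz
      by (simp add: Suc qbinom_fps_def algebra_simps qpoch_Suc power_mult_distrib) (simp add: field_simps)
  qed (simp add: qbinom_fps_def)
qed

lemma qbinom_scale: "fps_scale c (qbinom_fps q t y) = qbinom_fps q t (c * y)"
  by (rule fps_ext) (simp add: qbinom_fps_def power_mult_distrib)

lemma fps_scale_prod [simp]: "fps_scale c (\<Prod>i\<in>A. f i) = (\<Prod>i\<in>A. fps_scale c (f i))"
  by (induction A rule: infinite_finite_induct) simp_all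

text \<open>
  For the type B parameters the coefficients of \<open>T\<^sub>i\<close> and of its inverse in \<open>koornwinder_op\<close> are, up to
  the factor \<open>csqrt a\<close>, the values of one function of \<open>y\<close> at \<open>x i\<close> and \<open>1 / x i\<close>.
\<close>
definition kappaB :: "nat \<Rightarrow> complex \<Rightarrow> complex \<Rightarrow> complex \<Rightarrow> (nat \<Rightarrow> complex) \<Rightarrow> nat \<Rightarrow> complex \<Rightarrow> complex" where
  "kappaB n a q t x i y = (1 + y) * (1 - a * y) * (1 - q * y^2) / (t ^ (n - 1) * (1 - y^2) * (1 - q * y^2)) *
      (\<Prod>j\<in>{..<n}-{i}. (1 - t * y * x j) * (1 - t * y / x j) / ((1 - y * x j) * (1 - y / x j)))"

lemma fls_const_prod: "fls_const (\<Prod>i\<in>A. f i) = (\<Prod>i\<in>A. fls_const (f i :: complex))"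
  by (induction A rule: infinite_finite_induct) (simp_all flip: fls_const_mult_const)

lemma fps_to_fls_prod: "fps_to_fls (\<Prod>i\<in>A. f i) = (\<Prod>i\<in>A. fps_to_fls (f i :: complex fps))"
  by (induction A rule: infinite_finite_induct) (simp_all add: fls_times_fps_to_fls)

lemma fps_to_fls_sum: "fps_to_fls (\<Sum>i\<in>A. f i) = (\<Sum>i\<in>A. fps_to_fls (f i :: complex fps))"
  by (induction A rule: infinite_finite_induct) simp_all

lemma mult_eq_imp_eq_divide:
  fixes D F N g :: "'a::field"
  assumes "D * F = N * g" "D \<noteq> 0"
  shows "F = N / D * g"
  using assms by (simp add: nonzero_eq_divide_eq mult.commute)

text \<open>The factor of the generating function that belongs to one variable is symmetric under
  inversion. So y = x i with z = q * x i and y = 1 / x i with z = x i / q are one computation, and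
  the shift and its inverse are treated together.\<close>

lemma gen_fps_upd:
  assumes "norm q < 1" "q \<noteq> 0" "i < n" "y = x i \<or> y = 1 / x i" "x i \<noteq> 0"
    and "z = q * y \<or> z = 1 / (q * y)" "z = (if y = x i then q * y else 1 / (q * y))"
  shows "(1 - fps_const (t * y) * fps_X) * (1 - fps_const (1 / (q * y)) * fps_X) * gen_fps n q t (x(i := z)) =
     (1 - fps_const y * fps_X) * (1 - fps_const (t / (q * y)) * fps_X) * gen_fps n q t x"
proof -
  have y0: "y \<noteq> 0" using assms by auto
  define R where "R = (\<Prod>j\<in>{..<n}-{i}. qbinom_fps q t (x j) * qbinom_fps q t (1 / x j))"
  have I: "finite {..<n}" "i \<in> {..<n}" using assms by auto
  have g1: "gen_fps n q t x = qbinom_fps q t (x i) * qbinom_fps q t (1 / x i) * R"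
    unfolding gen_fps_def R_def by (rule prod.remove[OF I])
  have g2: "gen_fps n q t (x(i := z)) = qbinom_fps q t z * qbinom_fps q t (1 / z) * R"
    unfolding gen_fps_def R_def by (subst prod.remove[OF I]) (auto intro!: prod.cong)
  have z: "qbinom_fps q t z * qbinom_fps q t (1 / z) = qbinom_fps q t (q * y) * qbinom_fps q t (1 / (q * y))"
    using assms by (auto simp: mult.commute)
  have yy: "qbinom_fps q t (x i) * qbinom_fps q t (1 / x i) = qbinom_fps q t y * qbinom_fps q t (1 / y)"
    using assms by (auto simp: mult.commute)
  have s1: "(1 - fps_const (t * y) * fps_X) * qbinom_fps q t (q * y) = (1 - fps_const y * fps_X) * qbinom_fps q t y"
    by (rule qbinom_shift[OF assms(1)])
  have s2: "(1 - fps_const (t / (q * y)) * fps_X) * qbinom_fps q t (1 / y) = (1 - fps_const (1 / (q * y)) * fps_X) * qbinom_fps q t (1 / (q * y))"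
    using qbinom_shift[OF assms(1), of t "1 / (q * y)"] assms(2) by simp
  show ?thesis unfolding g1 g2 z yy using s1 s2 by algebra
qed

lemma gen_fps_scale:
  assumes "norm q < 1" "q \<noteq> 0"
  shows "(\<Prod>i<n. (1 - fps_const (t * x i) * fps_X) * (1 - fps_const (t * (1 / x i)) * fps_X)) * fps_scale q (gen_fps n q t x) =
     (\<Prod>i<n. (1 - fps_const (x i) * fps_X) * (1 - fps_const (1 / x i) * fps_X)) * gen_fps n q t x"
    and "(\<Prod>i<n. (1 - fps_const (x i / q) * fps_X) * (1 - fps_const (1 / x i / q) * fps_X)) * fps_scale (1 / q) (gen_fps n q t x) =
     (\<Prod>i<n. (1 - fps_const (t * (x i / q)) * fps_X) * (1 - fps_const (t * (1 / x i / q)) * fps_X)) * gen_fps n q t x"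
proof -
  note s = qbinom_shift[OF assms(1), of t]
  have "((1 - fps_const (t * y) * fps_X) * (1 - fps_const (t * z) * fps_X)) * (qbinom_fps q t (q * y) * qbinom_fps q t (q * z)) =
    ((1 - fps_const y * fps_X) * (1 - fps_const z * fps_X)) * (qbinom_fps q t y * qbinom_fps q t z)" for y z
    using s[of y] s[of z] by algebra
  then show "(\<Prod>i<n. (1 - fps_const (t * x i) * fps_X) * (1 - fps_const (t * (1 / x i)) * fps_X)) * fps_scale q (gen_fps n q t x) =
     (\<Prod>i<n. (1 - fps_const (x i) * fps_X) * (1 - fps_const (1 / x i) * fps_X)) * gen_fps n q t x"
    unfolding gen_fps_def fps_scale_prod fps_scale_mult qbinom_scale prod.distrib[symmetric]
    by (intro prod.cong refl)
  have "((1 - fps_const y * fps_X) * (1 - fps_const z * fps_X)) * (qbinom_fps q t y * qbinom_fps q t z) =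
    ((1 - fps_const (t * y) * fps_X) * (1 - fps_const (t * z) * fps_X)) * (qbinom_fps q t (q * y) * qbinom_fps q t (q * z))" for y z
    using s[of y] s[of z] by algebra
  note s2 = this[of "_ / q" "_ / q"]
  show "(\<Prod>i<n. (1 - fps_const (x i / q) * fps_X) * (1 - fps_const (1 / x i / q) * fps_X)) * fps_scale (1 / q) (gen_fps n q t x) =
     (\<Prod>i<n. (1 - fps_const (t * (x i / q)) * fps_X) * (1 - fps_const (t * (1 / x i / q)) * fps_X)) * gen_fps n q t x"
    unfolding gen_fps_def fps_scale_prod fps_scale_mult qbinom_scale prod.distrib[symmetric]
  proof (intro prod.cong refl)
    fix i
    show "(1 - fps_const (x i / q) * fps_X) * (1 - fps_const (1 / x i / q) * fps_X) *
         (qbinom_fps q t (1 / q * x i) * qbinom_fps q t (1 / q * (1 / x i))) =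
         (1 - fps_const (t * (x i / q)) * fps_X) * (1 - fps_const (t * (1 / x i / q)) * fps_X) *
         (qbinom_fps q t (x i) * qbinom_fps q t (1 / x i))"
      using s2[of "x i" "1 / x i"] assms(2) by (simp add: mult_ac)
  qed
qed

text \<open>\<open>kernel_identity\<close> is applied in the field of formal Laurent series in u,
  where complex numbers are constants. All quotients in u make sense there, and the end result is
  again an identity of power series. The conditions on t * (x i)^2 keep the poles \<theta> and
  -\<theta> away from the nodes.\<close>

lemma gen_fps_operator:
  fixes x :: "nat \<Rightarrow> complex"
  assumes q: "norm q < 1" "q \<noteq> 0" and t: "t \<noteq> 0" "t \<noteq> 1" and n: "n > 0"
    and x: "x \<in> koornwinder_regular n q"
    and xt: "\<And>i. i < n \<Longrightarrow> t * (x i)^2 \<noteq> 1 \<and> (x i)^2 \<noteq> t"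
  shows "(\<Sum>i<n. fps_const (kappaB n a q t x i (x i)) * (gen_fps n q t (x(i := q * x i)) - gen_fps n q t x)
        + fps_const (kappaB n a q t x i (1 / x i)) * (gen_fps n q t (x(i := x i / q)) - gen_fps n q t x)) =
    fps_const (t ^ (n - 1)) * fps_scale q (dualA q t a) * fps_scale q (gen_fps n q t x)
    + fps_const (1 / t ^ (n - 1)) * fps_scale (1 / q) (dualB q t a) * fps_scale (1 / q) (gen_fps n q t x)
    + (dualC q t a - fps_const (a * t ^ (n - 1) + 1 / t ^ (n - 1))) * gen_fps n q t x"
proof -
  define c where "c = (fls_const :: complex \<Rightarrow> complex fls)"
  define u where "u = (fls_X :: complex fls)"
  define g where "g = fps_to_fls (gen_fps n q t x)"
  have cadd: "c (y + z) = c y + c z" and cdiff: "c (y - z) = c y - c z" and cmult: "c (y * z) = c y * c z"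
    and c1: "c 1 = 1" and c0: "c 0 = 0" and cdiv: "c (y / z) = c y / c z" and cpow: "c (y ^ k) = c y ^ k"
    and cneg: "c (- y) = - c y" for y z k
    by (simp_all add: c_def fls_plus_const fls_minus_const fls_const_power fls_const_divide_const)
  have cprod: "c (\<Prod>i\<in>A. f i) = (\<Prod>i\<in>A. c (f i))" for f :: "nat \<Rightarrow> complex" and A
    unfolding c_def by (rule fls_const_prod)
  have ceq: "c y = c z \<longleftrightarrow> y = z" for y z
    by (auto simp: c_def dest: arg_cong[of _ _ "\<lambda>f. fls_nth f 0"])
  note ch = cadd cdiff cmult c1 c0 cdiv cpow cneg cprod
  have cu: "fps_to_fls (fps_const y * fps_X) = c y * u" "fps_to_fls (fps_const y * fps_X ^ 2) = c y * u ^ 2"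
    "fps_to_fls (fps_const y) = c y" for y
    by (simp_all add: c_def u_def fls_times_fps_to_fls fps_to_fls_power)
  \<comment> \<open>A multiple of u or of u^2 by a constant is never a nonzero constant. This
    settles every condition of \<open>kernel_identity\<close> that involves u.\<close>
  have uc: "c y * u \<noteq> c z" "c y * u^2 \<noteq> c z" if "z \<noteq> 0" for y z
  proof -
    have "fps_const y * fps_X \<noteq> fps_const z" "fps_const y * fps_X ^ 2 \<noteq> fps_const z"
      using that by (auto simp: fps_eq_iff intro!: exI[of _ 0])
    then show "c y * u \<noteq> c z" "c y * u^2 \<noteq> c z"
      unfolding cu(1,2)[symmetric] cu(3)[symmetric, of z] fps_to_fls_eq_iff by auto
  qed
  have xtor: "x i \<noteq> 0" if "i < n" for i using x that by (simp add: koornwinder_regular_def torus_def)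
  have xreg: "(x i)\<^sup>2 \<noteq> 1 \<and> q * (x i)\<^sup>2 \<noteq> 1 \<and> (x i)\<^sup>2 \<noteq> q" if "i < n" for i
    using x that by (auto simp: koornwinder_regular_def)
  have xreg2: "x i \<noteq> x j \<and> x i * x j \<noteq> 1" if "i < n" "j < n" "i \<noteq> j" for i j
    using x that by (auto simp: koornwinder_regular_def)
  have q1: "q \<noteq> 1" using q by auto
  have u0: "u \<noteq> 0" by (simp add: u_def)
  have kernel: "(\<Sum>i<n. c (kappaB n a q t x i (x i)) * ((1 - u * c (x i)) * (1 - c t * u / (c q * c (x i))) / ((1 - c t * u * c (x i)) * (1 - u / (c q * c (x i)))) - 1)
     + c (kappaB n a q t x i (1 / x i)) * ((1 - u * (1 / c (x i))) * (1 - c t * u / (c q * (1 / c (x i)))) / ((1 - c t * u * (1 / c (x i))) * (1 - u / (c q * (1 / c (x i))))) - 1)) =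
    c t ^ (n - 1) * (1 + c t * u) * (c a - c t * u) * (1 - c t^2 * u^2 / c q) / ((1 - c t * u^2) * (1 - c t * u^2 / c q)) *
      (\<Prod>i<n. (1 - u * c (x i)) * (1 - u / c (x i)) / ((1 - c t * u * c (x i)) * (1 - c t * u / c (x i))))
    + (1 + u / c q) * (1 - c a * u / c q) * (1 - u^2 / c q) / (c t ^ (n - 1) * (1 - c t * u^2 / c q^2) * (1 - c t * u^2 / c q)) *
      (\<Prod>i<n. (1 - c t * u * c (x i) / c q) * (1 - c t * u / (c q * c (x i))) / ((1 - u * c (x i) / c q) * (1 - u / (c q * c (x i)))))
    + (c q - c t) * (u / c q) * ((c t - c a) * (c q + 1) * (u / c q) + (1 - c a) * (1 + c t * u^2 / c q)) / ((1 - c t * u^2) * (1 - c t * u^2 / c q^2))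
    - (c a * c t ^ (n - 1) + 1 / c t ^ (n - 1))"
    unfolding kappaB_def ch
  proof (rule kernel_identity[where x = "\<lambda>i. c (x i)" and \<theta> = "c (csqrt (1 / t))"])
    have "t * (csqrt (1 / t))^2 = 1" using t by simp
    then show "c t * c (csqrt (1 / t)) ^ 2 = 1"
      by (metis c1 cmult cpow)
    show "c t \<noteq> 1" "c q \<noteq> 0" "c q \<noteq> 1" using t q q1 c0 c1 ceq by metis+
    show "c (x i) \<noteq> 0" if "i < n" for i using xtor[OF that] c0 ceq by metis
    show "c (x i) ^ 2 \<noteq> 1 \<and> c q * c (x i) ^ 2 \<noteq> 1 \<and> c (x i) ^ 2 \<noteq> c q \<and> c t * c (x i) ^ 2 \<noteq> 1 \<and> c (x i) ^ 2 \<noteq> c t" if "i < n" for i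
      using xreg[OF that] xt[OF that] unfolding ch(7)[symmetric] c1[symmetric] ch(3)[symmetric] ceq by auto
    show "c (x i) \<noteq> c (x j) \<and> c (x i) * c (x j) \<noteq> 1" if "i < n" "j < n" "i \<noteq> j" for i j
      using xreg2[OF that] unfolding c1[symmetric] ch(3)[symmetric] ceq by auto
    show "c t * u * c (x i) \<noteq> 1 \<and> c t * u \<noteq> c (x i) \<and> u \<noteq> c q * c (x i) \<and> u * c (x i) \<noteq> c q" if "i < n" for i
      using uc[of 1 "t * x i"] uc[of "x i" t] uc[of "q * x i" 1] uc[of q "x i"] xtor[OF that] q t
      by (auto simp: c1 cmult mult_ac)
    show "c t * u^2 \<noteq> c q" "c t * u^2 \<noteq> 1" "c t * u^2 \<noteq> c q ^ 2"
      using uc(2)[of q t] uc(2)[of 1 t] uc(2)[of "q^2" t] q by (simp_all add: c1 cpow)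
  qed (use n u0 in auto)
  have fu: "fps_to_fls (1 - fps_const y * fps_X) = 1 - c y * u" for y
    by (simp add: cu)
  have nz1: "1 - c y * u \<noteq> 0" for y using uc(1)[of 1 y] by (simp add: c1)
  have nz2: "1 - c y * u^2 \<noteq> 0" for y using uc(2)[of 1 y] by (simp add: c1)
  have up: "fps_to_fls (gen_fps n q t (x(i := z))) =
     (1 - u * c y) * (1 - c t * u / (c q * c y)) / ((1 - c t * u * c y) * (1 - u / (c q * c y))) * g"
    if "i < n" "y = x i \<or> y = 1 / x i" "z = (if y = x i then q * y else 1 / (q * y))" for i y z
  proof -
    have "fps_to_fls ((1 - fps_const (t * y) * fps_X) * (1 - fps_const (1 / (q * y)) * fps_X) * gen_fps n q t (x(i := z))) =
      fps_to_fls ((1 - fps_const y * fps_X) * (1 - fps_const (t / (q * y)) * fps_X) * gen_fps n q t x)"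
      using gen_fps_upd[where q = q and n = n and i = i and y = y and x = x and z = z and t = t]
        q that xtor[OF that(1)] by (auto split: if_splits)
    then have "(1 - c (t * y) * u) * (1 - c (1 / (q * y)) * u) * fps_to_fls (gen_fps n q t (x(i := z))) =
      (1 - c y * u) * (1 - c (t / (q * y)) * u) * g"
      unfolding fls_times_fps_to_fls fu g_def .
    then have "fps_to_fls (gen_fps n q t (x(i := z))) =
      (1 - c y * u) * (1 - c (t / (q * y)) * u) / ((1 - c (t * y) * u) * (1 - c (1 / (q * y)) * u)) * g"
      by (rule mult_eq_imp_eq_divide) (use nz1 in auto)
    then show ?thesis by (simp add: ch mult_ac)
  qed
  have pr: "(\<Prod>i<n. (1 - c (y i) * u) * (1 - c (z i) * u)) \<noteq> 0" for y z
    using nz1 by simp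
  have sp: "fps_to_fls (fps_scale q (gen_fps n q t x)) =
     (\<Prod>i<n. (1 - u * c (x i)) * (1 - u / c (x i)) / ((1 - c t * u * c (x i)) * (1 - c t * u / c (x i)))) * g"
  proof -
    have "(\<Prod>i<n. (1 - c (t * x i) * u) * (1 - c (t * (1 / x i)) * u)) * fps_to_fls (fps_scale q (gen_fps n q t x)) =
      (\<Prod>i<n. (1 - c (x i) * u) * (1 - c (1 / x i) * u)) * g"
      using arg_cong[OF gen_fps_scale(1)[OF q, where n = n and x = x and t = t], of fps_to_fls]
      unfolding fps_to_fls_prod fls_times_fps_to_fls fu g_def .
    from mult_eq_imp_eq_divide[OF this pr] show ?thesis
      unfolding prod_dividef[symmetric] by (simp add: ch mult_ac)
  qed
  have sm: "fps_to_fls (fps_scale (1 / q) (gen_fps n q t x)) =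
     (\<Prod>i<n. (1 - c t * u * c (x i) / c q) * (1 - c t * u / (c q * c (x i))) / ((1 - u * c (x i) / c q) * (1 - u / (c q * c (x i))))) * g"
  proof -
    have "(\<Prod>i<n. (1 - c (x i / q) * u) * (1 - c (1 / x i / q) * u)) * fps_to_fls (fps_scale (1 / q) (gen_fps n q t x)) =
      (\<Prod>i<n. (1 - c (t * (x i / q)) * u) * (1 - c (t * (1 / x i / q)) * u)) * g"
      using arg_cong[OF gen_fps_scale(2)[OF q, where n = n and x = x and t = t], of fps_to_fls]
      unfolding fps_to_fls_prod fls_times_fps_to_fls fu g_def .
    from mult_eq_imp_eq_divide[OF this pr] show ?thesis
      unfolding prod_dividef[symmetric] by (simp add: ch mult_ac)
  qed
  have mono: "fps_to_fls fps_X = u" "fps_to_fls (f ^ k) = fps_to_fls f ^ k" for f :: "complex fps" and k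
    by (simp_all add: u_def fps_to_fls_power)
  note push = fls_times_fps_to_fls fps_to_fls_minus fps_to_fls_plus fps_one_to_fls cu(3) mono
  have den: "(1 - c y * u^2) * (1 - c z * u^2) \<noteq> 0" for y z using nz2 by simp
  have X2: "fps_const y * (fps_const z * fps_X) ^ 2 = fps_const (y * z^2) * fps_X ^ 2" for y z :: complex
    by (simp add: power_mult_distrib fps_const_power flip: mult.assoc)
  have num: "t * (1/q)^2 = t / q^2" "t * q * (1/q)^2 = t / q" "q * (1/q)^2 = 1 / q" "t / q^2 * q^2 = t"
    "t * q^2 / q^3 = t / q" "t^2 * q^2 / q^3 = t^2 / q"
    using q by (simp_all add: field_simps eval_nat_numeral)
  have dA: "fps_to_fls (fps_scale q (dualA q t a)) =
    (1 + c t * u) * (c a - c t * u) * (1 - c t^2 * u^2 / c q) / ((1 - c t * u^2) * (1 - c t * u^2 / c q))"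
  proof -
    have "fps_scale q (dualA q t a) * ((1 - fps_const t * fps_X^2) * (1 - fps_const (t / q) * fps_X^2)) =
      (fps_const a - fps_const t * fps_X) * (1 + fps_const t * fps_X) * (1 - fps_const (t^2 / q) * fps_X^2)"
      using arg_cong[OF dualA_mult_den[of q t a], of "fps_scale q"] q
      by (simp add: X2 num flip: mult.assoc)
    from arg_cong[OF this, of fps_to_fls]
    have "((1 - c t * u^2) * (1 - c (t / q) * u^2)) * fps_to_fls (fps_scale q (dualA q t a)) =
      ((c a - c t * u) * (1 + c t * u) * (1 - c (t^2 / q) * u^2)) * 1"
      unfolding push by (simp add: mult_ac)
    from mult_eq_imp_eq_divide[OF this den] show ?thesis by (simp add: ch mult_ac)
  qed
  have dB: "fps_to_fls (fps_scale (1 / q) (dualB q t a)) =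
    (1 + u / c q) * (1 - c a * u / c q) * (1 - u^2 / c q) / ((1 - c t * u^2 / c q^2) * (1 - c t * u^2 / c q))"
  proof -
    have "fps_scale (1 / q) (dualB q t a) * ((1 - fps_const (t / q^2) * fps_X^2) * (1 - fps_const (t / q) * fps_X^2)) =
      (1 - fps_const (a / q) * fps_X) * (1 + fps_const (1 / q) * fps_X) * (1 - fps_const (1 / q) * fps_X^2)"
      using arg_cong[OF dualB_mult_den[of q t a], of "fps_scale (1 / q)"] q
      by (simp add: X2 num flip: mult.assoc)
    from arg_cong[OF this, of fps_to_fls]
    have "((1 - c (t / q^2) * u^2) * (1 - c (t / q) * u^2)) * fps_to_fls (fps_scale (1 / q) (dualB q t a)) =
      ((1 - c (a / q) * u) * (1 + c (1 / q) * u) * (1 - c (1 / q) * u^2)) * 1"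
      unfolding push by (simp add: mult_ac)
    from mult_eq_imp_eq_divide[OF this den] show ?thesis by (simp add: ch mult_ac)
  qed
  have dC: "fps_to_fls (dualC q t a) =
    (c q - c t) * (u / c q) * ((c t - c a) * (c q + 1) * (u / c q) + (1 - c a) * (1 + c t * u^2 / c q)) / ((1 - c t * u^2) * (1 - c t * u^2 / c q^2))"
  proof -
    from arg_cong[OF dualC_mult_den[of q t a], of fps_to_fls]
    have "((1 - c t * u^2) * (1 - c (t / q^2) * u^2)) * fps_to_fls (dualC q t a) =
      (c ((q - t) / q) * u * (c ((t - a) * (q + 1) / q) * u + c (1 - a) * (1 + c (t / q) * u^2))) * 1"
      unfolding push by (simp add: mult_ac)
    from mult_eq_imp_eq_divide[OF this den] show ?thesis by (simp add: ch mult_ac)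
  qed
  have step: "fps_to_fls (fps_const (kappaB n a q t x i (x i)) * (gen_fps n q t (x(i := q * x i)) - gen_fps n q t x)
        + fps_const (kappaB n a q t x i (1 / x i)) * (gen_fps n q t (x(i := x i / q)) - gen_fps n q t x)) =
     (c (kappaB n a q t x i (x i)) * ((1 - u * c (x i)) * (1 - c t * u / (c q * c (x i))) / ((1 - c t * u * c (x i)) * (1 - u / (c q * c (x i)))) - 1)
     + c (kappaB n a q t x i (1 / x i)) * ((1 - u * (1 / c (x i))) * (1 - c t * u / (c q * (1 / c (x i)))) / ((1 - c t * u * (1 / c (x i))) * (1 - u / (c q * (1 / c (x i))))) - 1)) * g"
    if "i < n" for i
  proof -
    have "1 / x i \<noteq> x i" using xreg[OF that] xtor[OF that] by (auto simp: field_simps power2_eq_square)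
    then have "fps_to_fls (gen_fps n q t (x(i := x i / q))) =
       (1 - u * c (1 / x i)) * (1 - c t * u / (c q * c (1 / x i))) / ((1 - c t * u * c (1 / x i)) * (1 - u / (c q * c (1 / x i)))) * g"
      using up[OF that, of "1 / x i" "x i / q"] by simp
    moreover have "c (1 / x i) = 1 / c (x i)" by (simp add: ch)
    ultimately have 2: "fps_to_fls (gen_fps n q t (x(i := x i / q))) =
       (1 - u * (1 / c (x i))) * (1 - c t * u / (c q * (1 / c (x i)))) / ((1 - c t * u * (1 / c (x i))) * (1 - u / (c q * (1 / c (x i))))) * g"
      by (simp only:)
    have 1: "fps_to_fls (gen_fps n q t (x(i := q * x i))) =
       (1 - u * c (x i)) * (1 - c t * u / (c q * c (x i))) / ((1 - c t * u * c (x i)) * (1 - u / (c q * c (x i)))) * g"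
      using up[OF that, of "x i" "q * x i"] by simp
    show ?thesis
      unfolding push 1 2 g_def[symmetric] by (simp only: left_diff_distrib right_diff_distrib distrib_right mult.assoc mult_1_left)
  qed
  have "fps_to_fls (\<Sum>i<n. fps_const (kappaB n a q t x i (x i)) * (gen_fps n q t (x(i := q * x i)) - gen_fps n q t x)
        + fps_const (kappaB n a q t x i (1 / x i)) * (gen_fps n q t (x(i := x i / q)) - gen_fps n q t x)) =
    (\<Sum>i<n. c (kappaB n a q t x i (x i)) * ((1 - u * c (x i)) * (1 - c t * u / (c q * c (x i))) / ((1 - c t * u * c (x i)) * (1 - u / (c q * c (x i)))) - 1)
     + c (kappaB n a q t x i (1 / x i)) * ((1 - u * (1 / c (x i))) * (1 - c t * u / (c q * (1 / c (x i)))) / ((1 - c t * u * (1 / c (x i))) * (1 - u / (c q * (1 / c (x i))))) - 1)) * g"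
    unfolding fps_to_fls_sum sum_distrib_right by (intro sum.cong refl step) simp
  also have "\<dots> = fps_to_fls (fps_const (t ^ (n - 1)) * fps_scale q (dualA q t a) * fps_scale q (gen_fps n q t x)
    + fps_const (1 / t ^ (n - 1)) * fps_scale (1 / q) (dualB q t a) * fps_scale (1 / q) (gen_fps n q t x)
    + (dualC q t a - fps_const (a * t ^ (n - 1) + 1 / t ^ (n - 1))) * gen_fps n q t x)"
  proof -
    have "(T * N1 * N2 * N3 / D * R + M / (T * d1 * d2) * R' + K - E) * h =
       T * (N1 * N2 * N3 / D) * (R * h) + 1 / T * (M / (d1 * d2)) * (R' * h) + (K - E) * h"
      for T N1 N2 N3 D R M d1 d2 R' K E h :: "complex fls"
      by (simp add: algebra_simps)
    then show ?thesis
      unfolding kernel push sp sm dA dB dC g_def[symmetric] ch by blast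
  qed
  finally show ?thesis unfolding fps_to_fls_eq_iff .
qed

section \<open>From generic parameters to the given ones by continuity\<close>

lemma finite_square_roots: "finite {s::complex. s^2 = d}"
proof -
  have "{s. s^2 = d} \<subseteq> {csqrt d, - csqrt d}"
  proof
    fix s assume "s \<in> {s. s^2 = d}"
    then have "s^2 = (csqrt d)^2" by simp
    then show "s \<in> {csqrt d, - csqrt d}" unfolding power2_eq_iff by blast
  qed
  then show ?thesis using finite_subset by blast
qed

text \<open>Balls in the plane are uncountable, so the complement of a countable exceptional set is
  dense.\<close>

lemma countable_complement_seq:
  assumes "countable (A :: complex set)"
  obtains S where "\<And>m. S m \<notin> A" "S \<longlonglongrightarrow> z"
proof -
  have "\<exists>s\<in>-A. dist s z < e" if "e > 0" for e
  proof -
    have "\<not> ball z e \<subseteq> A"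
      using uncountable_ball[OF that, of z] countable_subset assms by blast
    then show ?thesis by (auto simp: dist_commute)
  qed
  then have "z \<in> closure (- A)"
    by (simp add: closure_approachable)
  then obtain S where "\<And>m. S m \<in> - A" "S \<longlonglongrightarrow> z"
    unfolding closure_sequential by blast
  then show ?thesis by (intro that[of S]) auto
qed

text \<open>Coefficients up to r involve only pairs with i + 2 j \<le> r, and for these the finitely
  many conditions with l < r control all denominators that depend on s.\<close>

lemma row_fps_continuous:
  fixes q t a s0 :: complex
  assumes qk: "\<And>k. k > 0 \<Longrightarrow> q ^ k \<noteq> 1" and a0: "a \<noteq> 0"
    and s1: "s0 \<noteq> 1" and ts: "\<And>l. l < r \<Longrightarrow> t * s0 * q ^ l \<noteq> 1"
    and as: "\<And>l. l < r \<Longrightarrow> t^2 * s0^2 * q * q ^ l \<noteq> a"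
    and k: "k \<le> r"
  shows "isCont (\<lambda>s. fps_nth (row_fps q t a s) k) s0"
proof -
  have qpc: "isCont (\<lambda>s. qpoch (f s) q m) s0" if "isCont f s0" for f m
    unfolding qpoch_def using that by (intro continuous_intros)
  have "isCont (\<lambda>s. row_coeff q t a s i j) s0" if ij: "i + 2 * j \<le> r" for i j
  proof -
    have 1: "qpoch q q m \<noteq> 0" for m
      using qk[of "Suc _"] by (auto simp: qpoch_eq_0_iff mult.commute)
    have 2: "qpoch (t * s0) q i \<noteq> 0"
      using ts ij by (auto simp: qpoch_eq_0_iff mult_ac)
    have 3: "qpoch (q ^ i * (t * s0 * q)) q j \<noteq> 0"
    proof -
      have "q ^ l * (q ^ i * (t * s0 * q)) = t * s0 * q ^ (Suc (i + l))" for l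
        by (simp add: power_add mult_ac)
      \<comment> \<open>Here j > 0, hence Suc (i + l) \<le> i + j < i + 2 * j \<le> r.\<close>
      moreover have "t * s0 * q ^ (Suc (i + l)) \<noteq> 1" if "l < j" for l using ts[of "Suc (i + l)"] that ij by auto
      ultimately show ?thesis unfolding qpoch_eq_0_iff by metis
    qed
    have 4: "qpoch (t^2 * s0^2 * q / a) q i \<noteq> 0"
      using as a0 ij by (auto simp: qpoch_eq_0_iff field_simps)
    show ?thesis
      unfolding row_coeff_def using 1 2 3 4 s1 a0
      by (intro continuous_intros qpc) auto
  qed
  then have "isCont (\<lambda>s. if even (k - i) then row_coeff q t a s i ((k - i) div 2) else 0) s0" if "i \<le> k" for i
    using that k by (cases "even (k - i)") auto
  then show ?thesis
    unfolding row_fps_def by (auto intro!: continuous_intros)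
qed

text \<open>
  For \<open>s = t powi (- int n) * q powi (- int r)\<close> genericity controls only finitely many denominators
  of \<open>row_fps\<close>. All denominators are nonzero for \<open>s\<close> outside a countable set, so the coefficients up to \<open>r\<close>
  are reached by continuity in \<open>s\<close>.
\<close>
lemma row_fps_equation_truncated:
  fixes q t a s0 :: complex
  assumes q0: "q \<noteq> 0" and t0: "t \<noteq> 0" and s0: "s0 \<noteq> 0" and a0: "a \<noteq> 0"
    and qk: "\<And>k. k > 0 \<Longrightarrow> q ^ k \<noteq> 1"
    and s1: "s0 \<noteq> 1" and ts: "\<And>l. l < r \<Longrightarrow> t * s0 * q ^ l \<noteq> 1"
    and as: "\<And>l. l < r \<Longrightarrow> t^2 * s0^2 * q * q ^ l \<noteq> a"
    and k: "k \<le> r"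
  shows "fps_nth (fps_const (1 / (t * s0)) * dualA q t a * fps_scale (1 / q) (row_fps q t a s0) +
   fps_const (t * s0) * dualB q t a * fps_scale q (row_fps q t a s0) +
   dualC q t a * row_fps q t a s0) k = fps_nth (fps_const (a / (t * s0) + t * s0) * row_fps q t a s0) k"
proof -
  define d where "d = (\<lambda>s. fps_nth (fps_const (1 / (t * s)) * dualA q t a * fps_scale (1 / q) (row_fps q t a s) +
   fps_const (t * s) * dualB q t a * fps_scale q (row_fps q t a s) +
   dualC q t a * row_fps q t a s) k - fps_nth (fps_const (a / (t * s) + t * s) * row_fps q t a s) k)"
  define bad where "bad = {0, 1} \<union> (\<Union>k. {1 / (t * q ^ k)}) \<union> (\<Union>k. {s. s^2 = a / (t^2 * q * q ^ k)})"
  have "countable bad"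
    unfolding bad_def by (intro countable_Un countable_UN) (auto intro: countable_finite finite_square_roots)
  then obtain S where S: "\<And>m. S m \<notin> bad" "S \<longlonglongrightarrow> s0"
    using countable_complement_seq by blast
  have "d (S m) = 0" for m
  proof -
    have b: "S m \<notin> bad" using S by auto
    have "t * S m * q ^ k \<noteq> 1" for k
    proof
      assume "t * S m * q ^ k = 1"
      then have "S m = 1 / (t * q ^ k)" using t0 q0 by (simp add: field_simps)
      then show False using b by (auto simp: bad_def)
    qed
    moreover have "t^2 * (S m)^2 * q * q ^ k \<noteq> a" for k
    proof
      assume "t^2 * (S m)^2 * q * q ^ k = a"
      then have "(S m)^2 = a / (t^2 * q * q ^ k)" using t0 q0 by (auto simp: field_simps)
      then show False using b by (auto simp: bad_def)
    qed
    ultimately show ?thesis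
      unfolding d_def using row_fps_equation[OF q0 t0 _ a0 qk, of "S m"] b by (auto simp: bad_def)
  qed
  moreover have "isCont d s0"
  proof -
    have R: "isCont (\<lambda>s. fps_nth (row_fps q t a s) m) s0" if "m \<le> k" for m
      using row_fps_continuous[OF qk a0 s1 ts as, where r = r and k = m] that k by auto
    have mult: "isCont (\<lambda>s. fps_nth (A * fps_scale c (row_fps q t a s)) k) s0" for A c
      unfolding fps_mult_nth by (intro continuous_intros) (auto intro!: continuous_intros R)
    show ?thesis
      unfolding d_def fps_add_nth mult.assoc fps_mult_left_const_nth
      using mult[of _ 1] s0 t0 by (auto intro!: continuous_intros mult R)
  qed
  ultimately have "(\<lambda>m. 0) \<longlonglongrightarrow> d s0"
    using isCont_tendsto_compose[of s0 d S sequentially] S(2) by simp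
  then have "d s0 = 0" by (simp add: LIMSEQ_const_iff)
  then show ?thesis by (simp add: d_def)
qed

definition row_fun :: "nat \<Rightarrow> complex \<Rightarrow> complex \<Rightarrow> complex \<Rightarrow> complex \<Rightarrow> nat \<Rightarrow> (nat \<Rightarrow> complex) \<Rightarrow> complex" where
  "row_fun n q t a s r x = fps_nth (row_fps q t a s * gen_fps n q t x) r"

lemma row_fun_eigen_generic:
  fixes q t a s :: complex
  assumes q: "norm q < 1" "q \<noteq> 0" and t: "t \<noteq> 0" "t \<noteq> 1" and n: "n > 0" and a0: "a \<noteq> 0"
    and s: "s * (t ^ n * q ^ r) = 1"
    and s1: "s \<noteq> 1" and ts: "\<And>l. l < r \<Longrightarrow> t * s * q ^ l \<noteq> 1"
    and as: "\<And>l. l < r \<Longrightarrow> t^2 * s^2 * q * q ^ l \<noteq> a"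
    and x: "x \<in> koornwinder_regular n q"
    and xt: "\<And>i. i < n \<Longrightarrow> t * (x i)^2 \<noteq> 1 \<and> (x i)^2 \<noteq> t"
  shows "(\<Sum>i<n. kappaB n a q t x i (x i) * (row_fun n q t a s r (x(i := q * x i)) - row_fun n q t a s r x)
        + kappaB n a q t x i (1 / x i) * (row_fun n q t a s r (x(i := x i / q)) - row_fun n q t a s r x)) =
    (a / (t * s) + t * s - (a * t ^ (n - 1) + 1 / t ^ (n - 1))) * row_fun n q t a s r x"
proof -
  define R where "R = row_fps q t a s"
  define g where "g = gen_fps n q t x"
  define E E0 where "E = a / (t * s) + t * s" and "E0 = a * t ^ (n - 1) + 1 / t ^ (n - 1)"
  have s0: "s \<noteq> 0" using s by auto
  have tn: "t ^ n = t * t ^ (n - 1)" using n by (metis Suc_diff_1 power_Suc)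
  have c1: "t ^ (n - 1) * q ^ r = 1 / (t * s)" and c2: "1 / t ^ (n - 1) * (1 / q) ^ r = t * s"
    using s t q s0 unfolding tn by (simp_all add: field_simps)
  have qk: "q ^ k \<noteq> 1" if "k > 0" for k using norm_less_1_power_neq_1 q(1) that .
  have "(\<Sum>i<n. kappaB n a q t x i (x i) * (row_fun n q t a s r (x(i := q * x i)) - row_fun n q t a s r x)
        + kappaB n a q t x i (1 / x i) * (row_fun n q t a s r (x(i := x i / q)) - row_fun n q t a s r x)) =
     fps_nth (R * (\<Sum>i<n. fps_const (kappaB n a q t x i (x i)) * (gen_fps n q t (x(i := q * x i)) - gen_fps n q t x)
        + fps_const (kappaB n a q t x i (1 / x i)) * (gen_fps n q t (x(i := x i / q)) - gen_fps n q t x))) r"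
    unfolding sum_distrib_left fps_sum_nth row_fun_def R_def[symmetric]
    by (intro sum.cong refl) (simp add: distrib_left right_diff_distrib mult.left_commute[of R "fps_const _"])
  also have "\<dots> = fps_nth (R * (fps_const (t ^ (n - 1)) * fps_scale q (dualA q t a) * fps_scale q g
    + fps_const (1 / t ^ (n - 1)) * fps_scale (1 / q) (dualB q t a) * fps_scale (1 / q) g
    + (dualC q t a - fps_const E0) * g)) r"
    using gen_fps_operator[OF q t n x xt] by (simp only: g_def E0_def)
  \<comment> \<open>In each of the first two terms the whole product is written as a rescaled
    series, with the inverse rescaling applied to R. The outer rescaling only multiplies the
    coefficient of X^r by q^r or q^(-r).\<close>
  also have "\<dots> = fps_nth (fps_const (t ^ (n - 1)) * fps_scale q (fps_scale (1 / q) R * dualA q t a * g)) r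
    + fps_nth (fps_const (1 / t ^ (n - 1)) * fps_scale (1 / q) (fps_scale q R * dualB q t a * g)) r
    + fps_nth ((dualC q t a * R - fps_const E0 * R) * g) r"
    using q(2) by (simp add: fps_scale_scale algebra_simps del: fps_const_mult fps_mult_left_const_nth fps_mult_right_const_nth)
  also have "\<dots> = fps_nth (fps_const (1 / (t * s)) * (fps_scale (1 / q) R * dualA q t a * g)) r
    + fps_nth (fps_const (t * s) * (fps_scale q R * dualB q t a * g)) r
    + fps_nth ((dualC q t a * R - fps_const E0 * R) * g) r"
  proof -
    have 1: "t ^ (n - 1) * (q ^ r * Y) = 1 / (t * s) * Y" for Y
      unfolding c1[symmetric] by (rule mult.assoc[symmetric])
    have 2: "1 / t ^ (n - 1) * ((1 / q) ^ r * Y) = t * s * Y" for Y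
      unfolding c2[symmetric] by (rule mult.assoc[symmetric])
    show ?thesis
      unfolding fps_mult_left_const_nth fps_scale_nth 1 2 ..
  qed
  also have "\<dots> = fps_nth (g * (fps_const (1 / (t * s)) * dualA q t a * fps_scale (1 / q) R +
     fps_const (t * s) * dualB q t a * fps_scale q R + dualC q t a * R)) r - fps_nth (fps_const E0 * (R * g)) r"
    by (simp add: algebra_simps del: fps_const_mult fps_mult_left_const_nth fps_mult_right_const_nth)
  \<comment> \<open>The coefficient of X^r in a product with g sees the other factor only up to X^r,
    so the truncated adjoint equation suffices.\<close>
  also have "fps_nth (g * (fps_const (1 / (t * s)) * dualA q t a * fps_scale (1 / q) R +
     fps_const (t * s) * dualB q t a * fps_scale q R + dualC q t a * R)) r = fps_nth (g * (fps_const E * R)) r"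
    unfolding R_def E_def
    by (rule fps_mult_nth_cong) (rule row_fps_equation_truncated[OF q(2) t(1) s0 a0 qk s1 ts as])
  also have "fps_nth (g * (fps_const E * R)) r - fps_nth (fps_const E0 * (R * g)) r = (E - E0) * fps_nth (R * g) r"
    by (simp add: mult.assoc mult.left_commute[of g] mult.commute[of g] left_diff_distrib)
  finally show ?thesis unfolding E_def E0_def R_def g_def row_fun_def .
qed

lemma gen_fps_continuous:
  assumes "\<And>i. i < n \<Longrightarrow> isCont (\<lambda>\<tau>. y \<tau> i) \<tau>0" "\<And>i. i < n \<Longrightarrow> y \<tau>0 i \<noteq> (0::complex)"
  shows "isCont (\<lambda>\<tau>. fps_nth (gen_fps n q t (y \<tau>)) m) (\<tau>0 :: complex)"
proof -
  have mult: "isCont (\<lambda>\<tau>. fps_nth (f \<tau> * g \<tau>) m) \<tau>0"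
    if "\<And>m. isCont (\<lambda>\<tau>. fps_nth (f \<tau>) m) \<tau>0" "\<And>m. isCont (\<lambda>\<tau>. fps_nth (g \<tau>) m) \<tau>0"
    for f g :: "complex \<Rightarrow> complex fps" and m
    unfolding fps_mult_nth using that by (intro continuous_intros)
  have prod: "isCont (\<lambda>\<tau>. fps_nth (\<Prod>i\<in>A. f i \<tau>) m) \<tau>0"
    if "finite A" "\<And>i m. i \<in> A \<Longrightarrow> isCont (\<lambda>\<tau>. fps_nth (f i \<tau>) m) \<tau>0"
    for f :: "nat \<Rightarrow> complex \<Rightarrow> complex fps" and A m
    using that
  proof (induction A arbitrary: m)
    case (insert i A)
    then show ?case by (simp add: mult)
  qed simp
  have qb: "isCont (\<lambda>\<tau>. fps_nth (qbinom_fps q t (f \<tau>)) m) \<tau>0" if "isCont f \<tau>0" for f m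
    unfolding qbinom_fps_def fps_nth_Abs_fps
    by (rule continuous_mult[OF continuous_const]) (intro continuous_intros that)
  show ?thesis
    unfolding gen_fps_def
    by (intro prod mult qb) (use assms in \<open>auto intro!: continuous_intros\<close>)
qed

lemma row_fun_continuous:
  assumes "\<And>i. i < n \<Longrightarrow> isCont (\<lambda>\<tau>. y \<tau> i) \<tau>0" "\<And>i. i < n \<Longrightarrow> y \<tau>0 i \<noteq> (0::complex)"
  shows "isCont (\<lambda>\<tau>. row_fun n q t a s r (y \<tau>)) (\<tau>0 :: complex)"
  unfolding row_fun_def fps_mult_nth using gen_fps_continuous[OF assms] by (intro continuous_intros)

lemma kappaB_continuous:
  assumes "\<And>j. j < n \<Longrightarrow> isCont (\<lambda>\<tau>. y \<tau> j) \<tau>0" "\<And>j. j < n \<Longrightarrow> y \<tau>0 j \<noteq> (0::complex)"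
    and "isCont z \<tau>0" "(z \<tau>0)^2 \<noteq> 1" "q * (z \<tau>0)^2 \<noteq> 1" "t \<noteq> 0"
    and "\<And>j. j < n \<Longrightarrow> j \<noteq> i \<Longrightarrow> z \<tau>0 * y \<tau>0 j \<noteq> 1 \<and> z \<tau>0 \<noteq> y \<tau>0 j"
  shows "isCont (\<lambda>\<tau>. kappaB n a q t (y \<tau>) i (z \<tau>)) (\<tau>0 :: complex)"
  unfolding kappaB_def using assms by (intro continuous_intros) auto

text \<open>The conditions on \<open>t * (x i)^2\<close> are removed by rescaling \<open>x\<close> and letting the scale tend to 1.\<close>
lemma row_fun_eigen:
  fixes q t a s :: complex
  assumes q: "norm q < 1" "q \<noteq> 0" and t: "t \<noteq> 0" "t \<noteq> 1" and n: "n > 0" and a0: "a \<noteq> 0"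
    and s: "s * (t ^ n * q ^ r) = 1"
    and s1: "s \<noteq> 1" and ts: "\<And>l. l < r \<Longrightarrow> t * s * q ^ l \<noteq> 1"
    and as: "\<And>l. l < r \<Longrightarrow> t^2 * s^2 * q * q ^ l \<noteq> a"
    and x: "x \<in> koornwinder_regular n q"
  shows "(\<Sum>i<n. kappaB n a q t x i (x i) * (row_fun n q t a s r (x(i := q * x i)) - row_fun n q t a s r x)
        + kappaB n a q t x i (1 / x i) * (row_fun n q t a s r (x(i := x i / q)) - row_fun n q t a s r x)) =
    (a / (t * s) + t * s - (a * t ^ (n - 1) + 1 / t ^ (n - 1))) * row_fun n q t a s r x"
proof -
  have x0: "x i \<noteq> 0" if "i < n" for i using x that by (simp add: koornwinder_regular_def torus_def)
  have xreg: "(x i)\<^sup>2 \<noteq> 1 \<and> q * (x i)\<^sup>2 \<noteq> 1 \<and> (x i)\<^sup>2 \<noteq> q" if "i < n" for i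
    using x that by (auto simp: koornwinder_regular_def)
  have xreg2: "x i \<noteq> x j \<and> x i * x j \<noteq> 1" if "i < n" "j < n" "i \<noteq> j" for i j
    using x that by (auto simp: koornwinder_regular_def)
  define y where "y = (\<lambda>\<tau> i. \<tau> * x i)"
  define d where "d = (\<lambda>\<tau>. (\<Sum>i<n. kappaB n a q t (y \<tau>) i (y \<tau> i) * (row_fun n q t a s r ((y \<tau>)(i := q * y \<tau> i)) - row_fun n q t a s r (y \<tau>))
        + kappaB n a q t (y \<tau>) i (1 / y \<tau> i) * (row_fun n q t a s r ((y \<tau>)(i := y \<tau> i / q)) - row_fun n q t a s r (y \<tau>)))
    - (a / (t * s) + t * s - (a * t ^ (n - 1) + 1 / t ^ (n - 1))) * row_fun n q t a s r (y \<tau>))"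
  \<comment> \<open>These are the values of \<tau>^2 at which the scaled point violates one of the
    required inequations. The inequations between distinct coordinates are preserved by scaling with
    \<tau> \<noteq> 0.\<close>
  define C where "C = (\<Union>i<n. {1 / (x i)^2, 1 / (q * (x i)^2), q / (x i)^2, 1 / (t * (x i)^2), t / (x i)^2} \<union> (\<Union>j<n. {1 / (x i * x j)}))"
  define bad where "bad = insert 0 (\<Union>c\<in>C. {\<tau>. \<tau>^2 = c})"
  have "finite C" by (auto simp: C_def)
  then have "countable bad" using finite_square_roots by (auto simp: bad_def intro!: countable_finite)
  then obtain S where S: "\<And>m. S m \<notin> bad" "S \<longlonglongrightarrow> 1"
    using countable_complement_seq by blast
  have "d (S m) = 0" for m
  proof -
    define \<tau> where "\<tau> = S m"
    have \<tau>: "\<tau> \<noteq> 0" "\<And>c. c \<in> C \<Longrightarrow> \<tau>^2 \<noteq> c" using S(1)[of m] by (auto simp: bad_def \<tau>_def)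
    have ne: "\<tau>^2 \<noteq> 1 / (x i)^2" "\<tau>^2 \<noteq> 1 / (q * (x i)^2)" "\<tau>^2 \<noteq> q / (x i)^2" "\<tau>^2 \<noteq> 1 / (t * (x i)^2)"
      "\<tau>^2 \<noteq> t / (x i)^2" if "i < n" for i
      using \<tau>(2) that by (auto simp: C_def)
    have ne2: "\<tau>^2 \<noteq> 1 / (x i * x j)" if "i < n" "j < n" for i j
      using \<tau>(2) that by (auto simp: C_def)
    have 1: "(y \<tau> i)^2 \<noteq> 1" "q * (y \<tau> i)^2 \<noteq> 1" "(y \<tau> i)^2 \<noteq> q" "t * (y \<tau> i)^2 \<noteq> 1" "(y \<tau> i)^2 \<noteq> t" if "i < n" for i
      using ne[OF that] x0[OF that] q t by (auto simp: y_def power_mult_distrib eq_divide_eq mult_ac)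
    have 2: "y \<tau> i \<noteq> y \<tau> j \<and> y \<tau> i * y \<tau> j \<noteq> 1" if "i < n" "j < n" "i \<noteq> j" for i j
      using ne2[OF that(1,2)] x0 xreg2[OF that] that \<tau>(1) by (auto simp: y_def power2_eq_square eq_divide_eq mult_ac)
    have "y \<tau> \<in> koornwinder_regular n q"
      using 1 2 x0 \<tau>(1) by (auto simp: koornwinder_regular_def torus_def) (auto simp: y_def)
    then show ?thesis
      unfolding d_def \<tau>_def[symmetric] using row_fun_eigen_generic[OF q t n a0 s s1 ts as, of "y \<tau>"] 1 by auto
  qed
  moreover have "isCont d 1"
  proof -
    have yc: "isCont (\<lambda>\<tau>. y \<tau> i) 1" for i unfolding y_def by (intro continuous_intros)
    have y1: "y 1 = x" by (simp add: y_def)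
    have R0: "isCont (\<lambda>\<tau>. row_fun n q t a s r (y \<tau>)) 1"
      by (rule row_fun_continuous) (auto simp: yc y1 x0)
    have R1: "isCont (\<lambda>\<tau>. row_fun n q t a s r ((y \<tau>)(i := c * y \<tau> i))) 1" if "c \<noteq> 0" for i c
    proof (rule row_fun_continuous)
      show "isCont (\<lambda>\<tau>. ((y \<tau>)(i := c * y \<tau> i)) j) 1" for j
        by (cases "j = i") (auto simp: yc intro!: continuous_intros)
      show "((y 1)(i := c * y 1 i)) j \<noteq> 0" if "j < n" for j
        using \<open>c \<noteq> 0\<close> x0 that by (auto simp: y1)
    qed
    have R2: "isCont (\<lambda>\<tau>. row_fun n q t a s r ((y \<tau>)(i := y \<tau> i / q))) 1" for i
      using R1[of "1 / q" i] q by simp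
    have K1: "isCont (\<lambda>\<tau>. kappaB n a q t (y \<tau>) i (y \<tau> i)) 1" if "i < n" for i
      by (rule kappaB_continuous) (use that xreg[of i] xreg2[of i] x0 t in \<open>auto simp: y1 yc\<close>)
    have K2: "isCont (\<lambda>\<tau>. kappaB n a q t (y \<tau>) i (1 / y \<tau> i)) 1" if "i < n" for i
    proof (rule kappaB_continuous)
      show "isCont (\<lambda>\<tau>. 1 / y \<tau> i) 1" using x0[OF that] yc by (intro continuous_intros) (auto simp: y1)
      show "(1 / y 1 i)^2 \<noteq> 1" "q * (1 / y 1 i)^2 \<noteq> 1"
        using xreg[OF that] x0[OF that] by (auto simp: y1 power_divide)
      show "1 / y 1 i * y 1 j \<noteq> 1 \<and> 1 / y 1 i \<noteq> y 1 j" if "j < n" "j \<noteq> i" for j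
        using xreg2[OF \<open>i < n\<close> that(1)] x0[OF \<open>i < n\<close>] that by (auto simp: y1 divide_eq_eq mult.commute)
    qed (auto simp: y1 yc x0 t)
    show ?thesis unfolding d_def
      using R0 R1[OF q(2)] R2 K1 K2 by (intro continuous_intros) auto
  qed
  ultimately have "(\<lambda>m. 0) \<longlonglongrightarrow> d 1"
    using isCont_tendsto_compose[of 1 d S sequentially] S(2) by simp
  then have "d 1 = 0" by (simp add: LIMSEQ_const_iff)
  then show ?thesis by (simp add: d_def y_def)
qed

section \<open>The operator at the type B parameters\<close>

lemma koornwinder_alpha_B: "q \<noteq> 0 \<Longrightarrow> koornwinder_alpha (- 1) a (- csqrt q) (csqrt q) q = csqrt a"
proof -
  assume "q \<noteq> 0"
  moreover have "csqrt q * csqrt q = q" by (simp flip: power2_eq_square)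
  ultimately have "(- 1) * a * (- csqrt q) * csqrt q / q = a" by (simp add: mult.assoc)
  then show ?thesis by (simp only: koornwinder_alpha_def)
qed

lemma koornwinder_op_B:
  assumes "q \<noteq> 0"
  shows "koornwinder_op n (- 1) a (- csqrt q) (csqrt q) q t f x = 1 / csqrt a *
    (\<Sum>i<n. kappaB n a q t x i (x i) * (f (x(i := q * x i)) - f x) + kappaB n a q t x i (1 / x i) * (f (x(i := x i / q)) - f x))"
proof -
  have sq: "(1 + csqrt q * y) * (1 - csqrt q * y) = 1 - q * y^2" for y
  proof -
    have "(1 + csqrt q * y) * (1 - csqrt q * y) = 1 - (csqrt q)^2 * y^2" by algebra
    then show ?thesis by simp
  qed
  have 1: "(1 - (-1) * y) * (1 - a * y) * (1 - (- csqrt q) * y) * (1 - csqrt q * y) / (csqrt a * T * D * D') =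
    1 / csqrt a * ((1 + y) * (1 - a * y) * (1 - q * y^2) / (T * D * D'))" for y T D D'
    using sq[of y] by (simp add: mult.assoc)
  have 2: "(1 - (-1) / y) * (1 - a / y) * (1 - (- csqrt q) / y) * (1 - csqrt q / y) / (csqrt a * T * D * D') =
    1 / csqrt a * ((1 + 1 / y) * (1 - a * (1 / y)) * (1 - q * (1 / y)^2) / (T * D * D'))" for y T D D'
    using sq[of "1 / y"] by (simp add: mult.assoc)
  show ?thesis
    unfolding koornwinder_op_def koornwinder_alpha_B[OF assms] 1 2 sum_distrib_left sum.distrib[symmetric] kappaB_def
    by (intro sum.cong refl) (simp add: distrib_left power_divide mult.assoc)
qed

section \<open>Uniqueness of the one-row Koornwinder polynomial\<close>

text \<open>The box serves as a common finite index set for all expansions, so that different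
  polynomials can be compared coefficient by coefficient.\<close>

definition exponent_box :: "nat \<Rightarrow> nat \<Rightarrow> (nat \<Rightarrow> int) set" where
  "exponent_box n r = {v. (\<forall>i<n. \<bar>v i\<bar> \<le> int r) \<and> (\<forall>i\<ge>n. v i = 0)}"

definition box_partitions :: "nat \<Rightarrow> nat \<Rightarrow> (nat \<Rightarrow> nat) set" where
  "box_partitions n r = {l. is_partition n l \<and> (\<forall>i. l i \<le> r)}"

definition signed_perm :: "nat \<Rightarrow> (nat \<Rightarrow> int) \<Rightarrow> (nat \<Rightarrow> nat) \<Rightarrow> (nat \<Rightarrow> int) \<Rightarrow> nat \<Rightarrow> int" where
  "signed_perm n e p v = (\<lambda>i. if i < n then e i * v (p i) else 0)"

lemma exponent_orbit_altdef:
  "exponent_orbit n l = {signed_perm n e p (\<lambda>i. int (l i)) | p e. p permutes {..<n} \<and> (\<forall>i. e i \<in> {1, -1})}"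
  by (auto simp: exponent_orbit_def signed_perm_def)

lemma finite_exponent_box: "finite (exponent_box n r)"
proof -
  have "exponent_box n r \<subseteq> {f. \<forall>x. (x \<in> {..<n} \<longrightarrow> f x \<in> {- int r..int r}) \<and> (x \<notin> {..<n} \<longrightarrow> f x = 0)}"
    by (auto simp: exponent_box_def abs_le_iff)
  then show ?thesis using finite_set_of_finite_funs[of "{..<n}" "{- int r..int r}" 0] finite_subset by blast
qed

lemma finite_box_partitions: "finite (box_partitions n r)"
proof -
  have "box_partitions n r \<subseteq> {f. \<forall>x. (x \<in> {..<n} \<longrightarrow> f x \<in> {..r}) \<and> (x \<notin> {..<n} \<longrightarrow> f x = 0)}"
    by (auto simp: box_partitions_def is_partition_def)
  then show ?thesis using finite_set_of_finite_funs[of "{..<n}" "{..r}" 0] finite_subset by blast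
qed

lemma signed_perm_orbit:
  assumes "v \<in> exponent_orbit n l" "p permutes {..<n}" "\<And>i. e i \<in> {1, -1}"
  shows "signed_perm n e p v \<in> exponent_orbit n l"
proof -
  obtain p' e' where v: "v = signed_perm n e' p' (\<lambda>i. int (l i))" "p' permutes {..<n}" "\<And>i. e' i \<in> {1, -1}"
    using assms(1) by (auto simp: exponent_orbit_altdef)
  have "p i < n" if "i < n" for i using permutes_in_image[OF assms(2)] that by auto
  then have "signed_perm n e p v = signed_perm n (\<lambda>i. e i * e' (p i)) (p' \<circ> p) (\<lambda>i. int (l i))"
    by (auto simp: v(1) signed_perm_def)
  moreover have "p' \<circ> p permutes {..<n}" using assms(2) v(2) by (rule permutes_compose)
  moreover have "e i * e' (p i) \<in> {1, -1}" for i using assms(3)[of i] v(3)[of "p i"] by auto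
  ultimately show ?thesis unfolding exponent_orbit_altdef by blast
qed

lemma partition_in_orbit:
  assumes "is_partition n l"
  shows "(\<lambda>i. int (l i)) \<in> exponent_orbit n l"
proof -
  have "(\<lambda>i. int (l i)) = signed_perm n (\<lambda>_. 1) id (\<lambda>i. int (l i))"
    using assms by (auto simp: signed_perm_def is_partition_def)
  then show ?thesis unfolding exponent_orbit_altdef using permutes_id by blast
qed

lemma orbit_abs:
  assumes "v \<in> exponent_orbit n l"
  obtains p where "p permutes {..<n}" "\<And>i. i < n \<Longrightarrow> \<bar>v i\<bar> = int (l (p i))" "\<And>i. i \<ge> n \<Longrightarrow> v i = 0"
proof -
  obtain p e where v: "v = signed_perm n e p (\<lambda>i. int (l i))" "p permutes {..<n}" "\<And>i. e i \<in> {1, -1}"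
    using assms by (auto simp: exponent_orbit_altdef)
  have "\<bar>v i\<bar> = int (l (p i))" if "i < n" for i
    using v(3)[of i] that by (auto simp: v(1) signed_perm_def)
  with v show ?thesis by (intro that[of p]) (auto simp: signed_perm_def)
qed

lemma orbit_sum_abs:
  assumes "v \<in> exponent_orbit n l"
  shows "(\<Sum>i<n. \<bar>v i\<bar>) = int (\<Sum>i<n. l i)"
proof -
  obtain p where p: "p permutes {..<n}" "\<And>i. i < n \<Longrightarrow> \<bar>v i\<bar> = int (l (p i))"
    using orbit_abs[OF assms] by metis
  have "(\<Sum>i<n. \<bar>v i\<bar>) = (\<Sum>i<n. int (l (p i)))" using p by simp
  also have "\<dots> = (\<Sum>i<n. int (l i))" using sum.permute[OF p(1), of "\<lambda>i. int (l i)"] by (simp add: o_def)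
  finally show ?thesis by simp
qed

lemma orbit_subset_box:
  assumes "l \<in> box_partitions n r"
  shows "exponent_orbit n l \<subseteq> exponent_box n r"
proof
  fix v assume "v \<in> exponent_orbit n l"
  then obtain p where "\<And>i. i < n \<Longrightarrow> \<bar>v i\<bar> = int (l (p i))" "\<And>i. i \<ge> n \<Longrightarrow> v i = 0"
    using orbit_abs by metis
  then show "v \<in> exponent_box n r" using assms by (auto simp: exponent_box_def box_partitions_def)
qed

lemma ex_partition:
  assumes "v \<in> exponent_box n r"
  shows "\<exists>l \<in> box_partitions n r. v \<in> exponent_orbit n l"
proof -
  define xs where "xs = map (\<lambda>i. nat \<bar>v i\<bar>) [0..<n]"
  \<comment> \<open>The partition of an exponent is the decreasing rearrangement of its absolute
    values.\<close>
  define ys where "ys = rev (sort xs)"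
  have "mset ys = mset xs" by (simp add: ys_def)
  then obtain p where p: "p permutes {..<length xs}" "permute_list p ys = xs"
    using mset_eq_permutation[of xs ys] by (metis mset_eq_length)
  define l where "l = (\<lambda>i. if i < n then ys ! i else 0)"
  have len: "length xs = n" "length ys = n" by (simp_all add: xs_def ys_def)
  have pn: "p i < n" if "i < n" for i using permutes_in_image[OF p(1)] that len by auto
  have "xs ! i = ys ! p i" if "i < n" for i
    using p permute_list_nth[of p ys i] that len by metis
  then have lp: "nat \<bar>v i\<bar> = l (p i)" if "i < n" for i
    using that pn[OF that] by (simp add: xs_def l_def)
  have "ys ! j \<le> ys ! i" if "i \<le> j" "j < n" for i j
  proof -
    have "ys ! j = sort xs ! (n - Suc j)" "ys ! i = sort xs ! (n - Suc i)"
      using that len by (simp_all add: ys_def rev_nth)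
    moreover have "sort xs ! (n - Suc j) \<le> sort xs ! (n - Suc i)"
      by (rule sorted_nth_mono) (use that len in auto)
    ultimately show ?thesis by simp
  qed
  then have "is_partition n l" by (auto simp: is_partition_def l_def antimono_def)
  moreover have "l i \<le> r" for i
  proof (cases "i < n")
    case True
    then have "ys ! i \<in> set xs" using len by (metis nth_mem set_rev set_sort ys_def)
    then show ?thesis using assms True by (auto simp: l_def xs_def exponent_box_def)
  qed (simp add: l_def)
  moreover have "v = signed_perm n (\<lambda>i. if v i < 0 then -1 else 1) p (\<lambda>i. int (l i))"
    using assms by (auto simp: signed_perm_def fun_eq_iff exponent_box_def simp flip: lp)
  moreover have "p permutes {..<n}" using p(1) len by simp
  ultimately show ?thesis
    unfolding exponent_orbit_altdef box_partitions_def by fastforce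
qed

text \<open>Signed permutations preserve the multiset of absolute values, and a decreasing sequence
  is determined by its multiset of entries.\<close>

lemma partition_unique:
  assumes "is_partition n l" "is_partition n l'" "v \<in> exponent_orbit n l" "v \<in> exponent_orbit n l'"
  shows "l = l'"
proof -
  have mset: "mset (map l [0..<n]) = mset (map (\<lambda>i. nat \<bar>v i\<bar>) [0..<n])" if v: "v \<in> exponent_orbit n l" for l
  proof -
    obtain p where p: "p permutes {..<n}" "\<And>i. i < n \<Longrightarrow> \<bar>v i\<bar> = int (l (p i))"
      using orbit_abs[OF v] by metis
    have "mset (map (\<lambda>i. nat \<bar>v i\<bar>) [0..<n]) = image_mset (\<lambda>i. nat \<bar>v i\<bar>) (mset_set {..<n})"
      by (simp add: atLeast0LessThan)
    also have "\<dots> = image_mset (\<lambda>i. l (p i)) (mset_set {..<n})"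
      by (rule image_mset_cong) (use p in auto)
    also have "\<dots> = image_mset l (image_mset p (mset_set {..<n}))"
      by (simp add: image_mset.compositionality o_def)
    also have "image_mset p (mset_set {..<n}) = mset_set {..<n}"
      using p(1) by (subst image_mset_mset_set) (auto simp: permutes_image permutes_inj_on)
    finally show ?thesis by (simp add: atLeast0LessThan)
  qed
  have sorted: "sorted (rev (map l [0..<n]))" if "is_partition n l" for l
    using that by (auto simp: is_partition_def antimono_def sorted_iff_nth_mono rev_nth)
  have "mset (rev (map l [0..<n])) = mset (rev (map l' [0..<n]))"
    using mset[OF assms(3)] mset[OF assms(4)] by simp
  then have "rev (map l [0..<n]) = rev (map l' [0..<n])"
    using properties_for_sort[of "rev (map l [0..<n])" "rev (map l' [0..<n])"] sorted assms(1,2)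
    by (metis sorted_sort_id)
  then have "l i = l' i" if "i < n" for i using that by (simp add: map_eq_conv)
  moreover have "l i = l' i" if "i \<ge> n" for i using that assms(1,2) by (simp add: is_partition_def)
  ultimately show ?thesis by (metis ext linorder_not_less)
qed

definition partition_of :: "nat \<Rightarrow> (nat \<Rightarrow> int) \<Rightarrow> nat \<Rightarrow> nat" where
  "partition_of n v = (THE l. is_partition n l \<and> v \<in> exponent_orbit n l)"

lemma partition_of_eq:
  assumes "is_partition n l" "v \<in> exponent_orbit n l"
  shows "partition_of n v = l"
  unfolding partition_of_def using assms partition_unique by blast

lemma sum_box_orbits:
  fixes f :: "(nat \<Rightarrow> int) \<Rightarrow> complex"
  shows "(\<Sum>v\<in>exponent_box n r. f v) = (\<Sum>l\<in>box_partitions n r. \<Sum>v\<in>exponent_orbit n l. f v)"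
proof -
  have "exponent_box n r = (\<Union>l\<in>box_partitions n r. exponent_orbit n l)"
    using ex_partition orbit_subset_box by fast
  moreover have "finite (exponent_orbit n l)" if "l \<in> box_partitions n r" for l
    using orbit_subset_box[OF that] finite_exponent_box finite_subset by blast
  moreover have "exponent_orbit n l \<inter> exponent_orbit n l' = {}"
    if "l \<in> box_partitions n r" "l' \<in> box_partitions n r" "l \<noteq> l'" for l l'
    using that partition_unique by (auto simp: box_partitions_def)
  ultimately show ?thesis
    by (simp add: sum.UNION_disjoint finite_box_partitions)
qed

lemma sum_orbit_sums:
  "(\<Sum>l\<in>box_partitions n r. k l * orbit_sum n l x) = (\<Sum>v\<in>exponent_box n r. k (partition_of n v) * lmonom n v x)"
  unfolding sum_box_orbits orbit_sum_def sum_distrib_left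
  by (intro sum.cong refl) (auto simp: partition_of_eq box_partitions_def)

text \<open>All nonempty partial sums of the row equal r, so being dominated by it is a condition on
  the size alone. Smaller sizes occur because the order compares partitions of different
  size.\<close>

lemma row_partition_lower:
  assumes "n > 0"
  shows "is_partition n (row_partition r)"
    and "insert (row_partition r) (lower_partitions n (row_partition r)) = {l \<in> box_partitions n r. (\<Sum>i<n. l i) \<le> r}"
proof -
  show row: "is_partition n (row_partition r)"
    using assms by (auto simp: is_partition_def row_partition_def antimono_def)
  have row_sum: "(\<Sum>i<k. row_partition r i) = (if k = 0 then 0 else r)" for k
    by (cases k) (simp_all add: row_partition_def sum.lessThan_Suc_shift del: sum.lessThan_Suc)
  have "dominated l (row_partition r) \<longleftrightarrow> (\<Sum>i<n. l i) \<le> r" if "is_partition n l" for l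
  proof
    assume "dominated l (row_partition r)"
    then show "(\<Sum>i<n. l i) \<le> r" using assms by (auto simp: dominated_def row_sum dest: spec[of _ n])
  next
    assume le: "(\<Sum>i<n. l i) \<le> r"
    have "(\<Sum>i<k. l i) \<le> (\<Sum>i<n. l i)" for k
    proof -
      have "(\<Sum>i<k. l i) \<le> (\<Sum>i<k + n. l i)" by (rule sum_mono2) auto
      also have "\<dots> = (\<Sum>i<n. l i)"
        by (rule sum.mono_neutral_right) (use that in \<open>auto simp: is_partition_def\<close>)
      finally show ?thesis .
    qed
    then show "dominated l (row_partition r)"
      using le order_trans by (auto simp: dominated_def row_sum)
  qed
  moreover have "l i \<le> r" if "is_partition n l" "(\<Sum>i<n. l i) \<le> r" for l i
  proof (cases "i < n")
    case True
    then have "l i \<le> (\<Sum>i<n. l i)" by (intro member_le_sum) auto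
    then show ?thesis using that by simp
  qed (use that in \<open>auto simp: is_partition_def\<close>)
  moreover have "dominated (row_partition r) (row_partition r)" by (simp add: dominated_def)
  ultimately show "insert (row_partition r) (lower_partitions n (row_partition r)) = {l \<in> box_partitions n r. (\<Sum>i<n. l i) \<le> r}"
    using row by (auto simp: lower_partitions_def box_partitions_def)
qed

lemma lmonom_perm:
  assumes "p permutes {..<n}"
  shows "lmonom n v (x \<circ> p) = lmonom n (signed_perm n (\<lambda>_. 1) (inv p) v) x"
proof -
  have "lmonom n v (x \<circ> p) = (\<Prod>i<n. x (p i) powi v i)" by (simp add: lmonom_def)
  also have "\<dots> = (\<Prod>i<n. x (p i) powi v (inv p (p i)))"
    using permutes_inverses(2)[OF assms] by simp
  also have "\<dots> = (\<Prod>i<n. x i powi v (inv p i))"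
    using prod.permute[OF assms, of "\<lambda>i. x i powi v (inv p i)"] by (simp add: o_def)
  finally show ?thesis by (simp add: lmonom_def signed_perm_def)
qed

lemma lmonom_inverse:
  assumes "i < n"
  shows "lmonom n v (x(i := inverse (x i))) = lmonom n (signed_perm n (\<lambda>j. if j = i then -1 else 1) id v) x"
  unfolding lmonom_def signed_perm_def
  by (intro prod.cong) (auto simp: power_int_minus power_int_inverse)

lemma signed_perm_inj:
  assumes "p permutes {..<n}" "\<And>i. e i \<in> {1, -1}"
  shows "inj_on (signed_perm n e p) {v. \<forall>i\<ge>n. v i = 0}"
proof (rule inj_onI)
  fix v w assume vw: "v \<in> {v. \<forall>i\<ge>n. v i = 0}" "w \<in> {v. \<forall>i\<ge>n. v i = 0}" "signed_perm n e p v = signed_perm n e p w"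
  have "v i = w i" if "i < n" for i
  proof -
    have "i \<in> p ` {..<n}" using permutes_image[OF assms(1)] that by simp
    then obtain j where j: "j < n" "p j = i" by auto
    have "e j * v i = e j * w i" using fun_cong[OF vw(3), of j] j by (simp add: signed_perm_def)
    then show ?thesis using assms(2)[of j] by auto
  qed
  moreover have "v i = w i" if "\<not> i < n" for i using vw(1,2) that by auto
  ultimately show "v = w" by (intro ext) blast
qed

lemma orbit_sum_signed_perm:
  assumes "p permutes {..<n}" "\<And>i. e i \<in> {1, -1}" "l \<in> box_partitions n r"
  shows "(\<Sum>v\<in>exponent_orbit n l. lmonom n (signed_perm n e p v) x) = orbit_sum n l x"
proof -
  have sub: "exponent_orbit n l \<subseteq> {v. \<forall>i\<ge>n. v i = 0}"
    using orbit_subset_box[OF assms(3)] by (auto simp: exponent_box_def)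
  have fin: "finite (exponent_orbit n l)"
    using orbit_subset_box[OF assms(3)] finite_exponent_box finite_subset by blast
  have inj: "inj_on (signed_perm n e p) (exponent_orbit n l)"
    using signed_perm_inj[of p n e] assms(1,2) sub inj_on_subset by blast
  have "signed_perm n e p ` exponent_orbit n l = exponent_orbit n l"
    by (rule card_subset_eq[OF fin]) (use signed_perm_orbit assms(1,2) card_image[OF inj] in auto)
  then show ?thesis
    unfolding orbit_sum_def using sum.reindex[OF inj, of "\<lambda>v. lmonom n v x"] by (simp add: o_def)
qed

lemma orbit_sum_invariant:
  assumes "l \<in> box_partitions n r"
  shows "perm_inv_invariant n (orbit_sum n l)"
  unfolding perm_inv_invariant_def
proof (intro ballI conjI allI impI)
  fix x p assume p: "p permutes {..<n}"
  show "orbit_sum n l (x \<circ> p) = orbit_sum n l x"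
    unfolding orbit_sum_def[of n l "x \<circ> p"] lmonom_perm[OF p]
    by (rule orbit_sum_signed_perm[OF permutes_inv[OF p] _ assms]) auto
next
  fix x :: "nat \<Rightarrow> complex" and i assume i: "i < n"
  show "orbit_sum n l (x(i := inverse (x i))) = orbit_sum n l x"
    unfolding orbit_sum_def[of n l "x(i := inverse (x i))"] lmonom_inverse[OF i]
    by (rule orbit_sum_signed_perm[OF permutes_id _ assms]) auto
qed

section \<open>Growth of monomials along the test points\<close>

text \<open>
  For large \<open>B\<close> the weight orders exponents lexicographically; it is the order of growth of
  \<open>lmonom n v\<close> along \<open>test_point n B z\<close> as \<open>z\<close> tends to 0.
\<close>
definition weight :: "nat \<Rightarrow> nat \<Rightarrow> (nat \<Rightarrow> int) \<Rightarrow> int" where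
  "weight n B v = (\<Sum>i<n. v i * int B ^ (n - i))"

text \<open>Uniqueness of expansions in base B: the last digit is divisible by B and smaller than B
  in absolute value, hence zero; then a factor B is removed and the induction continues.\<close>

lemma weight_zero_imp:
  assumes "\<And>i. i < n \<Longrightarrow> \<bar>d i\<bar> < int B" "weight n B d = 0"
  shows "\<forall>i<n. d i = 0"
  using assms
proof (induction n)
  case (Suc n)
  have "weight (Suc n) B d = int B * (weight n B d + d n)"
    by (simp add: weight_def Suc_diff_le sum_distrib_left distrib_left mult_ac)
  moreover have "int B > 0" using Suc.prems(1)[of n] by simp
  ultimately have 0: "weight n B d + d n = 0" using Suc.prems(2) by simp
  have "int B dvd weight n B d"
    unfolding weight_def by (intro dvd_sum) (auto intro!: dvd_mult dvd_power)
  then have "int B dvd d n" using 0 by (metis add.commute dvd_0_right dvd_add_right_iff)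
  then have "d n = 0" using Suc.prems(1)[of n] zdvd_not_zless[of "\<bar>d n\<bar>" "int B"] by fastforce
  with Suc 0 show ?case by (auto simp: less_Suc_eq)
qed simp

text \<open>Entries of two exponents in the box differ by at most 2 r. The base
  \<open>2 * r + 2\<close> exceeds this, and it is at least 2 also when r = 0, as the limits along
  the test points require.\<close>

lemma weight_inj:
  assumes "v \<in> exponent_box n r" "w \<in> exponent_box n r" "weight n (2 * r + 2) v = weight n (2 * r + 2) w"
  shows "v = w"
proof -
  have "weight n (2 * r + 2) (\<lambda>i. v i - w i) = 0"
    using assms(3) by (simp add: weight_def left_diff_distrib sum_subtractf)
  moreover have "\<bar>v i - w i\<bar> < int (2 * r + 2)" if "i < n" for i
  proof -
    have "\<bar>v i\<bar> \<le> int r" "\<bar>w i\<bar> \<le> int r" using assms(1,2) that by (auto simp: exponent_box_def)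
    then show ?thesis by linarith
  qed
  ultimately have "\<forall>i<n. v i - w i = 0" by (intro weight_zero_imp)
  moreover have "v i = w i" if "\<not> i < n" for i using assms(1,2) that by (auto simp: exponent_box_def)
  ultimately show ?thesis by (intro ext) (metis eq_iff_diff_eq_0)
qed

definition test_point :: "nat \<Rightarrow> nat \<Rightarrow> complex \<Rightarrow> nat \<Rightarrow> complex" where
  "test_point n B z i = 1 / z ^ (B ^ (n - i))"

lemma lmonom_test_point:
  assumes "z \<noteq> 0"
  shows "lmonom n v (test_point n B z) = z powi (- weight n B v)"
proof -
  have "test_point n B z i powi v i = z powi (- (v i * int B ^ (n - i)))" for i
  proof -
    have "test_point n B z i = z powi (- int (B ^ (n - i)))"
      by (simp add: test_point_def power_int_minus inverse_eq_divide del: of_nat_power)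
    then have "test_point n B z i powi v i = z powi (- int (B ^ (n - i)) * v i)"
      by (simp only: power_int_mult)
    then show ?thesis by (simp add: mult.commute)
  qed
  moreover have "(\<Prod>i\<in>A. z powi f i) = z powi (\<Sum>i\<in>A. f i)" if "finite A" for A and f :: "nat \<Rightarrow> int"
    using that assms by induction (simp_all add: power_int_add)
  ultimately show ?thesis
    by (simp add: lmonom_def weight_def sum_negf)
qed

text \<open>After multiplication by z to the weight of w, every term with a nonzero coefficient is a
  nonnegative power of z, and the exponent is zero only for w.\<close>

lemma tendsto_leading_coeff:
  assumes "finite V" "w \<in> V" "\<And>v. v \<in> V \<Longrightarrow> v \<noteq> w \<Longrightarrow> C v \<noteq> 0 \<Longrightarrow> weight n B v < weight n B w"
  shows "((\<lambda>z. z powi weight n B w * (\<Sum>v\<in>V. C v * lmonom n v (test_point n B z))) \<longlongrightarrow> C w) (at 0)"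
proof -
  have "((\<lambda>z. \<Sum>v\<in>V. C v * z ^ nat (weight n B w - weight n B v)) \<longlongrightarrow> (\<Sum>v\<in>V. if v = w then C w else 0)) (at (0::complex))"
  proof (rule tendsto_sum)
    fix v assume v: "v \<in> V"
    show "((\<lambda>z. C v * z ^ nat (weight n B w - weight n B v)) \<longlongrightarrow> (if v = w then C w else 0)) (at (0::complex))"
    proof (cases "v = w \<or> C v = 0")
      case False
      then have "nat (weight n B w - weight n B v) > 0" using assms(3)[OF v] by auto
      then have "((\<lambda>z. C v * z ^ nat (weight n B w - weight n B v)) \<longlongrightarrow> C v * 0 ^ nat (weight n B w - weight n B v)) (at 0)"
        by (intro tendsto_intros)
      with False \<open>nat _ > 0\<close> show ?thesis by (simp add: zero_power)
    qed auto
  qed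
  moreover have "(\<Sum>v\<in>V. if v = w then C w else 0) = C w" using assms by simp
  moreover have "eventually (\<lambda>z. (\<Sum>v\<in>V. C v * z ^ nat (weight n B w - weight n B v)) =
     z powi weight n B w * (\<Sum>v\<in>V. C v * lmonom n v (test_point n B z))) (at (0::complex))"
    unfolding eventually_at_filter
  proof (intro always_eventually allI impI)
    fix z :: complex assume "z \<noteq> 0"
    have "C v * z ^ nat (weight n B w - weight n B v) = z powi weight n B w * (C v * lmonom n v (test_point n B z))"
      if "v \<in> V" for v
    proof (cases "v = w \<or> C v \<noteq> 0")
      case True
      then have "weight n B v \<le> weight n B w" using assms(3)[OF that] by force
      then have "z ^ nat (weight n B w - weight n B v) = z powi (weight n B w - weight n B v)"
        by (simp add: power_int_def)
      also have "\<dots> = z powi weight n B w * z powi (- weight n B v)"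
        using \<open>z \<noteq> 0\<close> by (simp add: power_int_diff power_int_minus divide_inverse)
      finally show ?thesis using \<open>z \<noteq> 0\<close> by (simp add: lmonom_test_point)
    qed auto
    then show "(\<Sum>v\<in>V. C v * z ^ nat (weight n B w - weight n B v)) =
     z powi weight n B w * (\<Sum>v\<in>V. C v * lmonom n v (test_point n B z))"
      unfolding sum_distrib_left by (rule sum.cong[OF refl])
  qed
  ultimately show ?thesis using Lim_transform_eventually by fastforce
qed

lemma lmonom_scale:
  assumes "i < n"
  shows "lmonom n v (x(i := c * x i)) = c powi v i * lmonom n v x"
proof -
  have I: "finite {..<n}" "i \<in> {..<n}" using assms by auto
  show ?thesis
    unfolding lmonom_def prod.remove[OF I]
    by (auto simp: power_int_mult_distrib intro!: prod.cong)
qed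

section \<open>Limits of the operator coefficients and the eigenvalue\<close>

lemma tendsto_ratio_inf:
  assumes "(f \<longlongrightarrow> 0) F" "eventually (\<lambda>z. f z \<noteq> 0) F"
  shows "((\<lambda>z. (1 - t * (1 / f z)) / (1 - 1 / f z)) \<longlongrightarrow> (t::complex)) F"
proof -
  have "((\<lambda>z. (f z - t) / (f z - 1)) \<longlongrightarrow> (0 - t) / (0 - 1)) F"
    by (intro tendsto_intros assms) simp
  moreover have "eventually (\<lambda>z. (f z - t) / (f z - 1) = (1 - t * (1 / f z)) / (1 - 1 / f z)) F"
    using assms(2) by eventually_elim (simp add: divide_simps)
  ultimately show ?thesis using Lim_transform_eventually by fastforce
qed

lemma tendsto_ratio_zero:
  assumes "(f \<longlongrightarrow> 0) F"
  shows "((\<lambda>z. (1 - t * f z) / (1 - f z)) \<longlongrightarrow> (1::complex)) F"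
proof -
  have "((\<lambda>z. (1 - t * f z) / (1 - f z)) \<longlongrightarrow> (1 - t * 0) / (1 - 0)) F"
    by (intro tendsto_intros assms) simp
  then show ?thesis by simp
qed

lemma tendsto_power_zero: "k > 0 \<Longrightarrow> ((\<lambda>z. z ^ k) \<longlongrightarrow> 0) (at (0::complex))"
proof -
  assume "k > 0"
  have "((\<lambda>z. z ^ k) \<longlongrightarrow> 0 ^ k) (at (0::complex))" by (intro tendsto_intros)
  then show ?thesis using \<open>k > 0\<close> by (simp add: zero_power)
qed

lemma eventually_at_0_nonzero: "eventually (\<lambda>z. z \<noteq> 0) (at (0::complex))"
  by (simp add: eventually_at_filter)

lemma prod_if_gt: "i < n \<Longrightarrow> (\<Prod>j\<in>{..<n}-{i}. if i < j then t else 1) = (t::complex) ^ (n - 1 - i)"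
proof -
  assume "i < n"
  have "(\<Prod>j\<in>{..<n}-{i}. if i < j then t else 1) = (\<Prod>j\<in>{i<..<n}. t)"
    by (rule prod.mono_neutral_cong_right) auto
  then show ?thesis by simp
qed

lemma prod_if_lt: "i < n \<Longrightarrow> (\<Prod>j\<in>{..<n}-{i}. if i < j then 1 else t) = (t::complex) ^ i"
proof -
  assume "i < n"
  have "(\<Prod>j\<in>{..<n}-{i}. if i < j then 1 else t) = (\<Prod>j\<in>{..<i}. t)"
    by (rule prod.mono_neutral_cong_right) (use \<open>i < n\<close> in auto)
  then show ?thesis by simp
qed

definition koornwinder_coeff :: "nat \<Rightarrow> complex \<Rightarrow> complex \<Rightarrow> complex \<Rightarrow> complex \<Rightarrow> complex \<Rightarrow> complex \<Rightarrow> (nat \<Rightarrow> complex) \<Rightarrow> nat \<Rightarrow> complex" where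
  "koornwinder_coeff n a b c d q t x i = (1 - a * x i) * (1 - b * x i) * (1 - c * x i) * (1 - d * x i) /
        (koornwinder_alpha a b c d q * t ^ (n - 1) * (1 - (x i)\<^sup>2) * (1 - q * (x i)\<^sup>2)) *
        (\<Prod>j\<in>{..<n} - {i}.
           (1 - t * x i * x j) * (1 - t * x i / x j) /
           ((1 - x i * x j) * (1 - x i / x j)))"

definition koornwinder_coeff' :: "nat \<Rightarrow> complex \<Rightarrow> complex \<Rightarrow> complex \<Rightarrow> complex \<Rightarrow> complex \<Rightarrow> complex \<Rightarrow> (nat \<Rightarrow> complex) \<Rightarrow> nat \<Rightarrow> complex" where
  "koornwinder_coeff' n a b c d q t x i = (1 - a / x i) * (1 - b / x i) * (1 - c / x i) * (1 - d / x i) /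
        (koornwinder_alpha a b c d q * t ^ (n - 1) * (1 - 1 / (x i)\<^sup>2) * (1 - q / (x i)\<^sup>2)) *
        (\<Prod>j\<in>{..<n} - {i}.
           (1 - t * x j / x i) * (1 - t / (x i * x j)) /
           ((1 - x j / x i) * (1 - 1 / (x i * x j))))"

lemma koornwinder_op_altdef:
  "koornwinder_op n a b c d q t f x =
     (\<Sum>i<n. koornwinder_coeff n a b c d q t x i * (f (x(i := q * x i)) - f x)) +
     (\<Sum>i<n. koornwinder_coeff' n a b c d q t x i * (f (x(i := x i / q)) - f x))"
  by (simp add: koornwinder_op_def koornwinder_coeff_def koornwinder_coeff'_def)

context
  fixes n B :: nat and a b c d q t :: complex
  assumes B: "B \<ge> 2" and q0: "q \<noteq> 0" and t0: "t \<noteq> 0" and abcd: "a * b * c * d \<noteq> 0"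
begin

lemma test_point_ratio:
  assumes "z \<noteq> 0" "i < j" "j < n"
  shows "test_point n B z j / test_point n B z i = z ^ (B ^ (n - i) - B ^ (n - j))" "B ^ (n - i) - B ^ (n - j) > 0"
proof -
  have "n - j < n - i" using assms by simp
  then have lt: "B ^ (n - j) < B ^ (n - i)" using B by (intro power_strict_increasing) auto
  then show "B ^ (n - i) - B ^ (n - j) > 0" by simp
  show "test_point n B z j / test_point n B z i = z ^ (B ^ (n - i) - B ^ (n - j))"
    using assms(1) lt by (simp add: test_point_def power_diff)
qed

lemma test_point_limits:
  assumes "i < n"
  shows "((\<lambda>z. 1 / test_point n B z i) \<longlongrightarrow> 0) (at 0)" "z \<noteq> 0 \<Longrightarrow> test_point n B z i \<noteq> 0"
proof -
  show "((\<lambda>z. 1 / test_point n B z i) \<longlongrightarrow> 0) (at 0)"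
    using tendsto_power_zero[of "B ^ (n - i)"] B by (simp add: test_point_def)
qed (simp add: test_point_def)

lemma test_point_ratio_limit:
  assumes "i < j" "j < n"
  shows "((\<lambda>z. test_point n B z j / test_point n B z i) \<longlongrightarrow> 0) (at 0)"
proof -
  have "((\<lambda>z. z ^ (B ^ (n - i) - B ^ (n - j))) \<longlongrightarrow> 0) (at (0::complex))"
    using test_point_ratio(2)[OF _ assms, of 1] by (intro tendsto_power_zero) simp
  moreover have "eventually (\<lambda>z. z ^ (B ^ (n - i) - B ^ (n - j)) = test_point n B z j / test_point n B z i) (at (0::complex))"
    using eventually_at_0_nonzero by eventually_elim (simp add: test_point_ratio assms)
  ultimately show ?thesis using Lim_transform_eventually by fast
qed

text \<open>Along the test points all products x i * x j tend to infinity, while x i / x j tends to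
  infinity for i < j and to 0 for i > j. Each quotient (1 - t y) / (1 - y) therefore tends to t or
  to 1.\<close>

lemma pair_limits:
  assumes "i < n" "j < n" "i \<noteq> j"
  defines "x \<equiv> test_point n B"
  shows "((\<lambda>z. (1 - t * x z i * x z j) * (1 - t * x z i / x z j) / ((1 - x z i * x z j) * (1 - x z i / x z j))) \<longlongrightarrow>
      t * (if i < j then t else 1)) (at 0)"
    and "((\<lambda>z. (1 - t * x z j / x z i) * (1 - t / (x z i * x z j)) / ((1 - x z j / x z i) * (1 - 1 / (x z i * x z j)))) \<longlongrightarrow>
      (if i < j then 1 else t)) (at 0)"
proof -
  have nz: "eventually (\<lambda>z. x z i \<noteq> 0 \<and> x z j \<noteq> 0) (at 0)"
    using eventually_at_0_nonzero by eventually_elim (use test_point_limits(2) assms in auto)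
  have "((\<lambda>z. 1 / x z i * (1 / x z j)) \<longlongrightarrow> 0 * 0) (at 0)"
    unfolding x_def by (intro tendsto_mult test_point_limits assms)
  then have p0: "((\<lambda>z. 1 / (x z i * x z j)) \<longlongrightarrow> 0) (at 0)" by simp
  have L1: "((\<lambda>z. (1 - t * (1 / (1 / (x z i * x z j)))) / (1 - 1 / (1 / (x z i * x z j)))) \<longlongrightarrow> t) (at 0)"
    by (rule tendsto_ratio_inf[OF p0]) (use nz in eventually_elim, simp)
  have L1': "((\<lambda>z. (1 - t * (1 / (x z i * x z j))) / (1 - 1 / (x z i * x z j))) \<longlongrightarrow> 1) (at 0)"
    by (rule tendsto_ratio_zero[OF p0])
  have L2: "((\<lambda>z. (1 - t * (x z i / x z j)) / (1 - x z i / x z j)) \<longlongrightarrow> (if i < j then t else 1)) (at 0)"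
  proof (cases "i < j")
    case True
    have "((\<lambda>z. (1 - t * (1 / (x z j / x z i))) / (1 - 1 / (x z j / x z i))) \<longlongrightarrow> t) (at 0)"
      unfolding x_def by (rule tendsto_ratio_inf[OF test_point_ratio_limit])
        (use True assms(2) nz in \<open>auto simp: x_def elim!: eventually_mono\<close>)
    then show ?thesis using True by simp
  next
    case False
    then have "((\<lambda>z. x z i / x z j) \<longlongrightarrow> 0) (at 0)"
      unfolding x_def using assms by (intro test_point_ratio_limit) auto
    from tendsto_ratio_zero[OF this, of t] show ?thesis using False by simp
  qed
  have L3: "((\<lambda>z. (1 - t * (x z j / x z i)) / (1 - x z j / x z i)) \<longlongrightarrow> (if i < j then 1 else t)) (at 0)"
  proof (cases "i < j")
    case False
    have "((\<lambda>z. (1 - t * (1 / (x z i / x z j))) / (1 - 1 / (x z i / x z j))) \<longlongrightarrow> t) (at 0)"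
      unfolding x_def by (rule tendsto_ratio_inf[OF test_point_ratio_limit])
        (use False assms(1,3) nz in \<open>auto simp: x_def elim!: eventually_mono\<close>)
    then show ?thesis using False by simp
  next
    case True
    then have "((\<lambda>z. x z j / x z i) \<longlongrightarrow> 0) (at 0)"
      unfolding x_def using assms by (intro test_point_ratio_limit) auto
    from tendsto_ratio_zero[OF this, of t] show ?thesis using True by simp
  qed
  show "((\<lambda>z. (1 - t * x z i * x z j) * (1 - t * x z i / x z j) / ((1 - x z i * x z j) * (1 - x z i / x z j))) \<longlongrightarrow>
      t * (if i < j then t else 1)) (at 0)"
    using tendsto_mult[OF L1 L2] by (simp add: mult.assoc)
  show "((\<lambda>z. (1 - t * x z j / x z i) * (1 - t / (x z i * x z j)) / ((1 - x z j / x z i) * (1 - 1 / (x z i * x z j)))) \<longlongrightarrow>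
      (if i < j then 1 else t)) (at 0)"
    using tendsto_mult[OF L3 L1'] by simp
qed

text \<open>The one-variable factor of the first coefficient tends to a b c d / q = \<alpha>^2
  divided by \<alpha> t^(n-1). The pairs contribute t once for each j \<noteq> i from the products
  and once more for each j > i from the quotients. The limits are the weights that appear in
  \<open>koornwinder_eigenvalue\<close>.\<close>

lemma coeff_limits:
  assumes "i < n"
  defines "x \<equiv> test_point n B" and "\<alpha> \<equiv> koornwinder_alpha a b c d q"
  shows "((\<lambda>z. koornwinder_coeff n a b c d q t (x z) i) \<longlongrightarrow> \<alpha> * t ^ (n - 1 - i)) (at 0)"
    and "((\<lambda>z. koornwinder_coeff' n a b c d q t (x z) i) \<longlongrightarrow> 1 / (\<alpha> * t ^ (n - 1 - i))) (at 0)"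
proof -
  have \<alpha>2: "\<alpha>^2 = a * b * c * d / q" by (simp add: \<alpha>_def koornwinder_alpha_def)
  then have \<alpha>0: "\<alpha> \<noteq> 0" using abcd q0 by auto
  define y where "y = (\<lambda>z. 1 / x z i)"
  have y0: "(y \<longlongrightarrow> 0) (at 0)" unfolding y_def x_def by (rule test_point_limits[OF assms(1)])
  have ynz: "eventually (\<lambda>z. x z i \<noteq> 0 \<and> x z i = 1 / y z \<and> y z \<noteq> 0) (at 0)"
    using eventually_at_0_nonzero by eventually_elim (use test_point_limits(2)[OF assms(1)] in \<open>auto simp: y_def x_def\<close>)
  \<comment> \<open>Numerator and denominator are divided by (x i)^4, which leaves a rational
    function of y = 1 / x i that is continuous at 0.\<close>
  have "((\<lambda>z. (y z - a) * (y z - b) * (y z - c) * (y z - d) / (\<alpha> * t ^ (n - 1) * ((y z)^2 - 1) * ((y z)^2 - q))) \<longlongrightarrow>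
      (0 - a) * (0 - b) * (0 - c) * (0 - d) / (\<alpha> * t ^ (n - 1) * (0^2 - 1) * (0^2 - q))) (at 0)"
    by (intro tendsto_intros y0) (use \<alpha>0 t0 q0 in auto)
  also have "(0 - a) * (0 - b) * (0 - c) * (0 - d) / (\<alpha> * t ^ (n - 1) * (0^2 - 1) * (0^2 - q)) = \<alpha>^2 / (\<alpha> * t ^ (n - 1))"
    unfolding \<alpha>2 using q0 by simp
  also have "\<dots> = \<alpha> / t ^ (n - 1)" using \<alpha>0 by (simp add: power2_eq_square)
  finally have "((\<lambda>z. (1 - a * x z i) * (1 - b * x z i) * (1 - c * x z i) * (1 - d * x z i) /
        (\<alpha> * t ^ (n - 1) * (1 - (x z i)\<^sup>2) * (1 - q * (x z i)\<^sup>2))) \<longlongrightarrow> \<alpha> / t ^ (n - 1)) (at 0)"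
  proof (rule Lim_transform_eventually)
    show "\<forall>\<^sub>F z in at 0. (y z - a) * (y z - b) * (y z - c) * (y z - d) / (\<alpha> * t ^ (n - 1) * ((y z)^2 - 1) * ((y z)^2 - q)) =
      (1 - a * x z i) * (1 - b * x z i) * (1 - c * x z i) * (1 - d * x z i) /
        (\<alpha> * t ^ (n - 1) * (1 - (x z i)\<^sup>2) * (1 - q * (x z i)\<^sup>2))"
      using ynz
    proof eventually_elim
      case (elim z)
      have n1: "1 - e * x z i = (y z - e) / y z" for e using elim by (simp add: field_simps)
      have n2: "1 - e * (x z i)^2 = ((y z)^2 - e) / (y z)^2" for e using elim by (simp add: field_simps)
      have n3: "1 - (x z i)^2 = ((y z)^2 - 1) / (y z)^2" using n2[of 1] by simp
      show ?case unfolding n1 n2 n3 using elim by (simp add: power2_eq_square)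
    qed
  qed
  moreover have "((\<lambda>z. \<Prod>j\<in>{..<n} - {i}. (1 - t * x z i * x z j) * (1 - t * x z i / x z j) /
           ((1 - x z i * x z j) * (1 - x z i / x z j))) \<longlongrightarrow> (\<Prod>j\<in>{..<n} - {i}. t * (if i < j then t else 1))) (at 0)"
    unfolding x_def by (intro tendsto_prod pair_limits) (use assms in auto)
  ultimately have "((\<lambda>z. koornwinder_coeff n a b c d q t (x z) i) \<longlongrightarrow>
     \<alpha> / t ^ (n - 1) * (\<Prod>j\<in>{..<n} - {i}. t * (if i < j then t else 1))) (at 0)"
    unfolding koornwinder_coeff_def \<alpha>_def by (rule tendsto_mult)
  also have "(\<Prod>j\<in>{..<n} - {i}. t * (if i < j then t else 1)) = t ^ (n - 1) * t ^ (n - 1 - i)"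
    using assms(1) by (simp add: prod.distrib prod_if_gt)
  finally show "((\<lambda>z. koornwinder_coeff n a b c d q t (x z) i) \<longlongrightarrow> \<alpha> * t ^ (n - 1 - i)) (at 0)"
    using t0 by simp
  have "((\<lambda>z. (1 - a * y z) * (1 - b * y z) * (1 - c * y z) * (1 - d * y z) / (\<alpha> * t ^ (n - 1) * (1 - (y z)^2) * (1 - q * (y z)^2))) \<longlongrightarrow>
      (1 - a * 0) * (1 - b * 0) * (1 - c * 0) * (1 - d * 0) / (\<alpha> * t ^ (n - 1) * (1 - 0^2) * (1 - q * 0^2))) (at 0)"
    by (intro tendsto_intros y0) (use \<alpha>0 t0 in auto)
  then have "((\<lambda>z. (1 - a / x z i) * (1 - b / x z i) * (1 - c / x z i) * (1 - d / x z i) /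
        (\<alpha> * t ^ (n - 1) * (1 - 1 / (x z i)\<^sup>2) * (1 - q / (x z i)\<^sup>2))) \<longlongrightarrow> 1 / (\<alpha> * t ^ (n - 1))) (at 0)"
    by (simp add: y_def power_divide)
  moreover have "((\<lambda>z. \<Prod>j\<in>{..<n} - {i}. (1 - t * x z j / x z i) * (1 - t / (x z i * x z j)) /
           ((1 - x z j / x z i) * (1 - 1 / (x z i * x z j)))) \<longlongrightarrow> (\<Prod>j\<in>{..<n} - {i}. if i < j then 1 else t)) (at 0)"
    unfolding x_def by (intro tendsto_prod pair_limits) (use assms in auto)
  ultimately have "((\<lambda>z. koornwinder_coeff' n a b c d q t (x z) i) \<longlongrightarrow>
     1 / (\<alpha> * t ^ (n - 1)) * (\<Prod>j\<in>{..<n} - {i}. if i < j then 1 else t)) (at 0)"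
    unfolding koornwinder_coeff'_def \<alpha>_def by (rule tendsto_mult)
  also have "1 / (\<alpha> * t ^ (n - 1)) * (\<Prod>j\<in>{..<n} - {i}. if i < j then 1 else t) = 1 / (\<alpha> * t ^ (n - 1 - i))"
  proof -
    have "t ^ (n - 1) = t ^ (n - 1 - i) * t ^ i" using assms(1) by (simp flip: power_add)
    then show ?thesis unfolding prod_if_lt[OF assms(1)] using t0 by simp
  qed
  finally show "((\<lambda>z. koornwinder_coeff' n a b c d q t (x z) i) \<longlongrightarrow> 1 / (\<alpha> * t ^ (n - 1 - i))) (at 0)" .
qed

lemma eventually_regular: "eventually (\<lambda>z. test_point n B z \<in> koornwinder_regular n q) (at 0)"
proof -
  define x where "x = test_point n B"
  have ne: "eventually (\<lambda>z. f z \<noteq> e) (at 0)" if "(f \<longlongrightarrow> 0) (at 0)" "e \<noteq> 0" for f :: "complex \<Rightarrow> complex" and e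
    using tendsto_imp_eventually_ne[OF that(1)] that(2) by auto
  have 1: "eventually (\<lambda>z. (x z i)^2 \<noteq> 1 \<and> q * (x z i)^2 \<noteq> 1 \<and> (x z i)^2 \<noteq> q \<and> x z i \<noteq> 0) (at 0)" if "i < n" for i
  proof -
    have l: "((\<lambda>z. (1 / x z i)^2) \<longlongrightarrow> 0) (at 0)"
      using tendsto_power[OF test_point_limits(1)[OF that], of 2] by (simp add: x_def)
    have "eventually (\<lambda>z. (1 / x z i)^2 \<noteq> 1) (at 0)" "eventually (\<lambda>z. (1 / x z i)^2 \<noteq> 1 / q) (at 0)"
      "eventually (\<lambda>z. (1 / x z i)^2 \<noteq> q) (at 0)"
      by (rule ne[OF l]; use q0 in simp)+
    then show ?thesis using eventually_at_0_nonzero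
    proof eventually_elim
      case (elim z)
      then show ?case using test_point_limits(2)[OF that, of z] q0
        by (auto simp: x_def power_divide field_simps)
    qed
  qed
  have 2: "eventually (\<lambda>z. i \<noteq> j \<longrightarrow> x z i \<noteq> x z j \<and> x z i * x z j \<noteq> 1) (at 0)" if "i < n" "j < n" for i j
  proof (cases "i = j")
    case False
    have "((\<lambda>z. 1 / x z i * (1 / x z j)) \<longlongrightarrow> 0 * 0) (at 0)"
      unfolding x_def by (intro tendsto_mult test_point_limits that)
    then have l: "((\<lambda>z. 1 / x z i * (1 / x z j)) \<longlongrightarrow> 0) (at 0)" by simp
    have "((\<lambda>z. if i < j then x z j / x z i else x z i / x z j) \<longlongrightarrow> 0) (at 0)"
      using False that test_point_ratio_limit[of i j] test_point_ratio_limit[of j i]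
      by (cases "i < j") (auto simp: x_def)
    from ne[OF this one_neq_zero] ne[OF l one_neq_zero] eventually_at_0_nonzero show ?thesis
    proof eventually_elim
      case (elim z)
      then show ?case using test_point_limits(2)[of _ z] that by (auto simp: x_def split: if_splits)
    qed
  qed auto
  have "eventually (\<lambda>z. \<forall>i\<in>{..<n}. (x z i)^2 \<noteq> 1 \<and> q * (x z i)^2 \<noteq> 1 \<and> (x z i)^2 \<noteq> q \<and> x z i \<noteq> 0) (at 0)"
    using 1 by (intro eventually_ball_finite) auto
  moreover have "eventually (\<lambda>z. \<forall>i\<in>{..<n}. \<forall>j\<in>{..<n}. i \<noteq> j \<longrightarrow> x z i \<noteq> x z j \<and> x z i * x z j \<noteq> 1) (at 0)"
    by (intro eventually_ball_finite ballI finite_lessThan) (use 2 in auto)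
  ultimately show ?thesis
    unfolding x_def[symmetric] by eventually_elim (auto simp: koornwinder_regular_def torus_def)
qed

text \<open>Scaling one variable by q or 1/q multiplies the leading coefficient by a power of q
  given by the entry of w. Multiplying the eigenvalue equation by z to the weight of w and letting z
  tend to 0 therefore turns it into an equation between multiples of C w.\<close>

lemma eigenvalue_of_leading_term:
  assumes V: "finite V" "w \<in> V" "\<And>v. v \<in> V \<Longrightarrow> v \<noteq> w \<Longrightarrow> C v \<noteq> 0 \<Longrightarrow> weight n B v < weight n B w"
    and Cw: "C w \<noteq> 0"
    and f: "\<And>x. f x = (\<Sum>v\<in>V. C v * lmonom n v x)"
    and eig: "\<And>x. x \<in> koornwinder_regular n q \<Longrightarrow> koornwinder_op n a b c d q t f x = E * f x"
    and w: "\<And>i. w i = int (l i)"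
  shows "E = koornwinder_eigenvalue n a b c d q t l"
proof -
  define x where "x = test_point n B"
  define \<alpha> where "\<alpha> = koornwinder_alpha a b c d q"
  define M where "M = weight n B w"
  have lim: "((\<lambda>z. z powi M * f (x z)) \<longlongrightarrow> C w) (at 0)"
    unfolding f x_def M_def by (rule tendsto_leading_coeff[OF V])
  have up: "((\<lambda>z. z powi M * f ((x z)(i := e * x z i))) \<longlongrightarrow> e powi w i * C w) (at 0)" if "i < n" for i e
  proof -
    have "((\<lambda>z. z powi M * (\<Sum>v\<in>V. (e powi v i * C v) * lmonom n v (x z))) \<longlongrightarrow> e powi w i * C w) (at 0)"
      unfolding x_def M_def by (rule tendsto_leading_coeff[OF V(1,2)]) (use V(3) in auto)
    moreover have "f ((x z)(i := e * x z i)) = (\<Sum>v\<in>V. (e powi v i * C v) * lmonom n v (x z))" for z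
      unfolding f lmonom_scale[OF that] by (simp add: mult_ac)
    ultimately show ?thesis by simp
  qed
  have "((\<lambda>z. (\<Sum>i<n. koornwinder_coeff n a b c d q t (x z) i * (z powi M * f ((x z)(i := q * x z i)) - z powi M * f (x z))) +
     (\<Sum>i<n. koornwinder_coeff' n a b c d q t (x z) i * (z powi M * f ((x z)(i := 1 / q * x z i)) - z powi M * f (x z)))) \<longlongrightarrow>
     (\<Sum>i<n. \<alpha> * t ^ (n - 1 - i) * (q powi w i * C w - C w)) + (\<Sum>i<n. 1 / (\<alpha> * t ^ (n - 1 - i)) * ((1 / q) powi w i * C w - C w))) (at 0)"
    unfolding x_def \<alpha>_def
    by (intro tendsto_add tendsto_sum tendsto_mult tendsto_diff coeff_limits up[unfolded x_def] lim[unfolded x_def]) auto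
  also have "(\<Sum>i<n. \<alpha> * t ^ (n - 1 - i) * (q powi w i * C w - C w)) + (\<Sum>i<n. 1 / (\<alpha> * t ^ (n - 1 - i)) * ((1 / q) powi w i * C w - C w))
     = koornwinder_eigenvalue n a b c d q t l * C w"
    unfolding koornwinder_eigenvalue_def \<alpha>_def[symmetric] sum_distrib_right sum.distrib[symmetric] w
    by (intro sum.cong refl) (simp add: field_simps power_one_over)
  finally have L1: "((\<lambda>z. (\<Sum>i<n. koornwinder_coeff n a b c d q t (x z) i * (z powi M * f ((x z)(i := q * x z i)) - z powi M * f (x z))) +
     (\<Sum>i<n. koornwinder_coeff' n a b c d q t (x z) i * (z powi M * f ((x z)(i := 1 / q * x z i)) - z powi M * f (x z)))) \<longlongrightarrow>
     koornwinder_eigenvalue n a b c d q t l * C w) (at 0)" .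
  have "((\<lambda>z. E * (z powi M * f (x z))) \<longlongrightarrow> koornwinder_eigenvalue n a b c d q t l * C w) (at 0)"
  proof (rule Lim_transform_eventually[OF L1])
    show "\<forall>\<^sub>F z in at 0. (\<Sum>i<n. koornwinder_coeff n a b c d q t (x z) i * (z powi M * f ((x z)(i := q * x z i)) - z powi M * f (x z))) +
     (\<Sum>i<n. koornwinder_coeff' n a b c d q t (x z) i * (z powi M * f ((x z)(i := 1 / q * x z i)) - z powi M * f (x z))) = E * (z powi M * f (x z))"
      using eventually_regular
    proof eventually_elim
      case (elim z)
      have "z powi M * koornwinder_op n a b c d q t f (x z) = z powi M * (E * f (x z))"
        using eig[of "x z"] elim by (simp add: x_def)
      then show ?case
        unfolding koornwinder_op_altdef by (simp add: distrib_left sum_distrib_left right_diff_distrib mult_ac)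
    qed
  qed
  moreover have "((\<lambda>z. E * (z powi M * f (x z))) \<longlongrightarrow> E * C w) (at 0)"
    by (intro tendsto_intros lim)
  ultimately have "E * C w = koornwinder_eigenvalue n a b c d q t l * C w"
    using tendsto_unique trivial_limit_at by blast
  then show ?thesis using Cw by simp
qed

end

text \<open>An exponent of total absolute value at most r has weight at most r B^n. Equality would
  require the whole amount r, with positive sign, at the first coordinate, since later coordinates
  carry smaller powers of B.\<close>

lemma weight_row:
  assumes n: "n > 0" and B: "B \<ge> 2"
    and v: "v \<in> exponent_box n r" "(\<Sum>i<n. \<bar>v i\<bar>) \<le> int r" "v \<noteq> (\<lambda>i. int (row_partition r i))"
  shows "weight n B v < weight n B (\<lambda>i. int (row_partition r i))"
proof -
  have row: "weight n B (\<lambda>i. int (row_partition r i)) = int r * int B ^ n"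
  proof -
    have "weight n B (\<lambda>i. int (row_partition r i)) = (\<Sum>i<n. if i = 0 then int r * int B ^ n else 0)"
      unfolding weight_def by (intro sum.cong) (auto simp: row_partition_def)
    then show ?thesis using n by simp
  qed
  have le: "v i * int B ^ (n - i) \<le> \<bar>v i\<bar> * int B ^ n" for i
  proof -
    have "int B ^ (n - i) \<le> int B ^ n" using B by (intro power_increasing) auto
    then have "\<bar>v i\<bar> * int B ^ (n - i) \<le> \<bar>v i\<bar> * int B ^ n" by (intro mult_left_mono) auto
    moreover have "v i * int B ^ (n - i) \<le> \<bar>v i\<bar> * int B ^ (n - i)" by (intro mult_right_mono) auto
    ultimately show ?thesis by linarith
  qed
  have tot: "(\<Sum>i<n. \<bar>v i\<bar> * int B ^ n) \<le> int r * int B ^ n"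
    unfolding sum_distrib_right[symmetric] using v(2) by (intro mult_right_mono) auto
  show ?thesis
  proof (cases "\<exists>i<n. i > 0 \<and> v i \<noteq> 0")
    case True
    then obtain i where i: "i < n" "i > 0" "v i \<noteq> 0" by blast
    have "int B ^ (n - i) < int B ^ n" using B i by (intro power_strict_increasing) auto
    then have "\<bar>v i\<bar> * int B ^ (n - i) < \<bar>v i\<bar> * int B ^ n" using i by (intro mult_strict_left_mono) auto
    moreover have "v i * int B ^ (n - i) \<le> \<bar>v i\<bar> * int B ^ (n - i)" by (intro mult_right_mono) auto
    ultimately have "v i * int B ^ (n - i) < \<bar>v i\<bar> * int B ^ n" by linarith
    then have "weight n B v < (\<Sum>i<n. \<bar>v i\<bar> * int B ^ n)"
      unfolding weight_def using le i(1) by (intro sum_strict_mono_ex1) auto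
    with tot row show ?thesis by simp
  next
    case False
    then have z: "v i = 0" if "i \<noteq> 0" for i using that v(1) by (cases "i < n") (auto simp: exponent_box_def)
    then have "v = (\<lambda>i. int (row_partition r i))" if "v 0 = int r"
      using that by (intro ext) (simp add: row_partition_def)
    then have "v 0 \<noteq> int r" using v(3) by blast
    moreover have "\<bar>v 0\<bar> \<le> int r" using v(1) n by (auto simp: exponent_box_def)
    ultimately have "v 0 < int r" by simp
    moreover have "weight n B v = (\<Sum>i<n. if i = 0 then v 0 * int B ^ n else 0)"
      unfolding weight_def by (intro sum.cong) (auto simp: z)
    ultimately show ?thesis using n B row by simp
  qed
qed

text \<open>The coefficients of a candidate polynomial, extended by zero to all partitions in the
  box and with the normalisation 1 at the row built in.\<close>

definition row_coeffs :: "nat \<Rightarrow> nat \<Rightarrow> ((nat \<Rightarrow> nat) \<Rightarrow> complex) \<Rightarrow> (nat \<Rightarrow> nat) \<Rightarrow> complex" where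
  "row_coeffs n r k l = (if l = row_partition r then 1 else if l \<in> lower_partitions n (row_partition r) then k l else 0)"

lemma row_expansion:
  assumes "n > 0"
  shows "orbit_sum n (row_partition r) x + (\<Sum>l\<in>lower_partitions n (row_partition r). k l * orbit_sum n l x) =
    (\<Sum>l\<in>box_partitions n r. row_coeffs n r k l * orbit_sum n l x)"
proof -
  let ?S = "lower_partitions n (row_partition r)"
  have sub: "insert (row_partition r) ?S \<subseteq> box_partitions n r"
    using row_partition_lower(2)[OF assms] by blast
  then have fin: "finite ?S" using finite_subset[OF _ finite_box_partitions, of ?S n r] by blast
  have "(\<Sum>l\<in>box_partitions n r. row_coeffs n r k l * orbit_sum n l x) =
    (\<Sum>l\<in>insert (row_partition r) ?S. row_coeffs n r k l * orbit_sum n l x)"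
    by (rule sum.mono_neutral_right[OF finite_box_partitions sub]) (auto simp: row_coeffs_def)
  also have "\<dots> = row_coeffs n r k (row_partition r) * orbit_sum n (row_partition r) x +
      (\<Sum>l\<in>?S. row_coeffs n r k l * orbit_sum n l x)"
    by (rule sum.insert[OF fin]) (simp add: lower_partitions_def)
  also have "\<dots> = orbit_sum n (row_partition r) x + (\<Sum>l\<in>?S. k l * orbit_sum n l x)"
    by (intro arg_cong2[of _ _ _ _ "(+)"] sum.cong) (auto simp: row_coeffs_def lower_partitions_def)
  finally show ?thesis ..
qed

text \<open>Changing the sign of a negative entry, or exchanging two entries in the wrong order,
  would raise the weight.\<close>

lemma dominant_exponent:
  assumes v: "v \<in> exponent_box n r" and B: "B \<ge> 2"
    and max: "\<And>e p. p permutes {..<n} \<Longrightarrow> (\<And>i. e i \<in> {1, -1}) \<Longrightarrow> weight n B (signed_perm n e p v) \<le> weight n B v"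
  shows "\<exists>l. is_partition n l \<and> v = (\<lambda>i. int (l i))"
proof -
  have nonneg: "v i \<ge> 0" for i
  proof (rule ccontr)
    assume neg: "\<not> v i \<ge> 0"
    then have i: "i < n" using v by (cases "i < n") (auto simp: exponent_box_def)
    have "weight n B v < weight n B (signed_perm n (\<lambda>j. if j = i then -1 else 1) id v)"
      unfolding weight_def
    proof (rule sum_strict_mono_ex1)
      show "\<exists>j\<in>{..<n}. v j * int B ^ (n - j) < signed_perm n (\<lambda>j. if j = i then -1 else 1) id v j * int B ^ (n - j)"
        using i neg B by (intro bexI[of _ i]) (auto simp: signed_perm_def mult_less_0_iff)
    qed (use neg in \<open>auto simp: signed_perm_def intro!: mult_right_mono mult_nonpos_nonneg\<close>)
    moreover have "(if j = i then -1 else 1 :: int) \<in> {1, -1}" for j by simp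
    ultimately show False
      using max[OF permutes_id, of "\<lambda>j. if j = i then -1 else 1"] by simp
  qed
  have anti: "v j \<le> v i" if "i \<le> j" for i j
  proof (rule ccontr)
    assume lt: "\<not> v j \<le> v i"
    then have j: "j < n" using v nonneg[of i] by (cases "j < n") (auto simp: exponent_box_def)
    have ij: "i < j" "i < n" using that lt j by (auto simp: le_less)
    have p: "Transposition.transpose i j permutes {..<n}" using ij j by (intro permutes_swap_id) auto
    define w where "w = signed_perm n (\<lambda>_. 1) (Transposition.transpose i j) v"
    have w: "w k = (if k = i then v j else if k = j then v i else v k)" if "k < n" for k
      using that by (auto simp: w_def signed_perm_def Transposition.transpose_def)
    have I: "finite {..<n}" "i \<in> {..<n}" "j \<in> {..<n} - {i}" using ij j by auto
    have split: "weight n B u = u i * int B ^ (n - i) + (u j * int B ^ (n - j) + (\<Sum>k\<in>{..<n} - {i} - {j}. u k * int B ^ (n - k)))" for u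
      unfolding weight_def using sum.remove[OF I(1,2), of "\<lambda>k. u k * int B ^ (n - k)"]
        sum.remove[OF _ I(3), of "\<lambda>k. u k * int B ^ (n - k)"] by simp
    have rest: "(\<Sum>k\<in>{..<n} - {i} - {j}. w k * int B ^ (n - k)) = (\<Sum>k\<in>{..<n} - {i} - {j}. v k * int B ^ (n - k))"
      by (intro sum.cong) (auto simp: w)
    have "weight n B w - weight n B v = (v j - v i) * (int B ^ (n - i) - int B ^ (n - j))"
      unfolding split rest using w ij j by (simp add: algebra_simps)
    moreover have "int B ^ (n - j) < int B ^ (n - i)" using B ij j by (intro power_strict_increasing) auto
    then have "(v j - v i) * (int B ^ (n - i) - int B ^ (n - j)) > 0" using lt by (intro mult_pos_pos) auto
    ultimately have "weight n B w > weight n B v" by simp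
    with max[OF p, of "\<lambda>_. 1"] show False by (simp add: w_def)
  qed
  have "is_partition n (\<lambda>i. nat (v i))"
    using v anti by (auto simp: is_partition_def antimono_def exponent_box_def intro!: nat_mono)
  moreover have "v = (\<lambda>i. int (nat (v i)))" using nonneg by auto
  ultimately show ?thesis by blast
qed

text \<open>Both candidates have the row as leading exponent, hence the same eigenvalue. If their
  difference has a nonzero coefficient, it is an eigenfunction for this eigenvalue whose leading
  exponent is a strictly lower partition, which nondegeneracy forbids.\<close>

lemma koornwinder_row_unique:
  fixes a b c d q t :: complex
  assumes n: "n > 0" and q0: "q \<noteq> 0" and t0: "t \<noteq> 0" and abcd: "a * b * c * d \<noteq> 0"
    and nondeg: "koornwinder_nondegenerate n (row_partition r) a b c d q t"
    and P: "is_koornwinder n (row_partition r) a b c d q t P"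
    and P': "is_koornwinder n (row_partition r) a b c d q t P'"
  shows "P = P'"
proof -
  define B where "B = 2 * r + 2"
  have B: "B \<ge> 2" by (simp add: B_def)
  define L where "L = lower_partitions n (row_partition r)"
  let ?row = "\<lambda>i. int (row_partition r i)"
  have row_box: "row_partition r \<in> box_partitions n r"
    using row_partition_lower(2)[OF n] by blast
  have row_orbit: "?row \<in> exponent_orbit n (row_partition r)"
    using partition_in_orbit row_partition_lower(1)[OF n] by blast
  have row_of: "partition_of n ?row = row_partition r"
    using partition_of_eq row_partition_lower(1)[OF n] row_orbit by blast
  have row_ebox: "?row \<in> exponent_box n r"
    using orbit_subset_box[OF row_box] row_orbit by blast
  have coeffs: "\<exists>k. (\<forall>x. Q x = (\<Sum>v\<in>exponent_box n r. row_coeffs n r k (partition_of n v) * lmonom n v x)) \<and>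
      (\<forall>x\<in>koornwinder_regular n q. koornwinder_op n a b c d q t Q x = koornwinder_eigenvalue n a b c d q t (row_partition r) * Q x)"
    if Q: "is_koornwinder n (row_partition r) a b c d q t Q" for Q
  proof -
    obtain k E where k: "Q = (\<lambda>x. orbit_sum n (row_partition r) x + (\<Sum>l\<in>L. k l * orbit_sum n l x))"
      and E: "\<And>x. x \<in> koornwinder_regular n q \<Longrightarrow> koornwinder_op n a b c d q t Q x = E * Q x"
      using Q unfolding is_koornwinder_def L_def by blast
    have Qx: "Q x = (\<Sum>v\<in>exponent_box n r. row_coeffs n r k (partition_of n v) * lmonom n v x)" for x
      unfolding k L_def row_expansion[OF n] sum_orbit_sums ..
    have "weight n B v < weight n B ?row"
      if v: "v \<in> exponent_box n r" "v \<noteq> ?row" "row_coeffs n r k (partition_of n v) \<noteq> 0" for v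
    proof -
      obtain l where l: "l \<in> box_partitions n r" "v \<in> exponent_orbit n l" using ex_partition[OF v(1)] by blast
      have "partition_of n v = l" using l by (auto intro!: partition_of_eq simp: box_partitions_def)
      then have "l \<in> insert (row_partition r) (lower_partitions n (row_partition r))"
        using v(3) by (auto simp: row_coeffs_def split: if_splits)
      then have "(\<Sum>i<n. l i) \<le> r" using row_partition_lower(2)[OF n] by blast
      then have "(\<Sum>i<n. \<bar>v i\<bar>) \<le> int r" unfolding orbit_sum_abs[OF l(2)] by (simp del: of_nat_sum)
      then show ?thesis using weight_row[OF n B v(1) _ v(2)] by blast
    qed
    then have "E = koornwinder_eigenvalue n a b c d q t (row_partition r)"
      by (intro eigenvalue_of_leading_term[OF B q0 t0 abcd finite_exponent_box row_ebox _ _ Qx E])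
        (auto simp: row_of row_coeffs_def)
    with Qx E show ?thesis by blast
  qed
  obtain k where k: "\<And>x. P x = (\<Sum>v\<in>exponent_box n r. row_coeffs n r k (partition_of n v) * lmonom n v x)"
    "\<And>x. x \<in> koornwinder_regular n q \<Longrightarrow> koornwinder_op n a b c d q t P x = koornwinder_eigenvalue n a b c d q t (row_partition r) * P x"
    using coeffs[OF P] by blast
  obtain k' where k': "\<And>x. P' x = (\<Sum>v\<in>exponent_box n r. row_coeffs n r k' (partition_of n v) * lmonom n v x)"
    "\<And>x. x \<in> koornwinder_regular n q \<Longrightarrow> koornwinder_op n a b c d q t P' x = koornwinder_eigenvalue n a b c d q t (row_partition r) * P' x"
    using coeffs[OF P'] by blast
  define C where "C = (\<lambda>v. row_coeffs n r k (partition_of n v) - row_coeffs n r k' (partition_of n v))"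
  define V where "V = {v \<in> exponent_box n r. C v \<noteq> 0}"
  have "V = {}"
  proof (rule ccontr)
    assume "V \<noteq> {}"
    have finV: "finite V" using finite_exponent_box by (simp add: V_def)
    \<comment> \<open>An exponent of maximal weight is chosen among those with C v \<noteq> 0. Since
      C is constant on orbits, all its signed permutations compete, so it is a partition.\<close>
    have "Max (weight n B ` V) \<in> weight n B ` V" using finV \<open>V \<noteq> {}\<close> by (intro Max_in) auto
    then obtain w where w0: "w \<in> V" "weight n B w = Max (weight n B ` V)" by auto
    then have w: "w \<in> V" "\<And>v. v \<in> V \<Longrightarrow> weight n B v \<le> weight n B w" using finV by auto
    have wbox: "w \<in> exponent_box n r" "C w \<noteq> 0" using w by (auto simp: V_def)
    obtain l0 where l0: "l0 \<in> box_partitions n r" "w \<in> exponent_orbit n l0" using ex_partition[OF wbox(1)] by blast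
    have p0: "partition_of n v = l0" if "v \<in> exponent_orbit n l0" for v
      using l0(1) that by (auto intro!: partition_of_eq simp: box_partitions_def)
    have "signed_perm n e p w \<in> V" if "p permutes {..<n}" "\<And>i. e i \<in> {1, -1}" for e p
    proof -
      have o: "signed_perm n e p w \<in> exponent_orbit n l0" by (rule signed_perm_orbit[OF l0(2) that])
      then show ?thesis using wbox(2) orbit_subset_box[OF l0(1)] p0[OF o] p0[OF l0(2)] by (auto simp: V_def C_def)
    qed
    then obtain l where l: "is_partition n l" "w = (\<lambda>i. int (l i))"
      using dominant_exponent[OF wbox(1) B] w(2) by blast
    have "l = l0" using p0[OF l0(2)] partition_of_eq[OF l(1) partition_in_orbit[OF l(1)]] l(2) by simp
    then have pl: "partition_of n w = l" using p0[OF l0(2)] by simp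
    \<comment> \<open>Both candidates have coefficient 1 at the row, so C vanishes there and l is a
      lower partition.\<close>
    then have "l \<in> L" using wbox(2) by (auto simp: C_def row_coeffs_def L_def split: if_splits)
    have diff: "P x - P' x = (\<Sum>v\<in>exponent_box n r. C v * lmonom n v x)" for x
      unfolding k k' C_def by (simp add: sum_subtractf left_diff_distrib)
    have op: "koornwinder_op n a b c d q t (\<lambda>x. P x - P' x) x =
        koornwinder_eigenvalue n a b c d q t (row_partition r) * (P x - P' x)" if "x \<in> koornwinder_regular n q" for x
    proof -
      have "koornwinder_op n a b c d q t (\<lambda>x. P x - P' x) x = koornwinder_op n a b c d q t P x - koornwinder_op n a b c d q t P' x"
        by (simp add: koornwinder_op_altdef sum_subtractf right_diff_distrib)
      then show ?thesis using k(2)[OF that] k'(2)[OF that] by (simp add: right_diff_distrib)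
    qed
    have mx: "weight n B v < weight n B w" if "v \<in> exponent_box n r" "v \<noteq> w" "C v \<noteq> 0" for v
      using w(2)[of v] weight_inj[of v n r w] that wbox(1) by (fastforce simp: V_def B_def le_less)
    have "koornwinder_eigenvalue n a b c d q t (row_partition r) = koornwinder_eigenvalue n a b c d q t l"
      by (rule eigenvalue_of_leading_term[OF B q0 t0 abcd finite_exponent_box wbox(1) mx wbox(2) diff op])
        (auto simp: l(2))
    then show False using nondeg \<open>l \<in> L\<close> unfolding koornwinder_nondegenerate_def L_def by auto
  qed
  then have "row_coeffs n r k (partition_of n v) = row_coeffs n r k' (partition_of n v)" if "v \<in> exponent_box n r" for v
    using that by (auto simp: V_def C_def)
  then show ?thesis by (intro ext) (simp add: k(1) k'(1))
qed

section \<open>Expansion in Laurent monomials\<close>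

text \<open>The coefficient of \<open>y\<^sup>m\<close> in the factor of the generating function that belongs to the variable \<open>y\<close>.\<close>
definition orbit_fps :: "complex \<Rightarrow> complex \<Rightarrow> int \<Rightarrow> complex fps" where
  "orbit_fps q t m = Abs_fps (\<lambda>k. \<Sum>p\<le>k. if int p - int (k - p) = m
     then qpoch t q p / qpoch q q p * (qpoch t q (k - p) / qpoch q q (k - p)) else 0)"

lemma orbit_fps_uminus: "orbit_fps q t (- m) = orbit_fps q t m"
proof (rule fps_ext)
  fix k
  have "(\<Sum>p\<le>k. if int p - int (k - p) = - m then qpoch t q p / qpoch q q p * (qpoch t q (k - p) / qpoch q q (k - p)) else 0) =
    (\<Sum>p\<le>k. if int p - int (k - p) = m then qpoch t q p / qpoch q q p * (qpoch t q (k - p) / qpoch q q (k - p)) else 0)"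
    by (rule sum.reindex_bij_witness[of _ "\<lambda>p. k - p" "\<lambda>p. k - p"]) (auto simp: mult.commute)
  then show "fps_nth (orbit_fps q t (- m)) k = fps_nth (orbit_fps q t m) k" by (simp add: orbit_fps_def)
qed

lemma orbit_fps_sign: "e \<in> {1, -1} \<Longrightarrow> orbit_fps q t (e * m) = orbit_fps q t m"
  by (auto simp: orbit_fps_uminus)

lemma orbit_fps_nth_0: "int k < \<bar>m\<bar> \<Longrightarrow> fps_nth (orbit_fps q t m) k = 0"
  unfolding orbit_fps_def fps_nth_Abs_fps by (intro sum.neutral) auto

lemma orbit_fps_nth_top: "fps_nth (orbit_fps q t (int r)) r = qpoch t q r / qpoch q q r"
proof -
  have "fps_nth (orbit_fps q t (int r)) r = (\<Sum>p\<le>r. if p = r then qpoch t q r / qpoch q q r else 0)"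
    unfolding orbit_fps_def fps_nth_Abs_fps by (intro sum.cong) auto
  then show ?thesis by simp
qed

text \<open>Exponents with absolute value above r first occur in degrees above r, so cutting the sum
  at r does not change the coefficients up to r.\<close>

lemma qbinom_pair_nth:
  assumes "y \<noteq> 0" "k \<le> r"
  shows "fps_nth (qbinom_fps q t y * qbinom_fps q t (1 / y)) k =
    fps_nth (\<Sum>m\<in>{- int r..int r}. fps_const (y powi m) * orbit_fps q t m) k"
proof -
  define f where "f = (\<lambda>p. qpoch t q p / qpoch q q p)"
  have "fps_nth (qbinom_fps q t y * qbinom_fps q t (1 / y)) k = (\<Sum>p\<le>k. f p * f (k - p) * y powi (int p - int (k - p)))"
  proof -
    have "y ^ p * (1 / y) ^ l = y powi (int p - int l)" for p l
      using assms(1) by (simp add: power_int_diff power_one_over)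
    then have "f p * y ^ p * (f l * (1 / y) ^ l) = f p * f l * y powi (int p - int l)" for p l
      by (metis (no_types, opaque_lifting) mult.assoc mult.left_commute)
    moreover have "qpoch t q p / qpoch q q p = f p" for p by (simp add: f_def)
    ultimately show ?thesis
      unfolding fps_mult_nth atLeast0AtMost qbinom_fps_def fps_nth_Abs_fps by (simp only:)
  qed
  also have "\<dots> = (\<Sum>p\<le>k. \<Sum>m\<in>{- int r..int r}. if int p - int (k - p) = m then f p * f (k - p) * y powi m else 0)"
    using assms(2) by (intro sum.cong refl) (subst sum.delta', auto)
  also have "\<dots> = (\<Sum>m\<in>{- int r..int r}. \<Sum>p\<le>k. if int p - int (k - p) = m then f p * f (k - p) * y powi m else 0)"
    by (rule sum.swap)
  also have "\<dots> = (\<Sum>m\<in>{- int r..int r}. y powi m * fps_nth (orbit_fps q t m) k)"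
    by (intro sum.cong refl) (simp add: orbit_fps_def f_def sum_distrib_left if_distrib mult_ac cong: if_cong)
  finally show ?thesis by (simp add: fps_sum_nth)
qed

lemma fps_prod_nth_cong:
  fixes f g :: "nat \<Rightarrow> complex fps"
  assumes "\<And>i j. i \<in> A \<Longrightarrow> j \<le> k \<Longrightarrow> fps_nth (f i) j = fps_nth (g i) j"
  shows "fps_nth (\<Prod>i\<in>A. f i) k = fps_nth (\<Prod>i\<in>A. g i) k"
  using assms
proof (induction A arbitrary: k rule: infinite_finite_induct)
  case (insert i A)
  have "fps_nth (f i) j = fps_nth (g i) j" "fps_nth (\<Prod>i\<in>A. f i) j = fps_nth (\<Prod>i\<in>A. g i) j" if "j \<le> k" for j
    using insert.IH[of j] insert.prems that by auto
  then show ?case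
    unfolding prod.insert[OF insert.hyps] fps_mult_nth by (intro sum.cong) auto
qed auto

lemma fps_prod_nth_eq_0:
  fixes f :: "nat \<Rightarrow> complex fps"
  assumes "\<And>i j. i \<in> A \<Longrightarrow> j < d i \<Longrightarrow> fps_nth (f i) j = 0" "k < (\<Sum>i\<in>A. d i)"
  shows "fps_nth (\<Prod>i\<in>A. f i) k = 0"
  using assms
proof (induction A arbitrary: k rule: infinite_finite_induct)
  case (insert i A)
  have "fps_nth (f i) j * fps_nth (\<Prod>i\<in>A. f i) (k - j) = 0" if "j \<le> k" for j
  proof (cases "j < d i")
    case False
    then have "k - j < (\<Sum>i\<in>A. d i)" using insert.prems(2) insert.hyps that by simp
    then show ?thesis using insert.IH insert.prems(1) by simp
  qed (use insert.prems(1) in auto)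
  then show ?case
    unfolding prod.insert[OF insert.hyps] fps_mult_nth by (intro sum.neutral) auto
qed auto

text \<open>Up to degree r each factor is a finite sum over powers of one variable. Multiplying
  these sums out gives one term for each exponent in the box.\<close>

lemma gen_fps_nth:
  assumes "x \<in> torus n" "k \<le> r"
  shows "fps_nth (gen_fps n q t x) k = (\<Sum>v\<in>exponent_box n r. lmonom n v x * fps_nth (\<Prod>i<n. orbit_fps q t (v i)) k)"
proof -
  define I where "I = {- int r..int r}"
  have "fps_nth (gen_fps n q t x) k = fps_nth (\<Prod>i<n. \<Sum>m\<in>I. fps_const (x i powi m) * orbit_fps q t m) k"
    unfolding gen_fps_def I_def using assms by (intro fps_prod_nth_cong qbinom_pair_nth) (auto simp: torus_def)
  also have "(\<Prod>i<n. \<Sum>m\<in>I. fps_const (x i powi m) * orbit_fps q t m) =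
      (\<Sum>v\<in>PiE {..<n} (\<lambda>_. I). \<Prod>i<n. fps_const (x i powi v i) * orbit_fps q t (v i))"
    by (rule prod_sum_PiE) (auto simp: I_def)
  also have "\<dots> = (\<Sum>v\<in>exponent_box n r. \<Prod>i<n. fps_const (x i powi v i) * orbit_fps q t (v i))"
    by (rule sum.reindex_bij_witness[of _ "\<lambda>v. restrict v {..<n}" "\<lambda>v i. if i < n then v i else 0"])
      (auto simp: exponent_box_def I_def PiE_iff extensional_def fun_eq_iff abs_le_iff minus_le_iff split: if_splits)
  also have "\<dots> = (\<Sum>v\<in>exponent_box n r. fps_const (lmonom n v x) * (\<Prod>i<n. orbit_fps q t (v i)))"
  proof (intro sum.cong refl)
    fix v
    have "(\<Prod>i\<in>A. fps_const (x i powi v i)) = fps_const (\<Prod>i\<in>A. x i powi v i)" for A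
      by (induction A rule: infinite_finite_induct) (simp_all add: fps_const_mult[symmetric] del: fps_const_mult)
    then show "(\<Prod>i<n. fps_const (x i powi v i) * orbit_fps q t (v i)) = fps_const (lmonom n v x) * (\<Prod>i<n. orbit_fps q t (v i))"
      by (simp add: prod.distrib lmonom_def)
  qed
  finally show ?thesis by (simp add: fps_sum_nth)
qed

definition laurent_coeff :: "nat \<Rightarrow> complex \<Rightarrow> complex \<Rightarrow> complex \<Rightarrow> complex \<Rightarrow> nat \<Rightarrow> (nat \<Rightarrow> int) \<Rightarrow> complex" where
  "laurent_coeff n q t a s r v = fps_nth (row_fps q t a s * (\<Prod>i<n. orbit_fps q t (v i))) r"

lemma row_fun_laurent:
  assumes "x \<in> torus n"
  shows "row_fun n q t a s r x = (\<Sum>v\<in>exponent_box n r. laurent_coeff n q t a s r v * lmonom n v x)"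
proof -
  have "row_fun n q t a s r x = (\<Sum>k=0..r. fps_nth (row_fps q t a s) k *
     (\<Sum>v\<in>exponent_box n r. lmonom n v x * fps_nth (\<Prod>i<n. orbit_fps q t (v i)) (r - k)))"
    unfolding row_fun_def fps_mult_nth by (intro sum.cong refl) (simp add: gen_fps_nth[OF assms])
  also have "\<dots> = (\<Sum>v\<in>exponent_box n r. laurent_coeff n q t a s r v * lmonom n v x)"
    unfolding sum_distrib_left by (subst sum.swap) (simp add: laurent_coeff_def fps_mult_nth sum_distrib_left sum_distrib_right mult_ac)
  finally show ?thesis .
qed

lemma laurent_coeff_signed_perm:
  assumes "p permutes {..<n}" "\<And>i. e i \<in> {1, -1}"
  shows "laurent_coeff n q t a s r (signed_perm n e p v) = laurent_coeff n q t a s r v"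
proof -
  have "(\<Prod>i<n. orbit_fps q t (signed_perm n e p v i)) = (\<Prod>i<n. orbit_fps q t (v (p i)))"
    using assms(2) by (intro prod.cong refl) (simp add: signed_perm_def orbit_fps_sign)
  also have "\<dots> = (\<Prod>i<n. orbit_fps q t (v i))"
    using prod.permute[OF assms(1), of "\<lambda>i. orbit_fps q t (v i)"] by (simp add: o_def)
  finally show ?thesis by (simp add: laurent_coeff_def)
qed

text \<open>The factor \<open>orbit_fps q t (v i)\<close> starts in degree \<bar>v i\<bar>. This is
  the triangularity of the explicit sum.\<close>

lemma laurent_coeff_eq_0:
  assumes "(\<Sum>i<n. \<bar>v i\<bar>) > int r"
  shows "laurent_coeff n q t a s r v = 0"
proof -
  have "int (\<Sum>i<n. nat \<bar>v i\<bar>) > int r" using assms by simp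
  then have gt: "r < (\<Sum>i<n. nat \<bar>v i\<bar>)" by (simp only: of_nat_less_iff)
  have "fps_nth (\<Prod>i<n. orbit_fps q t (v i)) j = 0" if "j \<le> r" for j
    by (rule fps_prod_nth_eq_0[where d = "\<lambda>i. nat \<bar>v i\<bar>"]) (use gt that in \<open>auto intro!: orbit_fps_nth_0\<close>)
  then show ?thesis unfolding laurent_coeff_def fps_mult_nth by (intro sum.neutral) auto
qed

text \<open>For the row the product of the factors starts in degree r, so only constant terms of the
  other factors contribute. This is the origin of the normalising constant (q; q)_r / (t;
  q)_r.\<close>

lemma laurent_coeff_row:
  assumes "n > 0" "s \<noteq> 1"
  shows "laurent_coeff n q t a s r (\<lambda>i. int (row_partition r i)) = qpoch t q r / qpoch q q r"
proof -
  have split: "(\<Prod>i<n. orbit_fps q t (int (row_partition r i))) = orbit_fps q t (int r) * orbit_fps q t 0 ^ (n - 1)"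
  proof -
    have "{..<n} = insert 0 ({..<n} - {0})" using assms by auto
    then have "(\<Prod>i<n. orbit_fps q t (int (row_partition r i))) =
        orbit_fps q t (int (row_partition r 0)) * (\<Prod>i\<in>{..<n}-{0}. orbit_fps q t (int (row_partition r i)))"
      by (metis finite_Diff finite_lessThan insert_Diff_single insert_iff prod.remove)
    also have "(\<Prod>i\<in>{..<n}-{0}. orbit_fps q t (int (row_partition r i))) = (\<Prod>i\<in>{..<n}-{0}. orbit_fps q t 0)"
      by (intro prod.cong) (auto simp: row_partition_def)
    finally show ?thesis using assms by (simp add: row_partition_def)
  qed
  have R0: "fps_nth (row_fps q t a s) 0 = 1"
    using assms by (simp add: row_fps_def row_coeff_def)
  have low: "fps_nth (orbit_fps q t (int r)) j = 0" if "j < r" for j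
    using that by (intro orbit_fps_nth_0) auto
  have P: "fps_nth (orbit_fps q t (int r) * g) j = (if j < r then 0 else fps_nth (orbit_fps q t (int r)) r * fps_nth g 0)"
    if "j \<le> r" for j g
  proof -
    have "(\<Sum>i=0..j. fps_nth (orbit_fps q t (int r)) i * fps_nth g (j - i)) =
       (\<Sum>i=0..j. if i = r then fps_nth (orbit_fps q t (int r)) r * fps_nth g 0 else 0)"
      using that by (intro sum.cong refl) (auto simp: low)
    then show ?thesis unfolding fps_mult_nth using that by auto
  qed
  have "laurent_coeff n q t a s r (\<lambda>i. int (row_partition r i)) =
      fps_nth (orbit_fps q t (int r) * (orbit_fps q t 0 ^ (n - 1) * row_fps q t a s)) r"
    unfolding laurent_coeff_def split by (simp add: mult_ac)
  also have "\<dots> = qpoch t q r / qpoch q q r"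
  proof -
    have "fps_nth (orbit_fps q t 0) 0 = 1" by (simp add: orbit_fps_def)
    then show ?thesis using P[of r] R0 by (simp add: orbit_fps_nth_top fps_nth_power_0)
  qed
  finally show ?thesis .
qed

section \<open>The explicit sum as the Koornwinder polynomial of the row\<close>

lemma row_fun_sum:
  "row_fun n q t a s r x = (\<Sum>(i, j)\<in>{(i, j). i + 2 * j \<le> r}. fps_nth (gen_fps n q t x) (r - i - 2 * j) * row_coeff q t a s i j)"
proof -
  define g where "g = (\<lambda>k. fps_nth (gen_fps n q t x) k)"
  have "row_fun n q t a s r x = (\<Sum>k\<le>r. \<Sum>i\<le>k. if even (k - i) then row_coeff q t a s i ((k - i) div 2) * g (r - k) else 0)"
    unfolding row_fun_def fps_mult_nth atLeast0AtMost row_fps_def fps_nth_Abs_fps sum_distrib_right g_def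
    by (intro sum.cong refl) auto
  also have "\<dots> = (\<Sum>(k, i)\<in>Sigma {..r} (\<lambda>k. {..k}). if even (k - i) then row_coeff q t a s i ((k - i) div 2) * g (r - k) else 0)"
    by (rule sum.Sigma) auto
  also have "\<dots> = (\<Sum>(k, i)\<in>{(k, i). k \<le> r \<and> i \<le> k \<and> even (k - i)}. row_coeff q t a s i ((k - i) div 2) * g (r - k))"
    by (rule sum.mono_neutral_cong_right) (auto split: if_splits)
  also have "\<dots> = (\<Sum>(i, j)\<in>{(i, j). i + 2 * j \<le> r}. g (r - i - 2 * j) * row_coeff q t a s i j)"
    by (rule sum.reindex_bij_witness[of _ "\<lambda>(i, j). (i + 2 * j, i)" "\<lambda>(k, i). (i, (k - i) div 2)"])
      (auto simp: mult.commute)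
  finally show ?thesis by (simp add: g_def)
qed

text \<open>P is built from orbit sums, because the definition asks for this form as an equality of
  functions at all points, whereas the Laurent expansion of \<open>row_fun\<close> is established on
  the torus. There the two agree up to the normalising constant.\<close>

lemma is_koornwinder_row_fun:
  fixes q t a :: complex
  assumes n: "n > 0" and q: "norm q < 1" and gen: "generic_params n r a q t"
  defines "s \<equiv> t powi (- int n) * q powi (- int r)"
  shows "\<exists>P. is_koornwinder n (row_partition r) (- 1) a (- csqrt q) (csqrt q) q t P \<and>
     (\<forall>x\<in>torus n. P x = qpoch q q r / qpoch t q r * row_fun n q t a s r x)"
proof -
  have a0: "a \<noteq> 0" and q0: "q \<noteq> 0" and t0: "t \<noteq> 0" and tr: "\<And>k. k < r \<Longrightarrow> t * q ^ k \<noteq> 1"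
    and tn: "\<And>k. k \<in> {1..r} \<Longrightarrow> t ^ (n - 1) * q ^ k \<noteq> 1" and tnr: "t ^ n * q ^ r \<noteq> 1"
    and ta: "\<And>k. k \<in> {r..<2 * r} \<Longrightarrow> a * t ^ (2 * n - 2) * q ^ k \<noteq> 1"
    using gen by (auto simp: generic_params_def)
  have s: "s * (t ^ n * q ^ r) = 1"
    using t0 q0 by (simp add: s_def power_int_minus field_simps)
  have s1: "s \<noteq> 1" using s tnr by auto
  have tn1: "t ^ n = t * t ^ (n - 1)" using n by (metis Suc_diff_1 power_Suc)
  have ts1: "t * s * (t ^ (n - 1) * q ^ r) = 1" using s unfolding tn1 by (simp add: mult_ac)
  have ts: "t * s * q ^ l \<noteq> 1" if "l < r" for l
  proof
    assume e: "t * s * q ^ l = 1"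
    have "q ^ r = q ^ l * q ^ (r - l)" using that by (simp flip: power_add)
    then have "t ^ (n - 1) * q ^ (r - l) = (t * s * q ^ l) * (t ^ (n - 1) * q ^ (r - l))" using e by simp
    also have "\<dots> = 1" using ts1 \<open>q ^ r = _\<close> by (simp add: mult_ac)
    finally have "t ^ (n - 1) * q ^ (r - l) = 1" .
    moreover have "r - l \<in> {1..r}" using that by auto
    ultimately show False using tn by blast
  qed
  have as: "t^2 * s^2 * q * q ^ l \<noteq> a" if "l < r" for l
  proof
    assume e: "t^2 * s^2 * q * q ^ l = a"
    \<comment> \<open>The reflection l to 2 r - 1 - l maps the range below r onto the range from r
      to 2 r - 1 in which genericity is formulated.\<close>
    define k where "k = 2 * r - Suc l"
    have k: "k \<in> {r..<2 * r}" "2 * r = Suc l + k" using that by (auto simp: k_def)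
    have "a * t ^ (2 * n - 2) * q ^ k = t^2 * s^2 * t ^ (2 * (n - 1)) * (q * q ^ l * q ^ k)"
      unfolding e[symmetric] by (simp add: diff_mult_distrib2 mult_ac)
    also have "q * q ^ l * q ^ k = q ^ (2 * r)" unfolding k(2) by (simp add: power_add)
    also have "t^2 * s^2 * t ^ (2 * (n - 1)) * q ^ (2 * r) = (t * s * (t ^ (n - 1) * q ^ r))^2"
      by (simp only: power_even_eq power_mult_distrib mult.assoc)
    finally show False using ta[OF k(1)] ts1 by simp
  qed
  define c0 where "c0 = qpoch q q r / qpoch t q r"
  have qq: "qpoch q q r \<noteq> 0" using norm_less_1_power_neq_1[OF q, of "Suc _"] by (auto simp: qpoch_eq_0_iff mult.commute)
  have tq: "qpoch t q r \<noteq> 0" using tr by (auto simp: qpoch_eq_0_iff mult.commute)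
  define k where "k = (\<lambda>l. c0 * laurent_coeff n q t a s r (\<lambda>i. int (l i)))"
  define P where "P = (\<lambda>x. orbit_sum n (row_partition r) x + (\<Sum>l\<in>lower_partitions n (row_partition r). k l * orbit_sum n l x))"
  have Px: "P x = (\<Sum>v\<in>exponent_box n r. row_coeffs n r k (partition_of n v) * lmonom n v x)" for x
    unfolding P_def row_expansion[OF n] sum_orbit_sums ..
  have coeff: "row_coeffs n r k (partition_of n v) = c0 * laurent_coeff n q t a s r v" if v: "v \<in> exponent_box n r" for v
  proof -
    obtain l where l: "l \<in> box_partitions n r" "v \<in> exponent_orbit n l" using ex_partition[OF v] by blast
    have pl: "partition_of n v = l" using l by (auto intro!: partition_of_eq simp: box_partitions_def)
    have inv: "laurent_coeff n q t a s r v = laurent_coeff n q t a s r (\<lambda>i. int (l i))"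
      using l(2) laurent_coeff_signed_perm by (auto simp: exponent_orbit_altdef)
    show ?thesis
    proof (cases "(\<Sum>i<n. l i) \<le> r")
      case True
      then have "l \<in> insert (row_partition r) (lower_partitions n (row_partition r))"
        using row_partition_lower(2)[OF n] l(1) by blast
      moreover have "c0 * laurent_coeff n q t a s r (\<lambda>i. int (row_partition r i)) = 1"
        using laurent_coeff_row[OF n s1] qq tq by (simp add: c0_def)
      ultimately show ?thesis unfolding pl inv row_coeffs_def k_def by auto
    next
      case False
      then have "l \<notin> insert (row_partition r) (lower_partitions n (row_partition r))"
        using row_partition_lower(2)[OF n] by blast
      moreover have "(\<Sum>i<n. \<bar>v i\<bar>) > int r" unfolding orbit_sum_abs[OF l(2)] using False by (simp del: of_nat_sum)
      ultimately show ?thesis unfolding pl by (simp add: row_coeffs_def laurent_coeff_eq_0)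
    qed
  qed
  have P_row: "P x = c0 * row_fun n q t a s r x" if "x \<in> torus n" for x
    unfolding Px row_fun_laurent[OF that] sum_distrib_left by (intro sum.cong refl) (simp add: coeff)
  have "laurent_poly n P"
    unfolding laurent_poly_def
    by (intro exI[of _ "exponent_box n r"] exI[of _ "\<lambda>v. row_coeffs n r k (partition_of n v)"]
      conjI ext finite_exponent_box Px)
  moreover have "perm_inv_invariant n P"
  proof -
    have "perm_inv_invariant n (orbit_sum n l)" if "l \<in> insert (row_partition r) (lower_partitions n (row_partition r))" for l
    proof -
      have "l \<in> box_partitions n r" using row_partition_lower(2)[OF n, of r] that by simp
      then show ?thesis by (rule orbit_sum_invariant)
    qed
    then show ?thesis unfolding P_def perm_inv_invariant_def by simp
  qed
  moreover have "\<exists>E. \<forall>x\<in>koornwinder_regular n q. koornwinder_op n (- 1) a (- csqrt q) (csqrt q) q t P x = E * P x"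
  proof (cases "r = 0")
    \<comment> \<open>For r = 0 genericity leaves t = 1 possible, which \<open>row_fun_eigen\<close>
      excludes. But P is then constant on the torus and is annihilated by the operator.\<close>
    case True
    have const: "row_fun n q t a s r x = row_fun n q t a s r y" for x y
    proof -
      have "fps_nth (gen_fps n q t x) 0 = fps_nth (gen_fps n q t y) 0"
        unfolding gen_fps_def by (rule fps_prod_nth_cong) (simp add: qbinom_fps_def)
      then show ?thesis using True by (simp add: row_fun_def)
    qed
    have "P (x(i := z)) = P x" if "x \<in> torus n" "z \<noteq> 0" for x i z
    proof -
      have "x(i := z) \<in> torus n" using that by (auto simp: torus_def)
      from P_row[OF this] show ?thesis using P_row[OF that(1)] const[of "x(i := z)" x] by simp
    qed
    then have "koornwinder_op n (- 1) a (- csqrt q) (csqrt q) q t P x = 0 * P x" if "x \<in> koornwinder_regular n q" for x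
      unfolding koornwinder_op_altdef using that q0 by (auto simp: koornwinder_regular_def torus_def intro!: sum.neutral)
    then show ?thesis by blast
  next
    case False
    then have t1: "t \<noteq> 1" using tr[of 0] by simp
    have "koornwinder_op n (- 1) a (- csqrt q) (csqrt q) q t P x =
       (1 / csqrt a * (a / (t * s) + t * s - (a * t ^ (n - 1) + 1 / t ^ (n - 1)))) * P x"
      if x: "x \<in> koornwinder_regular n q" for x
    proof -
      have xt: "x \<in> torus n" using x by (simp add: koornwinder_regular_def)
      have P1: "P (x(i := q * x i)) = c0 * row_fun n q t a s r (x(i := q * x i))"
        "P (x(i := x i / q)) = c0 * row_fun n q t a s r (x(i := x i / q))" if "i < n" for i
        using xt q0 that by (auto intro!: P_row simp: torus_def)
      have sm: "(\<Sum>i<n. kappaB n a q t x i (x i) * (P (x(i := q * x i)) - P x) + kappaB n a q t x i (1 / x i) * (P (x(i := x i / q)) - P x)) =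
        c0 * (\<Sum>i<n. kappaB n a q t x i (x i) * (row_fun n q t a s r (x(i := q * x i)) - row_fun n q t a s r x)
        + kappaB n a q t x i (1 / x i) * (row_fun n q t a s r (x(i := x i / q)) - row_fun n q t a s r x))"
        unfolding sum_distrib_left by (intro sum.cong refl) (simp add: P1 P_row[OF xt] algebra_simps)
      have "(\<Sum>i<n. kappaB n a q t x i (x i) * (row_fun n q t a s r (x(i := q * x i)) - row_fun n q t a s r x)
        + kappaB n a q t x i (1 / x i) * (row_fun n q t a s r (x(i := x i / q)) - row_fun n q t a s r x)) =
        (a / (t * s) + t * s - (a * t ^ (n - 1) + 1 / t ^ (n - 1))) * row_fun n q t a s r x"
        by (rule row_fun_eigen[OF q q0 t0 t1 n a0 s s1 ts as x])
      then show ?thesis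
        unfolding koornwinder_op_B[OF q0] sm by (simp add: P_row[OF xt])
    qed
    then show ?thesis by blast
  qed
  ultimately have "is_koornwinder n (row_partition r) (- 1) a (- csqrt q) (csqrt q) q t P"
    unfolding is_koornwinder_def by (intro conjI exI[of _ k] P_def)
  then show ?thesis using P_row unfolding c0_def by (intro exI[of _ P] conjI ballI)
qed

lemma macdonald_B_row:
  fixes q t a :: complex
  assumes n: "n > 0" and q: "norm q < 1" and gen: "generic_params n r a q t" and x: "x \<in> torus n"
  defines "s \<equiv> t powi (- int n) * q powi (- int r)"
  shows "macdonald_B n (row_partition r) a q t x = qpoch q q r / qpoch t q r *
     (\<Sum>(i, j)\<in>{(i, j). i + 2 * j \<le> r}. G_poly n q t (r - i - 2 * j) x * row_coeff q t a s i j)"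
proof -
  obtain P where P: "is_koornwinder n (row_partition r) (- 1) a (- csqrt q) (csqrt q) q t P"
     "\<And>x. x \<in> torus n \<Longrightarrow> P x = qpoch q q r / qpoch t q r * row_fun n q t a s r x"
    using is_koornwinder_row_fun[OF n q gen] unfolding s_def by blast
  have a0: "a \<noteq> 0" and q0: "q \<noteq> 0" and t0: "t \<noteq> 0"
    and nd: "koornwinder_nondegenerate n (row_partition r) (- 1) a (- csqrt q) (csqrt q) q t"
    using gen by (auto simp: generic_params_def)
  have "macdonald_B n (row_partition r) a q t = P"
    unfolding macdonald_B_def koornwinder_def
    by (rule the_equality[where P = "is_koornwinder n (row_partition r) (- 1) a (- csqrt q) (csqrt q) q t", OF P(1)])
      (rule koornwinder_row_unique[OF n q0 t0 _ nd _ P(1)], use a0 q0 in auto)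
  then show ?thesis
    using P(2)[OF x] unfolding row_fun_sum G_poly_eq[OF q] by simp
qed

theorem theorem5p5:
  fixes n r :: nat and x :: "nat \<Rightarrow> complex" and a q t :: complex
  assumes "n > 0" and "norm q < 1" and "x \<in> torus n"
  shows "(generic_params n r a q t \<longrightarrow>
    macdonald_B n (row_partition r) a q t x =
      qpoch q q r / qpoch t q r *
      (\<Sum>(i, j) \<in> {(i, j). i + 2 * j \<le> r}.
         G_poly n q t (r - i - 2 * j) x *
         ((qpoch a q i *
           qpoch (t powi (- int n) * q powi (- int r)) q (i + j) *
           qpoch (t powi (- 2 * int n + 2) * q powi (- 2 * int r)) q i *
           qpoch (1 / t) q j) /
          (qpoch q q i *
           qpoch (t powi (- int n + 1) * q powi (- int r)) q i *
           qpoch (q ^ i * (t powi (- int n + 1) * q powi (- int r + 1))) q j *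
           qpoch (t powi (- 2 * int n + 2) * q powi (- 2 * int r + 1) / a) q i *
           qpoch q q j)) *
         ((1 - t powi (- int n) * q powi (- int r + int i + 2 * int j)) /
          (1 - t powi (- int n) * q powi (- int r))) *
         (t / a) ^ i * (t\<^sup>2 / q) ^ j)) \<and>
   (generic_params n r 1 q t \<longrightarrow>
    macdonald_D n (row_partition r) q t x =
      qpoch q q r / qpoch t q r *
      (\<Sum>j \<in> {j. 2 * j \<le> r}.
         G_poly n q t (r - 2 * j) x *
         ((qpoch (t powi (- int n) * q powi (- int r)) q j * qpoch (1 / t) q j) /
          (qpoch (t powi (- int n + 1) * q powi (- int r + 1)) q j * qpoch q q j)) *
         ((1 - t powi (- int n) * q powi (- int r + 2 * int j)) /
          (1 - t powi (- int n) * q powi (- int r))) *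
         (t\<^sup>2 / q) ^ j))"
proof (intro conjI impI)
  define s where "s = t powi (- int n) * q powi (- int r)"
  have powers: "t powi (- 2 * int n + 2) * q powi (- 2 * int r) = t^2 * s^2"
    "t powi (- int n + 1) * q powi (- int r) = t * s"
    "t powi (- int n + 1) * q powi (- int r + 1) = t * s * q"
    "t powi (- 2 * int n + 2) * q powi (- 2 * int r + 1) = t^2 * s^2 * q"
    "t powi (- int n) * q powi (- int r + int i + 2 * int j) = s * q ^ (i + 2 * j)"
    "t powi (- int n) * q powi (- int r + 2 * int j) = s * q ^ (2 * j)"
    if "t \<noteq> 0" "q \<noteq> 0" for i j
  proof -
    have add: "t powi (k + l) = t powi k * t powi l" "q powi (k + l) = q powi k * q powi l" for k l
      using that by (simp_all add: power_int_add)
    have sq: "t powi (- 2 * int n) * q powi (- 2 * int r) = s^2"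
    proof -
      have "z powi (- 2 * int k) = (z powi (- int k))^2" if "z \<noteq> 0" for z :: complex and k
      proof -
        have "- 2 * int k = - int k + - int k" by simp
        moreover have "z powi (- int k + - int k) = z powi (- int k) * z powi (- int k)"
          by (rule power_int_add) (use that in simp)
        ultimately show ?thesis by (simp only: power2_eq_square)
      qed
      then show ?thesis using that by (simp add: s_def power_mult_distrib)
    qed
    show "t powi (- 2 * int n + 2) * q powi (- 2 * int r) = t^2 * s^2"
      "t powi (- 2 * int n + 2) * q powi (- 2 * int r + 1) = t^2 * s^2 * q"
      unfolding sq[symmetric] add by simp_all
    show "t powi (- int n + 1) * q powi (- int r) = t * s"
      "t powi (- int n + 1) * q powi (- int r + 1) = t * s * q"
      unfolding s_def add by simp_all
    have "q powi (2 * int j) = q ^ (2 * j)" by (metis of_nat_mult of_nat_numeral power_int_of_nat)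
    then show "t powi (- int n) * q powi (- int r + int i + 2 * int j) = s * q ^ (i + 2 * j)"
      "t powi (- int n) * q powi (- int r + 2 * int j) = s * q ^ (2 * j)"
      unfolding s_def add by (simp_all add: power_add)
  qed
  {
    assume gen: "generic_params n r a q t"
    then have tq: "t \<noteq> 0" "q \<noteq> 0" by (auto simp: generic_params_def)
    show "macdonald_B n (row_partition r) a q t x =
      qpoch q q r / qpoch t q r *
      (\<Sum>(i, j) \<in> {(i, j). i + 2 * j \<le> r}.
         G_poly n q t (r - i - 2 * j) x *
         ((qpoch a q i *
           qpoch (t powi (- int n) * q powi (- int r)) q (i + j) *
           qpoch (t powi (- 2 * int n + 2) * q powi (- 2 * int r)) q i *
           qpoch (1 / t) q j) /
          (qpoch q q i *
           qpoch (t powi (- int n + 1) * q powi (- int r)) q i *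
           qpoch (q ^ i * (t powi (- int n + 1) * q powi (- int r + 1))) q j *
           qpoch (t powi (- 2 * int n + 2) * q powi (- 2 * int r + 1) / a) q i *
           qpoch q q j)) *
         ((1 - t powi (- int n) * q powi (- int r + int i + 2 * int j)) /
          (1 - t powi (- int n) * q powi (- int r))) *
         (t / a) ^ i * (t\<^sup>2 / q) ^ j)"
      unfolding powers(1-5)[OF tq] s_def[symmetric]
      unfolding macdonald_B_row[OF assms(1,2) gen assms(3), folded s_def] row_coeff_def
      by (simp only: mult.assoc)
  }
  {
    assume gen: "generic_params n r 1 q t"
    then have tq: "t \<noteq> 0" "q \<noteq> 0" by (auto simp: generic_params_def)
    have q1: "qpoch 1 q i = 0" if "i > 0" for i using that by (auto simp: qpoch_eq_0_iff)
    have "(\<Sum>(i, j)\<in>{(i, j). i + 2 * j \<le> r}. G_poly n q t (r - i - 2 * j) x * row_coeff q t 1 s i j) =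
      (\<Sum>(i, j)\<in>Pair 0 ` {j. 2 * j \<le> r}. G_poly n q t (r - i - 2 * j) x * row_coeff q t 1 s i j)"
    proof (rule sum.mono_neutral_right)
      have "{(i, j). i + 2 * j \<le> r} \<subseteq> {..r} \<times> {..r}" by auto
      then show "finite {(i, j). i + 2 * j \<le> r}" using finite_subset by blast
      show "\<forall>p\<in>{(i, j). i + 2 * j \<le> r} - Pair 0 ` {j. 2 * j \<le> r}.
         (case p of (i, j) \<Rightarrow> G_poly n q t (r - i - 2 * j) x * row_coeff q t 1 s i j) = 0"
        using q1 by (auto simp: row_coeff_def image_iff)
    qed auto
    also have "\<dots> = (\<Sum>j\<in>{j. 2 * j \<le> r}. G_poly n q t (r - 2 * j) x * row_coeff q t 1 s 0 j)"
      by (subst sum.reindex) (auto simp: inj_on_def)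
    finally show "macdonald_D n (row_partition r) q t x =
      qpoch q q r / qpoch t q r *
      (\<Sum>j \<in> {j. 2 * j \<le> r}.
         G_poly n q t (r - 2 * j) x *
         ((qpoch (t powi (- int n) * q powi (- int r)) q j * qpoch (1 / t) q j) /
          (qpoch (t powi (- int n + 1) * q powi (- int r + 1)) q j * qpoch q q j)) *
         ((1 - t powi (- int n) * q powi (- int r + 2 * int j)) /
          (1 - t powi (- int n) * q powi (- int r))) *
         (t\<^sup>2 / q) ^ j)"
      unfolding powers(3,6)[OF tq] s_def[symmetric] macdonald_D_def
      unfolding macdonald_B_row[OF assms(1,2) gen assms(3), folded s_def]
      by (simp add: row_coeff_def mult.assoc)
  }
qed

end
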